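(* Let $K \subset \mathbb{R}^2$ be any convex shape, and let $Q \subset \mathbb{R}^2$ be either an arbitrary (convex) quadrilateral or an affinely regular hexagon (the image of a regular hexagon under an invertible affine map). Then \[ \operatorname{area} K \cdot \operatorname{area} Q \ge \frac12\, c(K \times Q)^2 . \]
   Context: A convex shape is a compact convex subset of $\mathbb{R}^2$ with non-empty interior. For convex shapes $K,Q\subset\mathbb{R}^2$, $c(K\times Q)$ denotes the Ekeland--Hofer--Zehnder symplectic capacity of the lagrangian product $K\times Q\subset \mathbb{R}^2_q\times\mathbb{R}^2_p$ (with standard symplectic form $dq_1\wedge dp_1+dq_2\wedge dp_2$): the minimal action $\int p\,dq$ of a closed (generalized) characteristic on the boundary $\partial(K\times Q)$, where for non-smooth boundaries characteristics are defined via the differential inclusion $\dot\gamma(t)\in J\,N_{K\times Q}(\gamma(t))$ with $N$ the outward normal cone and $J(q,p)=(-p,q)$. Equivalently, $c(K\times Q)$ is the minimal $Q$-length of a closed generalized $Q$-Minkowski billiard orbit in the billiard table $K$, where the $Q$-length of a vector $x$ is $\|x\|_Q=\max_{y\in Q}\langle x,y\rangle$. *)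

theory Defs
  imports "HOL-Analysis.Analysis"
begin

text \<open>Points of the plane are of type real^2; phase space R^4 = R^2_q x R^2_p
  is modelled as the product type (real^2) x (real^2).\<close>

definition convex_shape :: "(real^2) set \<Rightarrow> bool" where
  "convex_shape K \<longleftrightarrow> convex K \<and> compact K \<and> interior K \<noteq> {}"

definition normal_cone :: "'a::real_inner set \<Rightarrow> 'a \<Rightarrow> 'a set" where
  "normal_cone C x = {v. \<forall>y\<in>C. inner v (y - x) \<le> 0}"

definition Jmap :: "(real^2) \<times> (real^2) \<Rightarrow> (real^2) \<times> (real^2)" where
  "Jmap z = (- snd z, fst z)"

definition abs_continuous_on :: "real \<Rightarrow> real \<Rightarrow> (real \<Rightarrow> 'a::real_normed_vector) \<Rightarrow> bool" where
  "abs_continuous_on a b f \<longleftrightarrow>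
     (\<forall>e>0. \<exists>d>0. \<forall>(n::nat) (u::nat \<Rightarrow> real) v.
        (\<forall>i<n. a \<le> u i \<and> u i \<le> v i \<and> v i \<le> b) \<and>
        (\<forall>i<n. \<forall>j<n. i \<noteq> j \<longrightarrow> v i \<le> u j \<or> v j \<le> u i) \<and>
        (\<Sum>i<n. v i - u i) < d
        \<longrightarrow> (\<Sum>i<n. norm (f (v i) - f (u i))) < e)"

definition closed_characteristic ::
  "((real^2) \<times> (real^2)) set \<Rightarrow> real \<Rightarrow> (real \<Rightarrow> (real^2) \<times> (real^2)) \<Rightarrow> bool" where
  "closed_characteristic C T \<gamma> \<longleftrightarrow>
     T > 0 \<and> \<gamma> 0 = \<gamma> T \<and>
     (\<forall>t\<in>{0..T}. \<gamma> t \<in> frontier C) \<and>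
     abs_continuous_on 0 T \<gamma> \<and>
     (\<exists>t\<in>{0..T}. \<gamma> t \<noteq> \<gamma> 0) \<and>
     (AE t in lebesgue. t \<in> {0..T} \<longrightarrow>
        \<gamma> differentiable (at t) \<and>
        vector_derivative \<gamma> (at t) \<in> Jmap ` normal_cone C (\<gamma> t))"

definition action :: "real \<Rightarrow> (real \<Rightarrow> (real^2) \<times> (real^2)) \<Rightarrow> real" where
  "action T \<gamma> = integral {0..T} (\<lambda>t. inner (snd (\<gamma> t)) (fst (vector_derivative \<gamma> (at t))))"

text \<open>EHZ capacity of the lagrangian product K x Q: the minimal action of a closed
  characteristic on its boundary.  The action is taken in absolute value, since with
  J(q,p)=(-p,q) and the form dq/\dp the integral of p dq along characteristics is
  of constant sign (negative); the capacity is its (positive) size.\<close>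
definition ehz_lagr :: "(real^2) set \<Rightarrow> (real^2) set \<Rightarrow> real" where
  "ehz_lagr K Q = Inf {\<bar>action T \<gamma>\<bar> | T \<gamma>. closed_characteristic (K \<times> Q) T \<gamma>}"

definition area :: "(real^2) set \<Rightarrow> real" where
  "area S = measure lebesgue S"

definition convex_quadrilateral :: "(real^2) set \<Rightarrow> bool" where
  "convex_quadrilateral Q \<longleftrightarrow>
     (\<exists>S. finite S \<and> card S = 4 \<and> Q = convex hull S \<and>
          (\<forall>x\<in>S. x \<notin> convex hull (S - {x})))"

definition regular_hexagon :: "(real^2) set" where
  "regular_hexagon = convex hull ((\<lambda>k::nat. vector [cos (real k * pi / 3), sin (real k * pi / 3)]) ` {..<6})"

definition affinely_regular_hexagon :: "(real^2) set \<Rightarrow> bool" where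
  "affinely_regular_hexagon Q \<longleftrightarrow>
     (\<exists>(M::real^2^2) b. invertible M \<and> Q = (\<lambda>x. M *v x + b) ` regular_hexagon)"

end

theory Submission
  imports Defs
begin

text \<open>
  A shortest triangle (in the sense of \<open>Q\<close>-length) without a translate in the interior of \<open>K\<close> is a closed billiard
  orbit, so it yields a closed characteristic.  Hence \<open>K\<close> contains a translate of every triangle of \<open>Q\<close>-length at most
  \<open>c = ehz_lagr K Q\<close>, and the area of a convex set containing translates of suitable triangles of this length must be
  bounded from below.

  For a quadrilateral, four triangles suffice: if three sides of \<open>Q\<close> bound a triangle around \<open>Q\<close>, turn it by a right
  angle, rescale it to length \<open>c\<close> and take it together with its reflection.  Three area bounds, obtained from
  parallel chords of \<open>K\<close>, are linear in the unknown translations, and a positive combination of them is free of these.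

  For a hexagon, use segments (traversed twice) normal to the three pairs of sides and the two triangles with sides
  parallel to these segments.
\<close>

section \<open>Areas of planar convex sets\<close>

text \<open>The translations in \<open>K\<close> are unknown and independent of each other, so an
  area bound must hold for all placements. The chord bounds are arranged so that a misplaced point
  only contributes a nonpositive term: they stay linear in the positions, which can then be
  eliminated. For a hexagon linearity is lost: in coordinates where \<open>e1\<close>,
  \<open>e2\<close> are the standard basis, three crossing segments span the area
  \<open>3/4 + a * d - \<beta> * \<gamma>\<close>, which can drop below the target. The triangles
  exclude the bad placements or fill the deficit with caps.

  The targets come from the area of \<open>Q\<close>. A quadrilateral with diagonals
  \<open>u\<close>, \<open>w\<close> has area \<open>\<bar>crs u w\<bar> / 2\<close>, so
  \<open>C\<^sup>2 \<le> \<bar>crs u w\<bar> * area K\<close> is wanted, where \<open>C\<close> is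
  the capacity. For a hexagon with segments \<open>e1\<close>, \<open>e2\<close>,
  \<open>e1 - e2\<close> the product \<open>\<bar>crs e1 e2\<bar> * area Q\<close> is 3/4 of
  \<open>C\<^sup>2\<close>, so \<open>area K\<close> has to reach 2/3 of
  \<open>\<bar>crs e1 e2\<bar>\<close>. The 2/3 that scales the triangles has another source: a
  segment traversed twice has two edges of length \<open>C / 2\<close>, a triangle three edges of
  length \<open>C / 3\<close>.\<close>

definition crs :: "real^2 \<Rightarrow> real^2 \<Rightarrow> real" where
  "crs x y = x$1 * y$2 - x$2 * y$1"

lemma crs_simps:
  "crs (x + y) z = crs x z + crs y z" "crs x (y + z) = crs x y + crs x z"
  "crs (x - y) z = crs x z - crs y z" "crs x (y - z) = crs x y - crs x z"
  "crs (- x) y = - crs x y" "crs x (- y) = - crs x y"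
  "crs (r *\<^sub>R x) y = r * crs x y" "crs x (r *\<^sub>R y) = r * crs x y"
  "crs x x = 0" "crs 0 x = 0" "crs x 0 = 0"
  by (simp_all add: crs_def algebra_simps)

lemma crs_anti: "crs y x = - crs x y"
  by (simp add: crs_def)

text \<open>For fixed \<open>l\<close> the form \<open>crs l\<close> is constant along
  \<open>l\<close>, so it measures heights over lines parallel to \<open>l\<close>. As an inner
  product it gives access to the facts on half-spaces.\<close>

lemma crs_inner: "crs l x = vector [- l$2, l$1] \<bullet> x"
  by (simp add: crs_def inner_vec_def sum_2)

lemma area_nonneg: "0 \<le> area S"
  by (simp add: area_def)

lemma area_mono: "compact S \<Longrightarrow> compact T \<Longrightarrow> S \<subseteq> T \<Longrightarrow> area S \<le> area T"
  unfolding area_def by (intro measure_mono_fmeasurable) (auto simp: lmeasurable_compact fmeasurableD)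

lemma area_triangle: "area (convex hull {a,b,c}) = \<bar>crs (b - a) (c - a)\<bar> / 2"
proof -
  have cp: "compact (convex hull {a,b,c})"
    by (intro finite_imp_compact_convex_hull) auto
  have "area (convex hull {a,b,c}) = measure lborel (convex hull {a,b,c})"
    unfolding area_def using cp by (intro measure_completion) (auto dest: compact_imp_closed)
  also have "\<dots> = \<bar>crs (b - a) (c - a)\<bar> / 2"
    unfolding content_triangle crs_def by (auto simp: abs_minus_commute mult.commute)
  finally show ?thesis .
qed

lemma area_triangle_le:
  assumes "convex S" "compact S" "a \<in> S" "b \<in> S" "c \<in> S"
  shows "\<bar>crs (b - a) (c - a)\<bar> / 2 \<le> area S"
proof -
  have "compact (convex hull {a,b,c})" by (intro finite_imp_compact_convex_hull) auto
  moreover have "convex hull {a,b,c} \<subseteq> S" using assms by (intro hull_minimal) auto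
  ultimately show ?thesis using area_mono[OF _ assms(2)] by (simp add: area_triangle[symmetric])
qed

lemma convex_compact_upper:
  assumes "convex S" "compact S"
  shows "convex (S \<inter> {x. t \<le> crs l x})" "compact (S \<inter> {x. t \<le> crs l x})"
  using assms unfolding crs_inner
  by (auto intro!: convex_Int compact_Int_closed convex_halfspace_ge closed_halfspace_ge)

lemma convex_compact_lower:
  assumes "convex S" "compact S"
  shows "convex (S \<inter> {x. crs l x \<le> t})" "compact (S \<inter> {x. crs l x \<le> t})"
  using assms unfolding crs_inner
  by (auto intro!: convex_Int compact_Int_closed convex_halfspace_le closed_halfspace_le)

lemma area_split:
  assumes "compact S" "l \<noteq> 0"
  shows "area S = area (S \<inter> {x. t \<le> crs l x}) + area (S \<inter> {x. crs l x \<le> t})"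
proof -
  let ?A = "S \<inter> {x. t \<le> crs l x}" and ?B = "S \<inter> {x. crs l x \<le> t}"
  have lm: "?A \<in> lmeasurable" "?B \<in> lmeasurable"
    using assms(1) unfolding crs_inner
    by (auto intro!: lmeasurable_compact compact_Int_closed closed_halfspace_le closed_halfspace_ge)
  have ne: "vector [- l$2, l$1] \<noteq> (0 :: real^2)"
    using assms(2) by (auto simp: vec_eq_iff forall_2)
  have neg: "negligible (?A \<inter> ?B)"
  proof (rule negligible_subset)
    show "negligible {x::real^2. vector [- l$2, l$1] \<bullet> x = t}"
      using ne by (intro negligible_hyperplane) blast
  qed (auto simp: crs_inner)
  have "S = ?A \<union> ?B" by auto
  then have "area S = measure lebesgue (?A \<union> ?B)" by (simp add: area_def)
  also have "\<dots> = measure lebesgue ?A + measure lebesgue ?B"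
    using lm neg by (simp add: measure_Un3 negligible_imp_measure0)
  finally show ?thesis by (simp add: area_def)
qed

section \<open>Area bounds from parallel chords\<close>

text \<open>The diagonal from \<open>z + l\<close> to \<open>q\<close> cuts the trapezoid into two
  triangles with bases \<open>l\<close> and \<open>\<alpha> *\<^sub>R l\<close> and equal heights.
  The line of this diagonal, with direction \<open>m\<close>, cuts \<open>S\<close> into two parts
  that hold one triangle each.\<close>

lemma area_trapezoid_le:
  assumes S: "convex S" "compact S"
    and in_S: "z \<in> S" "z + l \<in> S" "q \<in> S" "q + \<alpha> *\<^sub>R l \<in> S"
    and "0 \<le> \<alpha>" "crs l z \<le> crs l q"
  shows "(1 + \<alpha>) * crs l (q - z) / 2 \<le> area S"
proof (cases "crs l (q - z) = 0")
  case True
  then show ?thesis by (simp add: area_nonneg)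
next
  case False
  then have pos: "crs l (q - z) > 0" using assms by (simp add: crs_simps)
  define m where "m = q - z - l"
  have m: "m \<noteq> 0"
  proof
    assume "m = 0"
    then have "q - z = l" by (simp add: m_def)
    then show False using False by (simp add: crs_simps)
  qed
  let ?A = "S \<inter> {x. crs m q \<le> crs m x}" and ?B = "S \<inter> {x. crs m x \<le> crs m q}"
  have 1: "crs m z - crs m q = crs l (q - z)" "crs m (z + l) = crs m q"
     "crs m (q + \<alpha> *\<^sub>R l) - crs m q = - \<alpha> * crs l (q - z)"
    by (simp_all add: m_def crs_def algebra_simps)
  have "- \<alpha> * crs l (q - z) \<le> 0" using pos \<open>0 \<le> \<alpha>\<close> by simp
  then have mem: "z \<in> ?A" "z + l \<in> ?A" "q \<in> ?A" "z + l \<in> ?B" "q \<in> ?B" "q + \<alpha> *\<^sub>R l \<in> ?B"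
    using in_S 1 pos by auto
  have "\<bar>crs (z + l - z) (q - z)\<bar> / 2 \<le> area ?A"
    by (rule area_triangle_le[OF convex_compact_upper[OF S] mem(1-3)])
  moreover have "\<bar>crs (q - (z + l)) (q + \<alpha> *\<^sub>R l - (z + l))\<bar> / 2 \<le> area ?B"
    by (rule area_triangle_le[OF convex_compact_lower[OF S] mem(4-6)])
  moreover have "crs (q - (z + l)) (q + \<alpha> *\<^sub>R l - (z + l)) = - (\<alpha> * crs l (q - z))"
    by (simp add: crs_def algebra_simps)
  moreover have "\<bar>\<alpha> * crs l (q - z)\<bar> = \<alpha> * crs l (q - z)" using pos \<open>0 \<le> \<alpha>\<close> by simp
  ultimately show ?thesis using area_split[OF S(2) m, of "crs m q"] pos by (simp add: algebra_simps add_divide_distrib)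
qed

text \<open>The trapezoid between the chords and the triangle with apex \<open>r\<close> over the
  shorter chord have these areas in sum. If \<open>q\<close> or \<open>r\<close> lies too low, the
  terms lost are nonpositive, so the same linear bound covers every position.\<close>

lemma area_above_chord:
  assumes S: "convex S" "compact S"
    and in_S: "z \<in> S" "z + l \<in> S" "q \<in> S" "q + \<alpha> *\<^sub>R l \<in> S" "r \<in> S"
    and \<alpha>: "0 \<le> \<alpha>" "\<alpha> \<le> 1"
  shows "(crs l (q - z) + \<alpha> * crs l (r - z)) / 2 \<le> area (S \<inter> {x. crs l z \<le> crs l x})"
proof -
  let ?U = "S \<inter> {x. crs l z \<le> crs l x}"
  note U = convex_compact_upper[OF S, of "crs l z" l]
  have [simp]: "crs l (z + l) = crs l z" "crs l (q + \<alpha> *\<^sub>R l) = crs l q" by (simp_all add: crs_simps)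
  show ?thesis
  proof (cases "crs l z \<le> crs l q")
    case False
    show ?thesis
    proof (cases "crs l z \<le> crs l r")
      case True
      then have "\<bar>crs (z + l - z) (r - z)\<bar> / 2 \<le> area ?U"
        using in_S by (intro area_triangle_le U) auto
      \<comment> \<open>With \<open>q\<close> too low, the triangle over the full chord replaces the
        trapezoid; this is where \<open>\<alpha> \<le> 1\<close> enters.\<close>
      moreover have "\<alpha> * crs l (r - z) \<le> 1 * crs l (r - z)"
        using \<alpha> True by (intro mult_right_mono) (auto simp: crs_simps)
      moreover have "crs l (q - z) \<le> 0" using False by (simp add: crs_simps)
      ultimately show ?thesis by auto
    next
      case r: False
      then have "\<alpha> * crs l (r - z) \<le> 0" using \<alpha> by (intro mult_nonneg_nonpos) (auto simp: crs_simps)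
      moreover have "crs l (q - z) \<le> 0" using False by (simp add: crs_simps)
      ultimately show ?thesis using area_nonneg[of ?U] by argo
    qed
  next
    case True
    show ?thesis
    proof (cases "l = 0")
      case True
      then show ?thesis by (simp add: crs_simps area_nonneg)
    next
      case l: False
      let ?A = "?U \<inter> {x. crs l q \<le> crs l x}" and ?B = "?U \<inter> {x. crs l x \<le> crs l q}"
      have B: "(1 + \<alpha>) * crs l (q - z) / 2 \<le> area ?B"
        using in_S True \<alpha> by (intro area_trapezoid_le convex_compact_lower U) auto
      have A: "\<alpha> * crs l (r - q) / 2 \<le> area ?A"
      proof (cases "crs l q \<le> crs l r")
        case r: True
        then have "\<bar>crs (q + \<alpha> *\<^sub>R l - q) (r - q)\<bar> / 2 \<le> area ?A"
          using in_S True by (intro area_triangle_le convex_compact_upper U) auto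
        then show ?thesis unfolding crs_simps add_diff_cancel_left' by (simp add: algebra_simps)
      next
        case r: False
        then have "\<alpha> * crs l (r - q) \<le> 0" using \<alpha> by (intro mult_nonneg_nonpos) (auto simp: crs_simps)
        then show ?thesis using area_nonneg[of ?A] by argo
      qed
      have "area ?U = area ?A + area ?B" by (rule area_split[OF U(2) l])
      then show ?thesis using A B by (simp add: crs_simps algebra_simps add_divide_distrib diff_divide_distrib)
    qed
  qed
qed

lemma area_below_chord:
  assumes S: "convex S" "compact S"
    and in_S: "z \<in> S" "z + l \<in> S" "q \<in> S" "q + \<alpha> *\<^sub>R l \<in> S" "r \<in> S"
    and \<alpha>: "0 \<le> \<alpha>" "\<alpha> \<le> 1"
  shows "(crs l (z - q) + \<alpha> * crs l (z - r)) / 2 \<le> area (S \<inter> {x. crs l x \<le> crs l z})"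
proof -
  have "(crs (- l) (q + \<alpha> *\<^sub>R l - (z + l)) + \<alpha> * crs (- l) (r - (z + l))) / 2
      \<le> area (S \<inter> {x. crs (- l) (z + l) \<le> crs (- l) x})"
    using assms by (intro area_above_chord) auto
  then show ?thesis by (simp add: crs_simps)
qed

text \<open>Between the chords of direction \<open>l\<close> lies a parallelogram, which counts
  their distance twice. The bounds above the upper and below the lower chord together subtract it
  \<open>1 + \<alpha>\<close> times, which leaves the factor \<open>1 - \<alpha>\<close>. For
  \<open>\<alpha> = 0\<close> and \<open>z = z'\<close> this is a bound on the width transverse to a
  chord.\<close>

lemma area_chords:
  assumes K: "convex K" "compact K"
    and z: "z \<in> K" "z + l \<in> K" "z' \<in> K" "z' + l \<in> K"
    and q: "q \<in> K" "q + \<alpha> *\<^sub>R l \<in> K" "q' \<in> K" "q' + \<alpha> *\<^sub>R l \<in> K"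
    and r: "r \<in> K" "r' \<in> K"
    and \<alpha>: "0 \<le> \<alpha>" "\<alpha> \<le> 1"
  shows "(1 - \<alpha>) * crs l (z - z') + crs l (q - q') + \<alpha> * crs l (r - r') \<le> 2 * area K"
proof (cases "l = 0")
  case True
  then show ?thesis by (simp add: crs_simps area_nonneg)
next
  case l: False
  have main: "(1 - \<alpha>) * crs l (a - b) + crs l (q - q') + \<alpha> * crs l (r - r') \<le> 2 * area K"
    if ab: "a \<in> K" "a + l \<in> K" "b \<in> K" "b + l \<in> K" "crs l b \<le> crs l a" for a b
  proof -
    let ?U = "K \<inter> {x. crs l a \<le> crs l x}" and ?D = "K \<inter> {x. crs l x \<le> crs l a}"
    let ?M = "?D \<inter> {x. crs l b \<le> crs l x}" and ?L = "?D \<inter> {x. crs l x \<le> crs l b}"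
    note D = convex_compact_lower[OF K, of l "crs l a"]
    have "area K = area ?U + area ?D" by (rule area_split[OF K(2) l])
    moreover have "area ?D = area ?M + area ?L" by (rule area_split[OF D(2) l])
    moreover have "(crs l (q - a) + \<alpha> * crs l (r - a)) / 2 \<le> area ?U"
      using ab q r \<alpha> by (intro area_above_chord K) auto
    moreover have "?L = K \<inter> {x. crs l x \<le> crs l b}" using ab by auto
    moreover have "(crs l (b - q') + \<alpha> * crs l (b - r')) / 2 \<le> area (K \<inter> {x. crs l x \<le> crs l b})"
      using ab q r \<alpha> by (intro area_below_chord K) auto
    moreover have "(1 + 1) * crs l (a - b) / 2 \<le> area ?M"
      using ab by (intro area_trapezoid_le convex_compact_upper D) (auto simp: crs_simps)
    ultimately show ?thesis
      by (simp add: crs_simps algebra_simps add_divide_distrib diff_divide_distrib)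
  qed
  show ?thesis
  proof (cases "crs l z' \<le> crs l z")
    case True
    then show ?thesis using main z by blast
  next
    case False
    \<comment> \<open>If the chords come in the other order, exchanging them only enlarges the
      left-hand side.\<close>
    then have "(1 - \<alpha>) * crs l (z - z') \<le> (1 - \<alpha>) * crs l (z' - z)"
      using \<alpha> by (intro mult_left_mono) (auto simp: crs_simps)
    then show ?thesis using main[OF z(3,4,1,2)] False by fastforce
  qed
qed

text \<open>The chord bound is applied in the directions \<open>k'\<close>, \<open>- k\<close> and
  \<open>\<alpha> *\<^sub>R k' - k\<close>, the last being the side of the first triangle opposite
  to \<open>O1\<close>. The unknown positions enter all three bounds only through the two numbers
  \<open>X\<close> and \<open>Y\<close>.\<close>

lemma area_four_triangles:
  assumes K: "convex K" "compact K"
    and O1: "O1 \<in> K" "O1 + k \<in> K" "O1 + \<alpha> *\<^sub>R k' \<in> K"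
    and P1: "P1 \<in> K" "P1 - k \<in> K" "P1 - \<alpha> *\<^sub>R k' \<in> K"
    and O2: "O2 \<in> K" "O2 + k' \<in> K" "O2 + \<delta> *\<^sub>R k \<in> K"
    and P2: "P2 \<in> K" "P2 - k' \<in> K" "P2 - \<delta> *\<^sub>R k \<in> K"
    and \<alpha>: "0 \<le> \<alpha>" "\<alpha> < 1" and \<delta>: "0 \<le> \<delta>" "\<delta> < 1"
  shows "(1 - \<alpha> * \<delta>) * crs k' k \<le> (2 - \<alpha> - \<delta>) * area K"
proof -
  define D where "D = crs k' k"
  define X where "X = - crs k (P1 - O1) - crs k (P2 - O2)"
  define Y where "Y = crs k' (P1 - O1) + crs k' (P2 - O2)"
  have kk: "crs k' k = D" "crs k k' = - D" by (simp_all add: D_def crs_anti[of k k'])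
  have "(1 - \<alpha>) * crs k' ((P2 - k') - O2) + crs k' ((P1 - \<alpha> *\<^sub>R k') - O1)
        + \<alpha> * crs k' ((O1 + k) - (P1 - k)) \<le> 2 * area K"
    using assms by (intro area_chords) auto
  then have I: "2 * \<alpha> * D + (1 - \<alpha>) * Y \<le> 2 * area K"
    by (simp only: crs_simps Y_def kk) (simp add: algebra_simps)
  have "(1 - \<delta>) * crs (- k) (P1 - (O1 + k)) + crs (- k) (P2 - (O2 + \<delta> *\<^sub>R k))
        + \<delta> * crs (- k) ((O2 + k') - (P2 - k')) \<le> 2 * area K"
    using assms by (intro area_chords) auto
  then have II: "2 * \<delta> * D + (1 - \<delta>) * X \<le> 2 * area K"
    by (simp only: crs_simps X_def kk) (simp add: algebra_simps)
  have "(1 - 0) * crs (\<alpha> *\<^sub>R k' - k) ((O1 + k) - (P1 - \<alpha> *\<^sub>R k'))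
     + crs (\<alpha> *\<^sub>R k' - k) ((O2 + k') - (P2 - k')) + 0 * crs (\<alpha> *\<^sub>R k' - k) (O1 - O1) \<le> 2 * area K"
    using assms by (intro area_chords) (auto simp: algebra_simps)
  then have III: "(2 + 2 * \<alpha>) * D - X - \<alpha> * Y \<le> 2 * area K"
    by (simp only: crs_simps X_def Y_def kk) (simp add: algebra_simps)
  \<comment> \<open>The weights are chosen to cancel \<open>X\<close> and \<open>Y\<close>; the
    coefficients of \<open>D\<close> then add up to
    \<open>2 * (1 - \<alpha> * \<delta>)\<close>.\<close>
  have "(1 - \<alpha>) * (1 - \<delta>) * ((2 + 2 * \<alpha>) * D - X - \<alpha> * Y) + (1 - \<alpha>) * (2 * \<delta> * D + (1 - \<delta>) * X)
      + \<alpha> * (1 - \<delta>) * (2 * \<alpha> * D + (1 - \<alpha>) * Y)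
     \<le> (1 - \<alpha>) * (1 - \<delta>) * (2 * area K) + (1 - \<alpha>) * (2 * area K) + \<alpha> * (1 - \<delta>) * (2 * area K)"
    using \<alpha> \<delta> by (intro add_mono mult_left_mono I II III) auto
  then show ?thesis by (simp add: kk algebra_simps)
qed

section \<open>Triangles with disjoint interiors inside a convex set\<close>

lemma linear_form_crs: "A * z$1 + B * z$2 = crs (vector [B, - A]) z" for z :: "real^2"
  by (simp add: crs_def)

lemma convex_compact_ge:
  assumes "convex S" "compact S"
  shows "convex (S \<inter> {z::real^2. t \<le> A * z$1 + B * z$2})" "compact (S \<inter> {z::real^2. t \<le> A * z$1 + B * z$2})"
  unfolding linear_form_crs by (rule convex_compact_upper[OF assms])+

lemma convex_compact_le:
  assumes "convex S" "compact S"
  shows "convex (S \<inter> {z::real^2. A * z$1 + B * z$2 \<le> t})" "compact (S \<inter> {z::real^2. A * z$1 + B * z$2 \<le> t})"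
  unfolding linear_form_crs by (rule convex_compact_lower[OF assms])+

lemma area_split_form:
  assumes "compact S" "A \<noteq> 0 \<or> B \<noteq> 0"
  shows "area S = area (S \<inter> {z. t \<le> A * z$1 + B * z$2}) + area (S \<inter> {z. A * z$1 + B * z$2 \<le> t})"
proof -
  have "vector [B, - A] \<noteq> (0 :: real^2)" using assms(2) by (auto simp: vec_eq_iff forall_2)
  then show ?thesis unfolding linear_form_crs by (rule area_split[OF assms(1)])
qed

lemma negligible_line:
  assumes "A \<noteq> 0 \<or> B \<noteq> 0"
  shows "negligible {z::real^2. A * z$1 + B * z$2 = t}"
proof -
  have "vector [A, B] \<noteq> (0 :: real^2)" using assms by (auto simp: vec_eq_iff forall_2)
  then have "negligible {z::real^2. vector [A, B] \<bullet> z = t}"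
    by (intro negligible_hyperplane) blast
  then show ?thesis by (simp add: inner_vec_def sum_2)
qed

lemma area_packing:
  assumes "finite I" "compact K" "\<And>i. i \<in> I \<Longrightarrow> compact (C i)" "\<And>i. i \<in> I \<Longrightarrow> C i \<subseteq> K"
    and "\<And>i j. i \<in> I \<Longrightarrow> j \<in> I \<Longrightarrow> i \<noteq> j \<Longrightarrow> negligible (C i \<inter> C j)"
  shows "(\<Sum>i\<in>I. area (C i)) \<le> area K"
proof -
  have "(\<Sum>i\<in>I. area (C i)) = measure lebesgue (\<Union>(C ` I))"
    unfolding area_def using assms
    by (intro measure_negligible_finite_Union_image[symmetric]) (auto simp: pairwise_def lmeasurable_compact)
  also have "\<dots> = area (\<Union>(C ` I))" by (simp add: area_def)
  also have "\<dots> \<le> area K" using assms by (intro area_mono compact_UN) auto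
  finally show ?thesis .
qed

lemma triangle_le:
  assumes "\<And>z. z \<in> {a,b,c} \<Longrightarrow> A * z$1 + B * z$2 \<le> (t::real)" and "x \<in> convex hull {a,b,c::real^2}"
  shows "A * x$1 + B * x$2 \<le> t"
proof -
  have "convex hull {a,b,c} \<subseteq> UNIV \<inter> {z::real^2. A * z$1 + B * z$2 \<le> t}"
    using assms(1) unfolding linear_form_crs crs_inner
    by (intro hull_minimal) (auto intro: convex_halfspace_le)
  then show ?thesis using assms(2) by auto
qed

text \<open>A line that weakly separates the vertices of two triangles contains their
  intersection.\<close>

lemma negligible_triangles_Int:
  fixes a b c a' b' c' :: "real^2"
  assumes "A \<noteq> 0 \<or> B \<noteq> 0"
    and "\<And>z. z \<in> {a,b,c} \<Longrightarrow> A * z$1 + B * z$2 \<le> t"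
    and "\<And>z. z \<in> {a',b',c'} \<Longrightarrow> t \<le> A * z$1 + B * z$2"
  shows "negligible (convex hull {a,b,c} \<inter> convex hull {a',b',c'})"
proof (rule negligible_subset[OF negligible_line[OF assms(1)]], safe)
  fix x assume "x \<in> convex hull {a,b,c}" "x \<in> convex hull {a',b',c'}"
  moreover from triangle_le[of a' b' c' "- A" "- B" "- t" x] assms(3)
  have "x \<in> convex hull {a',b',c'} \<Longrightarrow> t \<le> A * x$1 + B * x$2" by fastforce
  ultimately show "A * x$1 + B * x$2 = t" using triangle_le[OF assms(2)] by fastforce
qed

abbreviation pt :: "real \<Rightarrow> real \<Rightarrow> real^2" where "pt x y \<equiv> vector [x, y]"

lemma pt_simps [simp]:
  "pt x y - pt x' y' = pt (x - x') (y - y')" "pt x y + pt x' y' = pt (x + x') (y + y')"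
  "- pt x y = pt (- x) (- y)" "r *\<^sub>R pt x y = pt (r * x) (r * y)"
  "crs (pt x y) (pt x' y') = x * y' - y * x'"
  by (simp_all add: vec_eq_iff forall_2 crs_def)

text \<open>
  This is monotonicity of the mixed area, \<open>V(K, T) \<le> V(K, K)\<close>, for a triangle \<open>T\<close> in \<open>K\<close>.
  The caps over the sides of \<open>T\<close> are built over points of \<open>K\<close> farthest from these sides; this makes
  any two caps separable by a line through the common vertex, even if both lie beyond both sides.
\<close>
lemma area_triangle_caps:
  assumes K: "convex K" "compact K" and "\<tau> > 0"
    and t: "pt x y \<in> K" "pt (x - \<tau>) y \<in> K" "pt x (y - \<tau>) \<in> K"
    and p: "p \<in> K" "q \<in> K" "r \<in> K"
  shows "\<tau> * (p$1 + q$2 - (r$1 + r$2)) / 2 \<le> area K"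
proof -
  have ne: "K \<noteq> {}" using p by auto
  have "\<exists>P\<in>K. \<forall>z\<in>K. z$1 \<le> P$1"
    by (intro continuous_attains_sup K ne continuous_intros)
  then obtain P where P: "P \<in> K" "\<And>z. z \<in> K \<Longrightarrow> z$1 \<le> P$1" by blast
  have "\<exists>Q\<in>K. \<forall>z\<in>K. z$2 \<le> Q$2"
    by (intro continuous_attains_sup K ne continuous_intros)
  then obtain Q where Q: "Q \<in> K" "\<And>z. z \<in> K \<Longrightarrow> z$2 \<le> Q$2" by blast
  have "\<exists>R\<in>K. \<forall>z\<in>K. R$1 + R$2 \<le> z$1 + z$2"
    by (intro continuous_attains_inf K ne continuous_intros)
  then obtain R where R: "R \<in> K" "\<And>z. z \<in> K \<Longrightarrow> R$1 + R$2 \<le> z$1 + z$2" by blast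
  \<comment> \<open>These numbers tell how far \<open>K\<close> reaches beyond the sides of the
    triangle, in units in which each cap has area \<open>\<tau> / 2\<close> times the
    excess.\<close>
  define e1 where "e1 = P$1 - x"
  define e2 where "e2 = Q$2 - y"
  define e0 where "e0 = x + y - \<tau> - (R$1 + R$2)"
  have e: "e1 \<ge> 0" "e2 \<ge> 0" "e0 \<ge> 0"
    using P(2)[OF t(1)] Q(2)[OF t(1)] R(2)[OF t(2)] by (auto simp: e1_def e2_def e0_def)
  have PQR: "P$1 = x + e1" "P$2 \<le> y + e2" "P$1 + P$2 \<ge> x + y - \<tau> - e0"
    "Q$2 = y + e2" "Q$1 \<le> x + e1" "Q$1 + Q$2 \<ge> x + y - \<tau> - e0"
    "R$1 + R$2 = x + y - \<tau> - e0" "R$1 \<le> x + e1" "R$2 \<le> y + e2"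
    using P Q R by (auto simp: e1_def e2_def e0_def)
  define T where "T = convex hull {pt x y, pt (x - \<tau>) y, pt x (y - \<tau>)}"
  define C1 where "C1 = convex hull {pt x y, pt x (y - \<tau>), P}"
  define C2 where "C2 = convex hull {pt x y, pt (x - \<tau>) y, Q}"
  define C0 where "C0 = convex hull {pt (x - \<tau>) y, pt x (y - \<tau>), R}"
  note defs = T_def C1_def C2_def C0_def
  let ?C = "\<lambda>i::nat. [T, C1, C2, C0] ! i"
  have T1: "negligible (T \<inter> C1)" unfolding defs
    by (rule negligible_triangles_Int[of 1 0 _ _ _ x]) (use PQR e \<open>\<tau> > 0\<close> in auto)
  have T2: "negligible (T \<inter> C2)" unfolding defs
    by (rule negligible_triangles_Int[of 0 1 _ _ _ y]) (use PQR e \<open>\<tau> > 0\<close> in auto)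
  have T0: "negligible (T \<inter> C0)" unfolding defs
    by (rule negligible_triangles_Int[of "-1" "-1" _ _ _ "\<tau> - x - y"]) (use PQR e \<open>\<tau> > 0\<close> in auto)
  \<comment> \<open>The separating line runs from the common vertex \<open>pt x y\<close> to the
    corner \<open>pt (x + e1) (y + e2)\<close> of the two supporting lines. These points coincide if
    \<open>e1 = 0\<close> and \<open>e2 = 0\<close>, but then \<open>C1\<close> lies in a line. The
    other two pairs of neighbouring caps are treated in the same way.\<close>
  have C12: "negligible (C1 \<inter> C2)"
  proof (cases "e1 = 0 \<and> e2 = 0")
    case True
    have "C1 \<subseteq> {z. 1 * z$1 + 0 * z$2 = x}"
      using triangle_le[of "pt x y" "pt x (y - \<tau>)" P 1 0 x] triangle_le[of "pt x y" "pt x (y - \<tau>)" P "-1" 0 "- x"]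
        PQR True by (force simp: C1_def)
    then have "negligible C1" by (rule negligible_subset[rotated]) (rule negligible_line, simp)
    then show ?thesis by (rule negligible_subset) auto
  next
    case False
    have P2: "e1 * P$2 \<le> e1 * (y + e2)" using e PQR by (intro mult_left_mono)
    have Q1: "e2 * Q$1 \<le> e2 * (x + e1)" using e PQR by (intro mult_left_mono)
    have "0 \<le> \<tau> * e1" "0 \<le> \<tau> * e2" using e \<open>\<tau> > 0\<close> by auto
    then show ?thesis unfolding defs
      using False P2 Q1
      by (intro negligible_triangles_Int[of "- e2" e1 _ _ _ "e1 * y - e2 * x"]) (auto simp: PQR(1,4) algebra_simps)
  qed
  have C10: "negligible (C1 \<inter> C0)"
  proof (cases "e1 = 0 \<and> e0 = 0")
    case True
    have "C1 \<subseteq> {z. 1 * z$1 + 0 * z$2 = x}"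
      using triangle_le[of "pt x y" "pt x (y - \<tau>)" P 1 0 x] triangle_le[of "pt x y" "pt x (y - \<tau>)" P "-1" 0 "- x"]
        PQR True by (force simp: C1_def)
    then have "negligible C1" by (rule negligible_subset[rotated]) (rule negligible_line, simp)
    then show ?thesis by (rule negligible_subset) auto
  next
    case False
    have P0: "e1 * (x + y - \<tau> - e0) \<le> e1 * (P$1 + P$2)" using e PQR by (intro mult_left_mono)
    have R1: "e0 * R$1 \<le> e0 * (x + e1)" using e PQR by (intro mult_left_mono)
    have R0: "e1 * (R$1 + R$2) = e1 * (x + y - \<tau> - e0)" using PQR by simp
    have "0 \<le> \<tau> * e1" "0 \<le> \<tau> * e0" using e \<open>\<tau> > 0\<close> by auto
    then show ?thesis unfolding defs
      using False P0 R1 R0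
      by (intro negligible_triangles_Int[of "- e0 - e1" "- e1" _ _ _ "- e0 * x - e1 * (x + y - \<tau>)"])
        (auto simp: PQR(1) algebra_simps)
  qed
  have C20: "negligible (C2 \<inter> C0)"
  proof (cases "e2 = 0 \<and> e0 = 0")
    case True
    have "C2 \<subseteq> {z. 0 * z$1 + 1 * z$2 = y}"
      using triangle_le[of "pt x y" "pt (x - \<tau>) y" Q 0 1 y] triangle_le[of "pt x y" "pt (x - \<tau>) y" Q 0 "-1" "- y"]
        PQR True by (force simp: C2_def)
    then have "negligible C2" by (rule negligible_subset[rotated]) (rule negligible_line, simp)
    then show ?thesis by (rule negligible_subset) auto
  next
    case False
    have Q0: "e2 * (x + y - \<tau> - e0) \<le> e2 * (Q$1 + Q$2)" using e PQR by (intro mult_left_mono)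
    have R2: "e0 * R$2 \<le> e0 * (y + e2)" using e PQR by (intro mult_left_mono)
    have R0: "e2 * (R$1 + R$2) = e2 * (x + y - \<tau> - e0)" using PQR by simp
    have "0 \<le> \<tau> * e2" "0 \<le> \<tau> * e0" using e \<open>\<tau> > 0\<close> by auto
    then show ?thesis unfolding defs
      using False Q0 R2 R0
      by (intro negligible_triangles_Int[of "- e2" "- e0 - e2" _ _ _ "- e0 * y - e2 * (x + y - \<tau>)"])
        (auto simp: PQR(4) algebra_simps)
  qed
  have sub: "T \<subseteq> K" "C1 \<subseteq> K" "C2 \<subseteq> K" "C0 \<subseteq> K"
    unfolding defs by (rule hull_minimal; use t P(1) Q(1) R(1) K in simp)+
  have cpt: "compact T" "compact C1" "compact C2" "compact C0"
    unfolding defs by (intro finite_imp_compact_convex_hull; simp)+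
  have less4: "i < 4 \<Longrightarrow> i = 0 \<or> i = 1 \<or> i = 2 \<or> i = 3" for i :: nat by auto
  have "(\<Sum>i<4. area (?C i)) \<le> area K"
  proof (rule area_packing)
    fix i j :: nat assume "i \<in> {..<4}" "j \<in> {..<4}" "i \<noteq> j"
    then have "i \<in> {0,1,2,3}" "j \<in> {0,1,2,3}" "i \<noteq> j" by (auto dest: less4)
    then show "negligible (?C i \<inter> ?C j)"
      using T1 T2 T0 C12 C10 C20 by (elim insertE emptyE) (simp_all add: Int_commute)
  qed (use K sub cpt in \<open>auto dest!: less4\<close>)
  then have "area T + area C1 + area C2 + area C0 \<le> area K" by (simp add: numeral_eq_Suc)
  moreover have "area T = \<tau> * \<tau> / 2" unfolding T_def area_triangle by simp
  moreover have "area C1 = \<tau> * e1 / 2" 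
    unfolding C1_def area_triangle using e \<open>\<tau> > 0\<close> by (simp add: crs_def PQR abs_mult)
  moreover have "area C2 = \<tau> * e2 / 2" 
    unfolding C2_def area_triangle using e \<open>\<tau> > 0\<close> by (simp add: crs_def PQR abs_mult)
  moreover have "area C0 = \<tau> * e0 / 2"
  proof -
    have "crs (pt x (y - \<tau>) - pt (x - \<tau>) y) (R - pt (x - \<tau>) y) = \<tau> * (R$1 + R$2 - (x + y - \<tau>))"
      by (simp add: crs_def algebra_simps)
    also have "\<dots> = - (\<tau> * e0)" using PQR(7) by simp
    finally show ?thesis unfolding C0_def area_triangle using e \<open>\<tau> > 0\<close> by simp
  qed
  ultimately have "\<tau> * (\<tau> + e1 + e2 + e0) / 2 \<le> area K" by (simp add: algebra_simps add_divide_distrib)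
  moreover have "p$1 + q$2 - (r$1 + r$2) \<le> \<tau> + e1 + e2 + e0"
    using P(2)[OF p(1)] Q(2)[OF p(2)] R(2)[OF p(3)] by (simp add: e1_def e2_def e0_def)
  then have "\<tau> * (p$1 + q$2 - (r$1 + r$2)) \<le> \<tau> * (\<tau> + e1 + e2 + e0)"
    using \<open>\<tau> > 0\<close> by (intro mult_left_mono) auto
  ultimately show ?thesis by linarith
qed

section \<open>Area spanned by three crossing segments and caps\<close>

text \<open>By the sign hypotheses the line of the diagonal \<open>A\<close>, \<open>C\<close> has
  \<open>B\<close> and \<open>D\<close> on different sides, so it separates the two
  triangles.\<close>

lemma area_quadrilateral_le:
  assumes S: "convex S" "compact S" and mem: "A \<in> S" "B \<in> S" "C \<in> S" "D \<in> S"
    and "0 \<le> crs (B - A) (C - A)" "0 \<le> crs (C - A) (D - A)"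
  shows "crs (B - A) (C - A) + crs (C - A) (D - A) \<le> 2 * area S"
proof (cases "C = A")
  case True
  then show ?thesis by (simp add: crs_simps area_nonneg)
next
  case False
  let ?U = "S \<inter> {x. crs (C - A) A \<le> crs (C - A) x}" and ?L = "S \<inter> {x. crs (C - A) x \<le> crs (C - A) A}"
  have s: "crs (B - A) (C - A) = crs (C - A) A - crs (C - A) B" "crs (C - A) (D - A) = crs (C - A) D - crs (C - A) A"
    "crs (C - A) C = crs (C - A) A"
    by (simp_all add: crs_def algebra_simps)
  have "\<bar>crs (C - A) (D - A)\<bar> / 2 \<le> area ?U"
    using mem assms by (intro area_triangle_le convex_compact_upper S) (auto simp: s)
  moreover have "\<bar>crs (B - A) (C - A)\<bar> / 2 \<le> area ?L"
    using mem assms by (intro area_triangle_le convex_compact_lower S) (auto simp: s)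
  ultimately show ?thesis using area_split[OF S(2), of "C - A" "crs (C - A) A"] False by auto
qed

text \<open>The triangle with apex \<open>P\<close> is attached beyond the side from
  \<open>B\<close> to \<open>C\<close>; if \<open>P\<close> is on the inner side, its term is
  nonpositive.\<close>

lemma area_capped_quadrilateral_le:
  assumes S: "convex S" "compact S" and mem: "A \<in> S" "B \<in> S" "C \<in> S" "D \<in> S" "P \<in> S"
    and "0 \<le> crs (B - A) (C - A)" "0 \<le> crs (C - A) (D - A)" "0 \<le> crs (C - B) (D - B)"
  shows "crs (B - A) (C - A) + crs (C - A) (D - A) + crs (P - B) (C - B) \<le> 2 * area S"
proof (cases "crs (P - B) (C - B) \<le> 0")
  case True
  then show ?thesis using area_quadrilateral_le[OF S mem(1-4)] assms by simp
next
  case False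
  then have ne: "C - B \<noteq> 0" by (auto simp: crs_simps)
  let ?U = "S \<inter> {x. crs (C - B) B \<le> crs (C - B) x}" and ?L = "S \<inter> {x. crs (C - B) x \<le> crs (C - B) B}"
  have s: "crs (B - A) (C - A) = crs (C - B) A - crs (C - B) B" "crs (C - B) (D - B) = crs (C - B) D - crs (C - B) B"
    "crs (P - B) (C - B) = crs (C - B) B - crs (C - B) P"
    "crs (C - B) C = crs (C - B) B"
    by (simp_all add: crs_def algebra_simps)
  have "crs (B - A) (C - A) + crs (C - A) (D - A) \<le> 2 * area ?U"
    using mem assms by (intro area_quadrilateral_le convex_compact_upper S) (auto simp: s)
  moreover have "\<bar>crs (P - B) (C - B)\<bar> / 2 \<le> area ?L"
    using mem False by (intro area_triangle_le convex_compact_lower S) (auto simp: s)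
  ultimately show ?thesis using area_split[OF S(2) ne, of "crs (C - B) B"] by auto
qed

text \<open>
  The lines \<open>y = - \<beta>\<close>, \<open>x = - \<gamma>\<close>, \<open>x + y = 0\<close> through the three segments cut the plane into seven regions,
  and the three conditions on \<open>P1\<close>, \<open>P2\<close>, \<open>P3\<close> put each of them into one of the unbounded regions that
  meet the central triangle in an edge.
\<close>
lemma area_three_segments_caps:
  assumes K: "convex K" "compact K"
    and h: "pt (a - 1/2) (-\<beta>) \<in> K" "pt (a + 1/2) (-\<beta>) \<in> K"
    and v: "pt (-\<gamma>) (d - 1/2) \<in> K" "pt (-\<gamma>) (d + 1/2) \<in> K"
    and g: "pt (-1/2) (1/2) \<in> K" "pt (1/2) (-1/2) \<in> K"
    and c: "0 \<le> \<beta> + \<gamma>" "\<beta> \<le> 1/2" "\<gamma> \<le> 1/2" "a + \<gamma> \<le> 1/2" "\<beta> - a \<le> 1/2" "\<beta> + d \<le> 1/2" "\<gamma> - d \<le> 1/2"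
    and P: "P1 \<in> K" "P2 \<in> K" "P3 \<in> K"
    and P1: "- \<gamma> \<le> P1$1" "- \<beta> \<le> P1$2" "0 \<le> P1$1 + P1$2"
    and P2: "P2$1 \<le> - \<gamma>" "- \<beta> \<le> P2$2" "P2$1 + P2$2 \<le> 0"
    and P3: "- \<gamma> \<le> P3$1" "P3$2 \<le> - \<beta>" "P3$1 + P3$2 \<le> 0"
  shows "2 * (3/4 + a * d - \<beta> * \<gamma>)
     + crs (P1 - pt (a + 1/2) (-\<beta>)) (pt (-\<gamma>) (d + 1/2) - pt (a + 1/2) (-\<beta>))
     + crs (P2 - pt (-1/2) (1/2)) (pt (a - 1/2) (-\<beta>) - pt (-1/2) (1/2))
     + crs (P3 - pt (-\<gamma>) (d - 1/2)) (pt (1/2) (-1/2) - pt (-\<gamma>) (d - 1/2)) \<le> 2 * area K"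
proof -
  let ?Ye = "{z::real^2. - \<beta> \<le> 0 * z$1 + 1 * z$2}" and ?Yl = "{z::real^2. 0 * z$1 + 1 * z$2 \<le> - \<beta>}"
  let ?Xe = "{z::real^2. - \<gamma> \<le> 1 * z$1 + 0 * z$2}" and ?Xl = "{z::real^2. 1 * z$1 + 0 * z$2 \<le> - \<gamma>}"
  let ?Se = "{z::real^2. 0 \<le> 1 * z$1 + 1 * z$2}" and ?Sl = "{z::real^2. 1 * z$1 + 1 * z$2 \<le> 0}"
  have seg: "pt x y \<in> K" if "pt x1 y1 \<in> K" "pt x2 y2 \<in> K" "0 \<le> t" "t \<le> 1"
      "x = (1 - t) * x1 + t * x2" "y = (1 - t) * y1 + t * y2" for x y x1 y1 x2 y2 t
    using convexD_alt[OF K(1) that(1,2,3,4)] that(5,6) by simp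
  \<comment> \<open>The three crossing points of the lines belong to the segments, and thus to
    \<open>K\<close>, by the bounds \<open>c\<close>.\<close>
  have hv: "pt (-\<gamma>) (-\<beta>) \<in> K"
    by (rule seg[OF h, of "1/2 - a - \<gamma>"]) (use c in \<open>auto simp: algebra_simps\<close>)
  have gh: "pt \<beta> (-\<beta>) \<in> K"
    by (rule seg[OF h, of "1/2 - a + \<beta>"]) (use c in \<open>auto simp: algebra_simps\<close>)
  have vg: "pt (-\<gamma>) \<gamma> \<in> K"
    by (rule seg[OF v, of "1/2 - d + \<gamma>"]) (use c in \<open>auto simp: algebra_simps\<close>)
  note mem = h v g hv gh vg P
  note cc = convex_compact_ge convex_compact_le K
  \<comment> \<open>\<open>?Ce\<close> is the part in the central triangle. The parts
    \<open>?R1\<close>, \<open>?R2\<close>, \<open>?R3\<close> border it along an edge and hold a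
    capped quadrilateral each; \<open>?V1\<close>, \<open>?V2\<close>, \<open>?V3\<close> meet it in
    a vertex and hold a triangle each. For \<open>?V3\<close> the sign of the sum of coordinates
    follows from \<open>0 \<le> \<beta> + \<gamma>\<close>.\<close>
  let ?R1 = "K \<inter> ?Ye \<inter> ?Se \<inter> ?Xe" and ?V1 = "K \<inter> ?Ye \<inter> ?Se \<inter> ?Xl"
  let ?Ce = "K \<inter> ?Ye \<inter> ?Sl \<inter> ?Xe" and ?R2 = "K \<inter> ?Ye \<inter> ?Sl \<inter> ?Xl"
  let ?R3 = "K \<inter> ?Yl \<inter> ?Xe \<inter> ?Sl" and ?V2 = "K \<inter> ?Yl \<inter> ?Xe \<inter> ?Se"
  let ?V3 = "K \<inter> ?Yl \<inter> ?Xl"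
  have reg: "convex ?R1" "compact ?R1" "convex ?R2" "compact ?R2" "convex ?R3" "compact ?R3"
    "convex ?V1" "compact ?V1" "convex ?V2" "compact ?V2" "convex ?V3" "compact ?V3" "convex ?Ce" "compact ?Ce"
    by (intro cc)+
  have s1: "area K = area (K \<inter> ?Ye) + area (K \<inter> ?Yl)"
    by (intro area_split_form cc) auto
  have s2: "area (K \<inter> ?Ye) = area (K \<inter> ?Ye \<inter> ?Se) + area (K \<inter> ?Ye \<inter> ?Sl)"
    by (intro area_split_form cc) auto
  have s3: "area (K \<inter> ?Ye \<inter> ?Se) = area ?R1 + area ?V1"
    by (intro area_split_form cc) auto
  have s4: "area (K \<inter> ?Ye \<inter> ?Sl) = area ?Ce + area ?R2"
    by (intro area_split_form cc) auto
  have s5: "area (K \<inter> ?Yl) = area (K \<inter> ?Yl \<inter> ?Xe) + area ?V3"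
    by (intro area_split_form cc) auto
  have s6: "area (K \<inter> ?Yl \<inter> ?Xe) = area ?V2 + area ?R3"
    by (intro area_split_form cc) auto
  \<comment> \<open>These are the orientation conditions of the three quadrilaterals; each
    determinant is a product of two linear factors, both nonnegative by \<open>c\<close>.\<close>
  have n: "0 \<le> crs (pt (a + 1/2) (-\<beta>) - pt \<beta> (-\<beta>)) (pt (-\<gamma>) (d + 1/2) - pt \<beta> (-\<beta>))"
    "0 \<le> crs (pt (-\<gamma>) (d + 1/2) - pt \<beta> (-\<beta>)) (pt (-\<gamma>) \<gamma> - pt \<beta> (-\<beta>))"
    "0 \<le> crs (pt (-\<gamma>) (d + 1/2) - pt (a + 1/2) (-\<beta>)) (pt (-\<gamma>) \<gamma> - pt (a + 1/2) (-\<beta>))"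
    "0 \<le> crs (pt (-1/2) (1/2) - pt (-\<gamma>) \<gamma>) (pt (a - 1/2) (-\<beta>) - pt (-\<gamma>) \<gamma>)"
    "0 \<le> crs (pt (a - 1/2) (-\<beta>) - pt (-\<gamma>) \<gamma>) (pt (-\<gamma>) (-\<beta>) - pt (-\<gamma>) \<gamma>)"
    "0 \<le> crs (pt (a - 1/2) (-\<beta>) - pt (-1/2) (1/2)) (pt (-\<gamma>) (-\<beta>) - pt (-1/2) (1/2))"
    "0 \<le> crs (pt (-\<gamma>) (d - 1/2) - pt (-\<gamma>) (-\<beta>)) (pt (1/2) (-1/2) - pt (-\<gamma>) (-\<beta>))"
    "0 \<le> crs (pt (1/2) (-1/2) - pt (-\<gamma>) (-\<beta>)) (pt \<beta> (-\<beta>) - pt (-\<gamma>) (-\<beta>))"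
    "0 \<le> crs (pt (1/2) (-1/2) - pt (-\<gamma>) (d - 1/2)) (pt \<beta> (-\<beta>) - pt (-\<gamma>) (d - 1/2))"
  proof -
    have "crs (pt (a + 1/2) (-\<beta>) - pt \<beta> (-\<beta>)) (pt (-\<gamma>) (d + 1/2) - pt \<beta> (-\<beta>)) = (a + 1/2 - \<beta>) * (d + 1/2 + \<beta>)"
      by (simp add: field_simps)
    moreover have "0 \<le> (a + 1/2 - \<beta>) * (d + 1/2 + \<beta>)" using c by (intro mult_nonneg_nonneg) auto
    ultimately show "0 \<le> crs (pt (a + 1/2) (-\<beta>) - pt \<beta> (-\<beta>)) (pt (-\<gamma>) (d + 1/2) - pt \<beta> (-\<beta>))" by argo
    have "crs (pt (-\<gamma>) (d + 1/2) - pt \<beta> (-\<beta>)) (pt (-\<gamma>) \<gamma> - pt \<beta> (-\<beta>)) = (\<beta> + \<gamma>) * (d + 1/2 - \<gamma>)"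
      by (simp add: field_simps)
    moreover have "0 \<le> (\<beta> + \<gamma>) * (d + 1/2 - \<gamma>)" using c by (intro mult_nonneg_nonneg) auto
    ultimately show "0 \<le> crs (pt (-\<gamma>) (d + 1/2) - pt \<beta> (-\<beta>)) (pt (-\<gamma>) \<gamma> - pt \<beta> (-\<beta>))" by argo
    have "crs (pt (-\<gamma>) (d + 1/2) - pt (a + 1/2) (-\<beta>)) (pt (-\<gamma>) \<gamma> - pt (a + 1/2) (-\<beta>)) = (a + 1/2 + \<gamma>) * (d + 1/2 - \<gamma>)"
      by (simp add: field_simps)
    moreover have "0 \<le> (a + 1/2 + \<gamma>) * (d + 1/2 - \<gamma>)" using c by (intro mult_nonneg_nonneg) auto
    ultimately show "0 \<le> crs (pt (-\<gamma>) (d + 1/2) - pt (a + 1/2) (-\<beta>)) (pt (-\<gamma>) \<gamma> - pt (a + 1/2) (-\<beta>))" by argo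
    have "crs (pt (-1/2) (1/2) - pt (-\<gamma>) \<gamma>) (pt (a - 1/2) (-\<beta>) - pt (-\<gamma>) \<gamma>) = (1/2 - \<gamma>) * (1/2 + \<beta> - a)"
      by (simp add: field_simps)
    moreover have "0 \<le> (1/2 - \<gamma>) * (1/2 + \<beta> - a)" using c by (intro mult_nonneg_nonneg) auto
    ultimately show "0 \<le> crs (pt (-1/2) (1/2) - pt (-\<gamma>) \<gamma>) (pt (a - 1/2) (-\<beta>) - pt (-\<gamma>) \<gamma>)" by argo
    have "crs (pt (a - 1/2) (-\<beta>) - pt (-\<gamma>) \<gamma>) (pt (-\<gamma>) (-\<beta>) - pt (-\<gamma>) \<gamma>) = (1/2 - a - \<gamma>) * (\<beta> + \<gamma>)"
      by (simp add: field_simps)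
    moreover have "0 \<le> (1/2 - a - \<gamma>) * (\<beta> + \<gamma>)" using c by (intro mult_nonneg_nonneg) auto
    ultimately show "0 \<le> crs (pt (a - 1/2) (-\<beta>) - pt (-\<gamma>) \<gamma>) (pt (-\<gamma>) (-\<beta>) - pt (-\<gamma>) \<gamma>)" by argo
    have "crs (pt (a - 1/2) (-\<beta>) - pt (-1/2) (1/2)) (pt (-\<gamma>) (-\<beta>) - pt (-1/2) (1/2)) = (\<beta> + 1/2) * (1/2 - \<gamma> - a)"
      by (simp add: field_simps)
    moreover have "0 \<le> (\<beta> + 1/2) * (1/2 - \<gamma> - a)" using c by (intro mult_nonneg_nonneg) auto
    ultimately show "0 \<le> crs (pt (a - 1/2) (-\<beta>) - pt (-1/2) (1/2)) (pt (-\<gamma>) (-\<beta>) - pt (-1/2) (1/2))" by argo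
    have "crs (pt (-\<gamma>) (d - 1/2) - pt (-\<gamma>) (-\<beta>)) (pt (1/2) (-1/2) - pt (-\<gamma>) (-\<beta>)) = (1/2 - d - \<beta>) * (1/2 + \<gamma>)"
      by (simp add: field_simps)
    moreover have "0 \<le> (1/2 - d - \<beta>) * (1/2 + \<gamma>)" using c by (intro mult_nonneg_nonneg) auto
    ultimately show "0 \<le> crs (pt (-\<gamma>) (d - 1/2) - pt (-\<gamma>) (-\<beta>)) (pt (1/2) (-1/2) - pt (-\<gamma>) (-\<beta>))" by argo
    have "crs (pt (1/2) (-1/2) - pt (-\<gamma>) (-\<beta>)) (pt \<beta> (-\<beta>) - pt (-\<gamma>) (-\<beta>)) = (1/2 - \<beta>) * (\<beta> + \<gamma>)"
      by (simp add: field_simps)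
    moreover have "0 \<le> (1/2 - \<beta>) * (\<beta> + \<gamma>)" using c by (intro mult_nonneg_nonneg) auto
    ultimately show "0 \<le> crs (pt (1/2) (-1/2) - pt (-\<gamma>) (-\<beta>)) (pt \<beta> (-\<beta>) - pt (-\<gamma>) (-\<beta>))" by argo
    have "crs (pt (1/2) (-1/2) - pt (-\<gamma>) (d - 1/2)) (pt \<beta> (-\<beta>) - pt (-\<gamma>) (d - 1/2)) = (1/2 - \<beta>) * (1/2 + \<gamma> - d)"
      by (simp add: field_simps)
    moreover have "0 \<le> (1/2 - \<beta>) * (1/2 + \<gamma> - d)" using c by (intro mult_nonneg_nonneg) auto
    ultimately show "0 \<le> crs (pt (1/2) (-1/2) - pt (-\<gamma>) (d - 1/2)) (pt \<beta> (-\<beta>) - pt (-\<gamma>) (d - 1/2))" by argo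
  qed
  have r1: "crs (pt (a + 1/2) (-\<beta>) - pt \<beta> (-\<beta>)) (pt (-\<gamma>) (d + 1/2) - pt \<beta> (-\<beta>))
      + crs (pt (-\<gamma>) (d + 1/2) - pt \<beta> (-\<beta>)) (pt (-\<gamma>) \<gamma> - pt \<beta> (-\<beta>))
      + crs (P1 - pt (a + 1/2) (-\<beta>)) (pt (-\<gamma>) (d + 1/2) - pt (a + 1/2) (-\<beta>)) \<le> 2 * area ?R1"
    by (rule area_capped_quadrilateral_le[OF _ _ _ _ _ _ _ n(1,2,3)]) (use mem c P1 reg in \<open>auto\<close>)
  have r2: "crs (pt (-1/2) (1/2) - pt (-\<gamma>) \<gamma>) (pt (a - 1/2) (-\<beta>) - pt (-\<gamma>) \<gamma>)
      + crs (pt (a - 1/2) (-\<beta>) - pt (-\<gamma>) \<gamma>) (pt (-\<gamma>) (-\<beta>) - pt (-\<gamma>) \<gamma>)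
      + crs (P2 - pt (-1/2) (1/2)) (pt (a - 1/2) (-\<beta>) - pt (-1/2) (1/2)) \<le> 2 * area ?R2"
    by (rule area_capped_quadrilateral_le[OF _ _ _ _ _ _ _ n(4,5,6)]) (use mem c P2 reg in \<open>auto\<close>)
  have r3: "crs (pt (-\<gamma>) (d - 1/2) - pt (-\<gamma>) (-\<beta>)) (pt (1/2) (-1/2) - pt (-\<gamma>) (-\<beta>))
      + crs (pt (1/2) (-1/2) - pt (-\<gamma>) (-\<beta>)) (pt \<beta> (-\<beta>) - pt (-\<gamma>) (-\<beta>))
      + crs (P3 - pt (-\<gamma>) (d - 1/2)) (pt (1/2) (-1/2) - pt (-\<gamma>) (d - 1/2)) \<le> 2 * area ?R3"
    by (rule area_capped_quadrilateral_le[OF _ _ _ _ _ _ _ n(7,8,9)]) (use mem c P3 reg in \<open>auto\<close>)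
  have v1: "\<bar>crs (pt (-\<gamma>) (d + 1/2) - pt (-\<gamma>) \<gamma>) (pt (-1/2) (1/2) - pt (-\<gamma>) \<gamma>)\<bar> / 2 \<le> area ?V1"
    by (rule area_triangle_le) (use mem c reg in \<open>auto\<close>)
  have v2: "\<bar>crs (pt (1/2) (-1/2) - pt \<beta> (-\<beta>)) (pt (a + 1/2) (-\<beta>) - pt \<beta> (-\<beta>))\<bar> / 2 \<le> area ?V2"
    by (rule area_triangle_le) (use mem c reg in \<open>auto\<close>)
  have v3: "\<bar>crs (pt (a - 1/2) (-\<beta>) - pt (-\<gamma>) (-\<beta>)) (pt (-\<gamma>) (d - 1/2) - pt (-\<gamma>) (-\<beta>))\<bar> / 2 \<le> area ?V3"
    by (rule area_triangle_le) (use mem c reg in \<open>auto\<close>)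
  have ce: "\<bar>crs (pt \<beta> (-\<beta>) - pt (-\<gamma>) (-\<beta>)) (pt (-\<gamma>) \<gamma> - pt (-\<gamma>) (-\<beta>))\<bar> / 2 \<le> area ?Ce"
    by (rule area_triangle_le) (use mem c reg in \<open>auto\<close>)
  have ab: "t \<le> 2 * A" if "\<bar>t\<bar> / 2 \<le> A" for t A :: real using that by simp
  \<comment> \<open>The right-hand side is the shoelace sum over ten triangles: two in each
    quadrilateral, three at the vertices, one in the centre.\<close>
  have "2 * (3/4 + a * d - \<beta> * \<gamma>)
    = crs (pt (a + 1/2) (-\<beta>) - pt \<beta> (-\<beta>)) (pt (-\<gamma>) (d + 1/2) - pt \<beta> (-\<beta>))
      + crs (pt (-\<gamma>) (d + 1/2) - pt \<beta> (-\<beta>)) (pt (-\<gamma>) \<gamma> - pt \<beta> (-\<beta>))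
      + crs (pt (-1/2) (1/2) - pt (-\<gamma>) \<gamma>) (pt (a - 1/2) (-\<beta>) - pt (-\<gamma>) \<gamma>)
      + crs (pt (a - 1/2) (-\<beta>) - pt (-\<gamma>) \<gamma>) (pt (-\<gamma>) (-\<beta>) - pt (-\<gamma>) \<gamma>)
      + crs (pt (-\<gamma>) (d - 1/2) - pt (-\<gamma>) (-\<beta>)) (pt (1/2) (-1/2) - pt (-\<gamma>) (-\<beta>))
      + crs (pt (1/2) (-1/2) - pt (-\<gamma>) (-\<beta>)) (pt \<beta> (-\<beta>) - pt (-\<gamma>) (-\<beta>))
      + crs (pt (-\<gamma>) (d + 1/2) - pt (-\<gamma>) \<gamma>) (pt (-1/2) (1/2) - pt (-\<gamma>) \<gamma>)
      + crs (pt (1/2) (-1/2) - pt \<beta> (-\<beta>)) (pt (a + 1/2) (-\<beta>) - pt \<beta> (-\<beta>))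
      + crs (pt (a - 1/2) (-\<beta>) - pt (-\<gamma>) (-\<beta>)) (pt (-\<gamma>) (d - 1/2) - pt (-\<gamma>) (-\<beta>))
      + crs (pt \<beta> (-\<beta>) - pt (-\<gamma>) (-\<beta>)) (pt (-\<gamma>) \<gamma> - pt (-\<gamma>) (-\<beta>))"
    by (simp add: field_simps)
  then show ?thesis
    using r1 r2 r3 ab[OF v1] ab[OF v2] ab[OF v3] ab[OF ce] s1 s2 s3 s4 s5 s6 by linarith
qed

section \<open>Polynomial inequalities for the spanned areas\<close>

lemma mult_add_mult_le_twelfth:
  fixes \<beta> \<gamma> x y :: real
  assumes "0 \<le> \<beta> + \<gamma>" "\<gamma> \<le> 1/2" "0 \<le> x" "x + \<beta> \<le> 1/6" "0 \<le> y" "y \<le> 1/3"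
  shows "\<beta> * \<gamma> + x * y \<le> 1/12"
proof (cases "\<beta> \<ge> 0")
  case True
  then have "\<beta> * \<gamma> \<le> \<beta> * (1/2)" "x * y \<le> x * (1/2)"
    using assms by (intro mult_left_mono; simp)+
  then show ?thesis using assms by linarith
next
  case False
  then have "\<beta> * \<gamma> \<le> \<beta> * (- \<beta>)" using assms by (intro mult_left_mono_neg) auto
  moreover have "x * y \<le> (1/6 - \<beta>) * (1/3)" using assms by (intro mult_mono) auto
  moreover have "0 \<le> (\<beta> + 1/6)\<^sup>2" by simp
  ultimately show ?thesis by (simp add: power2_eq_square field_simps)
qed

lemma mult_le_square_quarter: "0 \<le> x \<Longrightarrow> 0 \<le> y \<Longrightarrow> x + y \<le> s \<Longrightarrow> x * y \<le> s * s / 4" for x y s :: real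
proof -
  assume *: "0 \<le> x" "0 \<le> y" "x + y \<le> s"
  have "0 \<le> (x - y) * (x - y)" by simp
  moreover have "(x + y) * (x + y) \<le> s * s" using * by (intro mult_mono) auto
  ultimately show ?thesis by (simp add: algebra_simps)
qed

text \<open>For the placement in which the line of the horizontal segment passes above the triangle:
  the widths then give the last two bounds. As 1/12 is 3/4 - 2/3, the segments alone span the area
  2/3.\<close>

lemma triangle_above_real:
  fixes a d \<beta> \<gamma> :: real
  assumes c: "0 \<le> \<beta> + \<gamma>" "\<gamma> \<le> 1/2" "a - d + \<gamma> \<le> 1/2" "- a \<le> 1/3" "\<beta> \<le> 1/6" "\<beta> + d \<le> 1/6"
  shows "\<beta> * \<gamma> - a * d \<le> 1/12"
proof -
  consider "0 \<le> a * d" | "a > 0" "d < 0" | "a < 0" "d > 0"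
    by (metis linorder_not_le mult_less_0_iff)
  then show ?thesis
  proof cases
    case 1
    then show ?thesis using mult_add_mult_le_twelfth[of \<beta> \<gamma> 0 0] c by simp
  next
    case 2
    have ad: "a * (- d) \<le> (1/2 - \<gamma>) * (1/2 - \<gamma>) / 4"
      by (intro mult_le_square_quarter) (use 2 c in auto)
    show ?thesis
    proof (cases "\<gamma> \<ge> 0")
      case True
      then have "\<beta> * \<gamma> \<le> (1/6) * \<gamma>" using c by (intro mult_right_mono) auto
      moreover have "\<gamma> * \<gamma> \<le> (1/2) * \<gamma>" using True c by (intro mult_right_mono) auto
      ultimately show ?thesis using ad c by (simp add: field_simps)
    next
      case False
      then have "\<beta> * \<gamma> \<le> (- \<gamma>) * \<gamma>" using c by (intro mult_right_mono_neg) auto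
      moreover have "0 \<le> (\<gamma> + 1/6)\<^sup>2" by simp
      ultimately show ?thesis using ad by (simp add: power2_eq_square field_simps)
    qed
  next
    case 3
    then show ?thesis using mult_add_mult_le_twelfth[of \<beta> \<gamma> d "- a"] c by (simp add: mult.commute)
  qed
qed

text \<open>The same for the placement in which the whole triangle satisfies
  \<open>0 < x + y\<close>, that is, lies on the positive side of the line of the third
  segment.\<close>

lemma triangle_below_real:
  fixes a d \<beta> \<gamma> :: real
  assumes c: "0 \<le> \<beta> + \<gamma>" "\<beta> \<le> 1/2" "\<gamma> \<le> 1/2" "\<bar>a\<bar> \<le> 1/3" "\<bar>d\<bar> \<le> 1/3" "\<beta> + d \<le> 1/2"
    "\<beta> - a \<le> 1/6" "\<gamma> - d \<le> 1/6"
  shows "\<beta> * \<gamma> - a * d \<le> 1/12"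
proof -
  have small: "\<beta> * \<gamma> \<le> 1/12" if "\<beta> \<le> 1/6 \<or> \<gamma> \<le> 1/6"
    using mult_add_mult_le_twelfth[of \<beta> \<gamma> 0 0] mult_add_mult_le_twelfth[of \<gamma> \<beta> 0 0] that c by (auto simp: mult.commute)
  consider "0 \<le> a" "0 \<le> d" | "a \<le> 0" "d \<le> 0" | "a < 0" "d > 0" | "a > 0" "d < 0" by linarith
  then show ?thesis
  proof cases
    case 1
    show ?thesis
    proof (cases "\<beta> \<le> 1/6 \<or> \<gamma> \<le> 1/6")
      case True
      then show ?thesis using small 1 by (smt (verit) mult_nonneg_nonneg)
    next
      case False
      then have "(\<beta> - 1/6) * (\<gamma> - 1/6) \<le> a * d" using 1 c by (intro mult_mono) auto
      \<comment> \<open>Adding the bounds on \<open>\<beta> + d\<close> and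
        \<open>\<gamma> - d\<close> gives \<open>\<beta> + \<gamma> \<le> 2/3\<close>, which
        controls the linear term of the product.\<close>
      then show ?thesis using c by (simp add: algebra_simps)
    qed
  next
    case 2
    then have "0 \<le> a * d" by (simp add: mult_nonpos_nonpos)
    then show ?thesis using small 2 c by linarith
  next
    case 3
    then show ?thesis using mult_add_mult_le_twelfth[of \<beta> \<gamma> "- a" d] c by auto
  next
    case 4
    then show ?thesis using mult_add_mult_le_twelfth[of \<gamma> \<beta> "- d" a] c by (auto simp: mult.commute)
  qed
qed

lemma nonagon_real_aux:
  fixes a e B C :: real
  assumes "0 \<le> a" "0 \<le> e" "a \<le> 1/3" "e \<le> 1/3" "a + e + C \<le> 1/3" "B \<le> 1/3" "a + e \<le> 1/3 + B - C" "-1/3 \<le> B + C"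
  shows "B * C + a * e \<le> 1/9"
proof (cases "C \<ge> 0")
  case True
  have "a * e \<le> (1/3 - C) * (1/3 - C) / 4" using assms by (intro mult_le_square_quarter) auto
  moreover have "B * C \<le> (1/3) * C" using assms True by (intro mult_right_mono) auto
  moreover have "C * C \<le> (1/3) * C" using assms True by (intro mult_right_mono) auto
  ultimately show ?thesis using assms True by (simp add: field_simps)
next
  case C: False
  have ae: "a * e \<le> (1/3) * (1/3)" using assms by (intro mult_mono) auto
  show ?thesis
  proof (cases "B \<ge> 0")
    case True
    then have "B * C \<le> 0" using C by (intro mult_nonneg_nonpos) auto
    then show ?thesis using ae by linarith
  next
    case False
    have "a * e \<le> (1/3 + B - C) * (1/3 + B - C) / 4" using assms by (intro mult_le_square_quarter) auto
    also have "\<dots> \<le> (1/3 + B - C) * (2/3 + 2 * B) / 4"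
      using assms by (intro divide_right_mono mult_left_mono) auto
    also have "\<dots> \<le> (2/3 + 2 * B) * (2/3 + 2 * B) / 4"
      using assms False C by (intro divide_right_mono mult_right_mono) auto
    finally have "a * e \<le> (1/3 + B) * (1/3 + B)" by (simp add: algebra_simps)
    moreover have "B * C \<le> B * (- 1/3 - B)" using assms False by (intro mult_left_mono_neg) auto
    ultimately show ?thesis using False by (simp add: algebra_simps)
  qed
qed

text \<open>Shifting \<open>\<beta>\<close> and \<open>\<gamma>\<close> by 1/6 absorbs the linear
  term and turns 1/12 into 1/9. The hypotheses are symmetric under exchanging \<open>a\<close>,
  \<open>\<beta>\<close> with \<open>d\<close>, \<open>\<gamma>\<close>, so both cases with
  \<open>a * d < 0\<close> reduce to the auxiliary inequality.\<close>

lemma nonagon_real: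
  fixes a d \<beta> \<gamma> :: real
  assumes c: "0 \<le> \<beta> + \<gamma>" "\<beta> \<le> 1/2" "\<gamma> \<le> 1/2" "\<bar>a\<bar> \<le> 1/3" "\<bar>d\<bar> \<le> 1/3"
    "a - d + \<gamma> \<le> 1/2" "d - a + \<beta> \<le> 1/2" "a + \<gamma> \<le> 1/3 + (\<beta> + d)" "\<beta> + d \<le> 1/3 + (a + \<gamma>)"
  shows "\<beta> * \<gamma> - a * d \<le> 1/12 + (\<beta> + \<gamma>) / 6"
proof -
  have "(\<beta> - 1/6) * (\<gamma> - 1/6) - a * d \<le> 1/9"
  proof -
    consider "0 \<le> a * d" | "a > 0" "d < 0" | "a < 0" "d > 0"
      by (metis linorder_not_le mult_less_0_iff)
    then show ?thesis
    proof cases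
      case 1
      have "(\<beta> - 1/6) * (\<gamma> - 1/6) \<le> 1/9"
      proof (cases "\<gamma> - 1/6 \<ge> 0")
        case True
        then have "(\<beta> - 1/6) * (\<gamma> - 1/6) \<le> (1/3) * (\<gamma> - 1/6)"
          using c by (intro mult_right_mono) auto
        also have "\<dots> \<le> 1/9" using c by simp
        finally show ?thesis .
      next
        case \<gamma>: False
        show ?thesis
        proof (cases "\<beta> - 1/6 \<ge> 0")
          case True
          then have "(\<beta> - 1/6) * (\<gamma> - 1/6) \<le> 0" using \<gamma> by (intro mult_nonneg_nonpos) auto
          then show ?thesis by linarith
        next
          case False
          have "(1/6 - \<beta>) * (1/6 - \<gamma>) \<le> (1/3) * (1/3) / 4"
            using False \<gamma> c by (intro mult_le_square_quarter) auto
          then show ?thesis by (simp add: algebra_simps)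
        qed
      qed
      then show ?thesis using 1 by linarith
    next
      case 2
      then show ?thesis using nonagon_real_aux[of a "- d" "\<gamma> - 1/6" "\<beta> - 1/6"] c by (auto simp: mult.commute)
    next
      case 3
      then show ?thesis using nonagon_real_aux[of "- a" d "\<beta> - 1/6" "\<gamma> - 1/6"] c by (auto simp: mult.commute)
    qed
  qed
  then show ?thesis by (simp add: field_simps)
qed

text \<open>
  If the area is less than \<open>2/3\<close>, then bounds by widths and by caps over the triangle force the three segments to
  cross pairwise and the line through each of them to meet the triangle.  The segment ends and the vertices of the
  triangle then span a (not necessarily convex) nonagon whose area is at least \<open>2/3\<close>.
\<close>
lemma area_hexagon_worms_aux:
  assumes K: "convex K" "compact K"
    and h: "pt (a - 1/2) (-\<beta>) \<in> K" "pt (a + 1/2) (-\<beta>) \<in> K"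
    and v: "pt (-\<gamma>) (d - 1/2) \<in> K" "pt (-\<gamma>) (d + 1/2) \<in> K"
    and g: "pt (-1/2) (1/2) \<in> K" "pt (1/2) (-1/2) \<in> K"
    and t: "pt x y \<in> K" "pt (x - 2/3) y \<in> K" "pt x (y - 2/3) \<in> K"
    and pos: "0 \<le> \<beta> + \<gamma>"
  shows "2/3 \<le> area K"
proof (rule ccontr)
  assume "\<not> 2/3 \<le> area K"
  then have A: "area K < 2/3" by simp
  have width: "crs l (q - q') < 4/3" if "z \<in> K" "z + l \<in> K" "q \<in> K" "q' \<in> K" for z l q q'
    using area_chords[OF K that(1,2,1,2), of q 0 q' z z] that A by (simp add: crs_simps(11))
  have ends: "pt (a - 1/2) (-\<beta>) + pt 1 0 = pt (a + 1/2) (-\<beta>)" "pt (-\<gamma>) (d + 1/2) + pt 0 (-1) = pt (-\<gamma>) (d - 1/2)"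
    "pt (-1/2) (1/2) + pt 1 (-1) = pt (1/2) (-1/2)" "pt (1/2) (-1/2) + pt (-1) 1 = pt (-1/2) (1/2)"
    by (simp_all add: vec_eq_iff forall_2)
  note hvg = h(1) h(2)[folded ends(1)] v(2) v(1)[folded ends(2)] g(1) g(2)[folded ends(3)] g(2) g(1)[folded ends(4)]
  have wy: "q$2 - q'$2 < 4/3" and wx: "q$1 - q'$1 < 4/3" and ws: "q$1 + q$2 - (q'$1 + q'$2) < 4/3"
    if "q \<in> K" "q' \<in> K" for q q'
    using width[OF hvg(1,2) that] width[OF hvg(3,4) that] width[OF hvg(5,6) that] by (auto simp: crs_def)
  \<comment> \<open>The three differences of \<open>c\<close> come from widths; those of
    \<open>cF\<close> come from this bound, the cap inequality with
    \<open>\<tau> = 2/3\<close>.\<close>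
  have F: "p$1 + q$2 - (r$1 + r$2) < 2" if "p \<in> K" "q \<in> K" "r \<in> K" for p q r
    using area_triangle_caps[OF K _ t that] A by simp
  have c: "\<bar>a\<bar> \<le> 1/3" "\<bar>d\<bar> \<le> 1/3" "a + \<gamma> \<le> 1/3 + (\<beta> + d)" "\<beta> + d \<le> 1/3 + (a + \<gamma>)"
    using wx[OF h(2) g(1)] wx[OF g(2) h(1)] wy[OF v(2) g(2)] wy[OF g(1) v(1)] ws[OF h(2) v(1)] ws[OF v(2) h(1)]
    by (auto simp: abs_le_iff)
  then have c': "a \<le> 1/3" "- a \<le> 1/3" "d \<le> 1/3" "- d \<le> 1/3" by auto
  have cF: "\<beta> < 1/2" "\<gamma> < 1/2" "\<beta> - a < 1/2" "\<beta> + d < 1/2" "\<gamma> - d < 1/2" "a + \<gamma> < 1/2"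
      "d - a + \<beta> < 1/2" "a - d + \<gamma> < 1/2"
    using F[OF g(2) g(1) h(1)] F[OF h(2) v(2) h(1)] F[OF h(2) v(2) v(1)] F[OF h(2) g(1) h(1)] F[OF g(2) v(2) h(1)]
      F[OF h(2) g(1) v(1)] F[OF g(2) v(2) v(1)] F[OF g(2) g(1) v(1)] by auto
  have hex: "\<beta> * \<gamma> - a * d > 1/12"
  proof -
    \<comment> \<open>Each cap is placed at an end of its own base, so all three vanish and only the
      area spanned by the segments remains.\<close>
    have "2 * (3/4 + a * d - \<beta> * \<gamma>) \<le> 2 * area K"
      using area_three_segments_caps[OF K h v g pos _ _ _ _ _ _ v(2) h(1) g(2)] cF pos by (simp add: crs_simps)
    then show ?thesis using A by simp
  qed
  have y1: "- \<beta> \<le> y"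
  proof (rule ccontr)
    assume "\<not> - \<beta> \<le> y"
    then have "\<beta> \<le> 1/6" "\<beta> + d \<le> 1/6" using wy[OF v(2) t(3)] wy[OF g(1) t(3)] by auto
    then show False using triangle_above_real[of \<beta> \<gamma> a d] hex pos c' cF by auto
  qed
  have x1: "- \<gamma> \<le> x"
  proof (rule ccontr)
    assume "\<not> - \<gamma> \<le> x"
    then have "\<gamma> \<le> 1/6" "\<gamma> + a \<le> 1/6" using wx[OF h(2) t(2)] wx[OF g(2) t(2)] by auto
    then show False using triangle_above_real[of \<gamma> \<beta> d a] hex pos c' cF by (auto simp: mult.commute)
  qed
  have s2: "x + y \<le> 2/3"
  proof (rule ccontr)
    assume "\<not> x + y \<le> 2/3"
    then have "\<beta> - a \<le> 1/6" "\<gamma> - d \<le> 1/6" using ws[OF t(1) h(1)] ws[OF t(1) v(1)] by auto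
    then show False using triangle_below_real[of \<beta> \<gamma> a d] hex pos c cF by auto
  qed
  \<comment> \<open>The side of the triangle parallel to a segment is 2/3 of it and serves as the
    second chord; \<open>r\<close> and \<open>q'\<close> will be ends of another segment on the two
    sides.\<close>
  have beyond: "2/3 > (crs l (q - z) + 2/3 * crs l (r - z)) / 2 + crs l (z - q') / 2"
    if "z \<in> K" "z + l \<in> K" "q \<in> K" "q + (2/3) *\<^sub>R l \<in> K" "r \<in> K" "q' \<in> K" "l \<noteq> 0" for z l q r q'
  proof -
    have "crs l (z - q') / 2 \<le> area (K \<inter> {x. crs l x \<le> crs l z})"
      using area_below_chord[OF K that(1,2,6), of 0 q'] that by simp
    moreover have "(crs l (q - z) + 2/3 * crs l (r - z)) / 2 \<le> area (K \<inter> {x. crs l z \<le> crs l x})"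
      by (intro area_above_chord K that) auto
    ultimately show ?thesis using area_split[OF K(2) that(7), of "crs l z"] A by linarith
  qed
  have nz: "pt 1 0 \<noteq> 0" "pt 0 (-1) \<noteq> 0" "pt (-1) 1 \<noteq> 0" by (auto simp: vec_eq_iff forall_2)
  have tt: "pt (x - 2/3) y + (2/3) *\<^sub>R pt 1 0 \<in> K" "pt x y + (2/3) *\<^sub>R pt 0 (-1) \<in> K"
    "pt x (y - 2/3) + (2/3) *\<^sub>R pt (-1) 1 \<in> K"
    using t by simp_all
  have y2: "y - 2/3 \<le> - \<beta>"
    using beyond[OF hvg(1,2) t(2) tt(1) g(1) g(2) nz(1)] cF by (simp add: field_simps)
  have x2: "x - 2/3 \<le> - \<gamma>"
    using beyond[OF hvg(3,4) t(1) tt(2) g(2) g(1) nz(2)] cF by (simp add: field_simps)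
  have s1: "0 \<le> x + y"
    using beyond[OF hvg(7,8) t(3) tt(3) h(1) h(2) nz(3)] cF by (simp add: field_simps)
  have "2 * (3/4 + a * d - \<beta> * \<gamma>)
     + crs (pt x y - pt (a + 1/2) (-\<beta>)) (pt (-\<gamma>) (d + 1/2) - pt (a + 1/2) (-\<beta>))
     + crs (pt (x - 2/3) y - pt (-1/2) (1/2)) (pt (a - 1/2) (-\<beta>) - pt (-1/2) (1/2))
     + crs (pt x (y - 2/3) - pt (-\<gamma>) (d - 1/2)) (pt (1/2) (-1/2) - pt (-\<gamma>) (d - 1/2)) \<le> 2 * area K"
    by (rule area_three_segments_caps[OF K h v g pos _ _ _ _ _ _ t]) (use cF x1 x2 y1 y2 s1 s2 in auto)
  \<comment> \<open>The position of the triangle has dropped out: the three edges that carry the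
    caps sum to zero.\<close>
  then have "17/24 + (a * d - \<beta> * \<gamma>) / 2 + (\<beta> + \<gamma>) / 12 \<le> area K"
    by (simp add: field_simps)
  moreover have "\<beta> * \<gamma> - a * d \<le> 1/12 + (\<beta> + \<gamma>) / 6"
    by (rule nonagon_real) (use pos c cF in auto)
  ultimately show False using A by argo
qed

section \<open>Affine coordinates and the bound for segments and triangles\<close>

lemma basis_expand:
  assumes "crs e1 e2 \<noteq> 0"
  shows "(crs w e2 / crs e1 e2) *\<^sub>R e1 + (crs e1 w / crs e1 e2) *\<^sub>R e2 = w"
proof -
  have "crs w e2 * e1$i + crs e1 w * e2$i = crs e1 e2 * w$i" if "i = 1 \<or> i = 2" for i :: 2
    using that by (auto simp: crs_def algebra_simps)
  then show ?thesis using assms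
    by (auto simp: vec_eq_iff forall_2 add_divide_distrib[symmetric])
qed

lemma area_coordinates:
  fixes e1 e2 c :: "real^2"
  assumes K: "convex K" "compact K" and D: "crs e1 e2 \<noteq> 0"
  defines "L \<equiv> {z. c + z$1 *\<^sub>R e1 + z$2 *\<^sub>R e2 \<in> K}"
  shows "convex L" "compact L" "area K = \<bar>crs e1 e2\<bar> * area L"
proof -
  define f where "f = (\<lambda>z::real^2. z$1 *\<^sub>R e1 + z$2 *\<^sub>R e2)"
  define g where "g = (\<lambda>w. pt (crs w e2 / crs e1 e2) (crs e1 w / crs e1 e2))"
  have lf: "linear f" by (rule linearI) (auto simp: f_def algebra_simps)
  have lg: "linear g"
    by (rule linearI) (auto simp: g_def vec_eq_iff forall_2 crs_simps add_divide_distrib)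
  have fg: "f (g w) = w" for w using basis_expand[OF D] by (simp add: f_def g_def)
  have gf: "g (f z) = z" for z
    using D by (simp add: f_def g_def crs_simps vec_eq_iff forall_2)
  have L: "L = g ` ((\<lambda>w. - c + w) ` K)"
  proof (intro set_eqI iffI)
    fix z assume "z \<in> L"
    then have "c + f z \<in> K" by (simp add: L_def f_def add.assoc)
    then have "g (- c + (c + f z)) \<in> g ` ((\<lambda>w. - c + w) ` K)" by blast
    then show "z \<in> g ` ((\<lambda>w. - c + w) ` K)" by (simp add: gf)
  next
    fix z assume "z \<in> g ` ((\<lambda>w. - c + w) ` K)"
    then obtain w where w: "w \<in> K" "z = g (- c + w)" by auto
    then have "f z = - c + w" by (simp add: fg)
    then show "z \<in> L" using w by (simp add: L_def f_def add.assoc)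
  qed
  show cL: "convex L" "compact L"
    unfolding L by (intro convex_linear_image[OF lg] convex_translation K
      compact_continuous_image[OF linear_continuous_on] compact_translation lg[unfolded linear_conv_bounded_linear])+
  have "K = (\<lambda>z. c + z) ` (f ` L)"
  proof (intro set_eqI iffI)
    fix w assume "w \<in> K"
    then have "g (- c + w) \<in> L" using fg[of "- c + w"] by (simp add: L_def f_def add.assoc)
    then have "c + f (g (- c + w)) \<in> (\<lambda>z. c + z) ` (f ` L)" by blast
    then show "w \<in> (\<lambda>z. c + z) ` (f ` L)" by (simp add: fg)
  qed (auto simp: L_def f_def add.assoc)
  then have "area K = area (f ` L)" by (simp add: area_def measure_translation)
  also have "\<dots> = \<bar>det (matrix f)\<bar> * area L"
    unfolding area_def using cL by (intro measure_linear_image lf) (auto simp: lmeasurable_compact)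
  also have "det (matrix f) = crs e1 e2"
    by (simp add: det_2 matrix_def f_def crs_def axis_def)
  finally show "area K = \<bar>crs e1 e2\<bar> * area L" .
qed

text \<open>Coordinates are taken with respect to \<open>e1\<close>, \<open>e2\<close> and the
  midpoint of the third segment. The two quotients in \<open>pos\<close> are then
  \<open>- \<beta>\<close> and \<open>- \<gamma>\<close>, so \<open>pos\<close> fixes the
  orientation of the triangle cut out by the three lines.\<close>

lemma area_hexagon_worms_half:
  assumes K: "convex K" "compact K" and D: "crs e1 e2 \<noteq> 0"
    and h: "h \<in> K" "h + e1 \<in> K" and v: "v \<in> K" "v + e2 \<in> K" and g: "g \<in> K" "g + (e1 - e2) \<in> K"
    and t: "t \<in> K" "t - (2/3) *\<^sub>R e1 \<in> K" "t - (2/3) *\<^sub>R e2 \<in> K"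
    and pos: "crs e1 (h - (g + (1/2) *\<^sub>R (e1 - e2))) / crs e1 e2
      + crs (v - (g + (1/2) *\<^sub>R (e1 - e2))) e2 / crs e1 e2 \<le> 0"
  shows "2/3 * \<bar>crs e1 e2\<bar> \<le> area K"
proof -
  define c where "c = g + (1/2) *\<^sub>R (e1 - e2)"
  define X where "X w = crs (w - c) e2 / crs e1 e2" for w
  define Y where "Y w = crs e1 (w - c) / crs e1 e2" for w
  have XY: "c + X w *\<^sub>R e1 + Y w *\<^sub>R e2 = w" for w
    using basis_expand[OF D, of "w - c"] by (simp add: X_def Y_def algebra_simps)
  let ?L = "{z. c + z$1 *\<^sub>R e1 + z$2 *\<^sub>R e2 \<in> K}"
  note L = area_coordinates[OF K D, of c]
  have mem: "pt (X w + r) (Y w + s) \<in> ?L" if "w + r *\<^sub>R e1 + s *\<^sub>R e2 \<in> K" for w r s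
  proof -
    have "c + (X w + r) *\<^sub>R e1 + (Y w + s) *\<^sub>R e2 = w + r *\<^sub>R e1 + s *\<^sub>R e2"
      using XY[of w] by (simp add: algebra_simps)
    then show ?thesis using that by simp
  qed
  have Xg: "X g = - 1/2" "Y g = 1/2"
    using D by (simp_all add: X_def Y_def c_def crs_simps field_simps)
  have "2/3 \<le> area ?L"
  proof (rule area_hexagon_worms_aux[OF L(1,2)])
    show "pt (X h + 1/2 - 1/2) (- (- Y h)) \<in> ?L" using mem[of h 0 0] h by simp
    show "pt (X h + 1/2 + 1/2) (- (- Y h)) \<in> ?L" using mem[of h 1 0] h by (simp add: add.assoc)
    show "pt (- (- X v)) (Y v + 1/2 - 1/2) \<in> ?L" using mem[of v 0 0] v by simp
    show "pt (- (- X v)) (Y v + 1/2 + 1/2) \<in> ?L" using mem[of v 0 1] v by (simp add: add.assoc)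
    show "pt (- 1/2) (1/2) \<in> ?L" using mem[of g 0 0] g Xg by simp
    show "pt (1/2) (- 1/2) \<in> ?L" using mem[of g 1 "-1"] g Xg by (simp add: add_diff_eq)
    show "pt (X t) (Y t) \<in> ?L" using mem[of t 0 0] t by simp
    show "pt (X t - 2/3) (Y t) \<in> ?L" using mem[of t "-2/3" 0] t by simp
    show "pt (X t) (Y t - 2/3) \<in> ?L" using mem[of t 0 "-2/3"] t by simp
    show "0 \<le> - Y h + - X v" using pos by (simp add: X_def Y_def c_def)
  qed
  then show ?thesis using L(3) D mult_left_mono[of "2/3" "area ?L" "\<bar>crs e1 e2\<bar>"] by simp
qed

text \<open>The point reflection that replaces \<open>e1\<close>, \<open>e2\<close> by their
  negatives changes the sign of the orientation term \<open>?s\<close> and turns \<open>t'\<close>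
  into a triangle of the first kind. This is why both triangles are present.\<close>

lemma area_hexagon_worms:
  assumes K: "convex K" "compact K"
    and h: "h \<in> K" "h + e1 \<in> K" and v: "v \<in> K" "v + e2 \<in> K" and g: "g \<in> K" "g + (e1 - e2) \<in> K"
    and t: "t \<in> K" "t - (2/3) *\<^sub>R e1 \<in> K" "t - (2/3) *\<^sub>R e2 \<in> K"
    and t': "t' \<in> K" "t' + (2/3) *\<^sub>R e1 \<in> K" "t' + (2/3) *\<^sub>R e2 \<in> K"
  shows "2/3 * \<bar>crs e1 e2\<bar> \<le> area K"
proof (cases "crs e1 e2 = 0")
  case True
  then show ?thesis by (simp add: area_nonneg)
next
  case D: False
  let ?c = "g + (1/2) *\<^sub>R (e1 - e2)"
  let ?s = "crs e1 (h - ?c) / crs e1 e2 + crs (v - ?c) e2 / crs e1 e2"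
  show ?thesis
  proof (cases "?s \<le> 0")
    case True
    then show ?thesis using area_hexagon_worms_half[OF K D h v g t] by blast
  next
    case False
    have c: "g + (e1 - e2) + (1/2) *\<^sub>R (- e1 - - e2) = ?c"
      by (simp add: vec_eq_iff forall_2 field_simps)
    have "crs (- e1) (h + e1 - (g + (e1 - e2) + (1/2) *\<^sub>R (- e1 - - e2))) / crs (- e1) (- e2)
      + crs (v + e2 - (g + (e1 - e2) + (1/2) *\<^sub>R (- e1 - - e2))) (- e2) / crs (- e1) (- e2) = - ?s"
      unfolding c by (simp add: crs_simps diff_divide_distrib add_divide_distrib)
    then have "2/3 * \<bar>crs (- e1) (- e2)\<bar> \<le> area K"
      using False D h v g t'
      by (intro area_hexagon_worms_half[OF K, of "- e1" "- e2" "h + e1" "v + e2" "g + (e1 - e2)" t'])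
        (auto simp: crs_simps)
    then show ?thesis by (simp add: crs_simps)
  qed
qed

section \<open>Closed characteristics from billiard triangles\<close>

text \<open>Edge \<open>k\<close> is traversed with constant velocity during the times from
  \<open>k\<close> to \<open>k + 1\<close>. As a sum of clamped increments the loop is Lipschitz
  term by term, without any case distinction on \<open>t\<close>.\<close>

definition polygonal_loop :: "nat \<Rightarrow> (nat \<Rightarrow> 'a::real_normed_vector) \<Rightarrow> real \<Rightarrow> 'a" where
  "polygonal_loop n z t = z 0 + (\<Sum>k<n. max 0 (min 1 (t - real k)) *\<^sub>R (z (Suc k) - z k))"

lemma polygonal_loop_edge:
  assumes "k < n" "real k \<le> t" "t \<le> real k + 1"
  shows "polygonal_loop n z t = z k + (t - real k) *\<^sub>R (z (Suc k) - z k)"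
proof -
  have "(\<Sum>j<n. max 0 (min 1 (t - real j)) *\<^sub>R (z (Suc j) - z j))
      = (\<Sum>j<Suc k. max 0 (min 1 (t - real j)) *\<^sub>R (z (Suc j) - z j))"
  proof (rule sum.mono_neutral_right)
    show "\<forall>j\<in>{..<n} - {..<Suc k}. max 0 (min 1 (t - real j)) *\<^sub>R (z (Suc j) - z j) = 0"
    proof
      fix j assume "j \<in> {..<n} - {..<Suc k}"
      then have "real k + 1 \<le> real j" by auto
      then show "max 0 (min 1 (t - real j)) *\<^sub>R (z (Suc j) - z j) = 0" using assms by simp
    qed
  qed (use assms in auto)
  also have "\<dots> = (\<Sum>j<k. z (Suc j) - z j) + (t - real k) *\<^sub>R (z (Suc k) - z k)"
  proof -
    have "max 0 (min 1 (t - real j)) = 1" if "j < k" for j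
    proof -
      from that have "real j + 1 \<le> real k" by linarith
      then show ?thesis using assms by simp
    qed
    then show ?thesis using assms by simp
  qed
  also have "\<dots> = z k - z 0 + (t - real k) *\<^sub>R (z (Suc k) - z k)"
    by (simp add: sum_lessThan_telescope)
  finally show ?thesis by (simp add: polygonal_loop_def)
qed

lemma polygonal_loop_lipschitz:
  "norm (polygonal_loop n z t - polygonal_loop n z s) \<le> (\<Sum>k<n. norm (z (Suc k) - z k)) * \<bar>t - s\<bar>"
proof -
  have "polygonal_loop n z t - polygonal_loop n z s
     = (\<Sum>k<n. (max 0 (min 1 (t - real k)) - max 0 (min 1 (s - real k))) *\<^sub>R (z (Suc k) - z k))"
    by (simp add: polygonal_loop_def sum_subtractf scaleR_left_diff_distrib)
  also have "norm \<dots> \<le> (\<Sum>k<n. \<bar>t - s\<bar> * norm (z (Suc k) - z k))"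
    by (intro sum_norm_le) (auto intro!: mult_right_mono)
  finally show ?thesis by (simp add: sum_distrib_left mult.commute)
qed

lemma lipschitz_imp_abs_continuous_on:
  assumes "\<And>s t. norm (f t - f s) \<le> M * \<bar>t - s\<bar>"
  shows "abs_continuous_on a b f"
  unfolding abs_continuous_on_def
proof (intro allI impI)
  fix e :: real assume "e > 0"
  have M: "M \<ge> 0" using order_trans[OF norm_ge_zero assms[of 1 0]] by simp
  show "\<exists>d>0. \<forall>(n::nat) u v.
        (\<forall>i<n. a \<le> u i \<and> u i \<le> v i \<and> v i \<le> b) \<and>
        (\<forall>i<n. \<forall>j<n. i \<noteq> j \<longrightarrow> v i \<le> u j \<or> v j \<le> u i) \<and>
        (\<Sum>i<n. v i - u i) < d \<longrightarrow> (\<Sum>i<n. norm (f (v i) - f (u i))) < e"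
  proof (intro exI[of _ "e / (M + 1)"] conjI allI impI)
    show "0 < e / (M + 1)" using M \<open>e > 0\<close> by simp
    fix n :: nat and u v :: "nat \<Rightarrow> real"
    assume *: "(\<forall>i<n. a \<le> u i \<and> u i \<le> v i \<and> v i \<le> b) \<and>
        (\<forall>i<n. \<forall>j<n. i \<noteq> j \<longrightarrow> v i \<le> u j \<or> v j \<le> u i) \<and> (\<Sum>i<n. v i - u i) < e / (M + 1)"
    have "(\<Sum>i<n. norm (f (v i) - f (u i))) \<le> (\<Sum>i<n. (M + 1) * (v i - u i))"
    proof (intro sum_mono)
      fix i assume "i \<in> {..<n}"
      then have "u i \<le> v i" using * by auto
      then show "norm (f (v i) - f (u i)) \<le> (M + 1) * (v i - u i)"
        using assms[of "v i" "u i"] by (simp add: algebra_simps)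
    qed
    also have "\<dots> = (M + 1) * (\<Sum>i<n. v i - u i)" by (simp add: sum_distrib_left)
    also have "\<dots> < (M + 1) * (e / (M + 1))" using * M by (intro mult_strict_left_mono) auto
    also have "\<dots> = e" using M by simp
    finally show "(\<Sum>i<n. norm (f (v i) - f (u i))) < e" .
  qed
qed

lemma polygonal_loop_deriv:
  assumes "k < n" "real k < t" "t < real k + 1"
  shows "(polygonal_loop n z has_vector_derivative z (Suc k) - z k) (at t)"
proof -
  have "((\<lambda>t. z k + (t - real k) *\<^sub>R (z (Suc k) - z k)) has_vector_derivative z (Suc k) - z k) (at t)"
    by (auto intro!: derivative_eq_intros)
  then show ?thesis
    by (rule has_vector_derivative_transform_within_open[of _ _ _ "{real k<..<real k + 1}"])
      (use assms in \<open>auto simp: polygonal_loop_edge\<close>)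
qed

lemma closed_characteristic_polygonal_loop:
  assumes "z n = z 0" and ne: "\<exists>k<n. z k \<noteq> z 0"
    and edge: "\<And>k s. k < n \<Longrightarrow> 0 \<le> s \<Longrightarrow> s \<le> 1 \<Longrightarrow> z k + s *\<^sub>R (z (Suc k) - z k) \<in> frontier C"
    "\<And>k s. k < n \<Longrightarrow> 0 \<le> s \<Longrightarrow> s \<le> 1 \<Longrightarrow>
       z (Suc k) - z k \<in> Jmap ` normal_cone C (z k + s *\<^sub>R (z (Suc k) - z k))"
  shows "closed_characteristic C (real n) (polygonal_loop n z)"
proof -
  have pos: "n > 0" using ne by auto
  have locate: "\<exists>k<n. real k \<le> t \<and> t \<le> real k + 1" if "t \<in> {0..real n}" for t
  proof (cases "t = real n")
    case True
    then show ?thesis using pos by (intro exI[of _ "n - 1"]) auto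
  next
    case False
    define k where "k = nat \<lfloor>t\<rfloor>"
    have "real k \<le> t" "t < real k + 1" using that by (auto simp: k_def)
    moreover have "k < n" using \<open>real k \<le> t\<close> that False by auto
    ultimately show ?thesis by auto
  qed
  have at_vertex: "polygonal_loop n z (real k) = z k" if "k < n" for k
    using polygonal_loop_edge[OF that, of "real k" z] by simp
  have at_n: "polygonal_loop n z (real n) = z n"
    using polygonal_loop_edge[of "n - 1" n "real n" z] pos by (simp add: of_nat_diff)
  \<comment> \<open>Differentiability is in doubt only at the vertices, which are passed at finitely
    many integer times.\<close>
  have "AE t in lebesgue. t \<notin> real ` {..n}"
    by (intro AE_not_in) (simp add: negligible_iff_null_sets[symmetric] negligible_finite)
  then have AE: "AE t in lebesgue. t \<in> {0..real n} \<longrightarrow>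
        polygonal_loop n z differentiable (at t) \<and>
        vector_derivative (polygonal_loop n z) (at t) \<in> Jmap ` normal_cone C (polygonal_loop n z t)"
  proof (rule AE_mp, intro AE_I2 impI)
    fix t assume t: "t \<notin> real ` {..n}" "t \<in> {0..real n}"
    then obtain k where k: "k < n" "real k \<le> t" "t \<le> real k + 1" using locate by blast
    then have "real k \<noteq> t" "t \<noteq> real (Suc k)" using t(1) by (auto simp del: of_nat_Suc)
    then have k': "real k < t" "t < real k + 1" using k by auto
    note d = polygonal_loop_deriv[OF k(1) k', of z]
    then show "polygonal_loop n z differentiable (at t) \<and>
        vector_derivative (polygonal_loop n z) (at t) \<in> Jmap ` normal_cone C (polygonal_loop n z t)"
      using edge(2)[OF k(1), of "t - real k"] k
      by (auto simp: vector_derivative_at polygonal_loop_edge differentiableI_vector)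
  qed
  show ?thesis
    unfolding closed_characteristic_def
  proof (intro conjI AE ballI)
    show "real n > 0" using pos by simp
    show "polygonal_loop n z 0 = polygonal_loop n z (real n)"
      using at_vertex[OF pos] at_n assms(1) by simp
    show "abs_continuous_on 0 (real n) (polygonal_loop n z)"
      by (rule lipschitz_imp_abs_continuous_on[OF polygonal_loop_lipschitz])
    show "\<exists>t\<in>{0..real n}. polygonal_loop n z t \<noteq> polygonal_loop n z 0"
    proof -
      obtain k where "k < n" "z k \<noteq> z 0" using ne by blast
      then show ?thesis using at_vertex[of k] at_vertex[OF pos] by (intro bexI[of _ "real k"]) auto
    qed
    fix t assume "t \<in> {0..real n}"
    then obtain k where k: "k < n" "real k \<le> t" "t \<le> real k + 1" using locate by blast
    then show "polygonal_loop n z t \<in> frontier C"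
      using edge(1)[OF k(1), of "t - real k"] by (simp add: polygonal_loop_edge)
  qed
qed

text \<open>Orthogonality of the two components of an edge makes the integrand constant along it;
  for billiard loops it holds because only one component moves at a time.\<close>

lemma action_polygonal_loop:
  assumes orth: "\<And>k. k < n \<Longrightarrow> snd (z (Suc k) - z k) \<bullet> fst (z (Suc k) - z k) = 0"
  shows "action (real n) (polygonal_loop n z) = (\<Sum>k<n. snd (z k) \<bullet> fst (z (Suc k) - z k))"
proof -
  let ?f = "\<lambda>t. snd (polygonal_loop n z t) \<bullet> fst (vector_derivative (polygonal_loop n z) (at t))"
  have "(?f has_integral (\<Sum>k<m. snd (z k) \<bullet> fst (z (Suc k) - z k))) {0..real m}" if "m \<le> n" for m
    using that
  proof (induction m)
    case 0
    then show ?case using has_integral_refl(2)[of ?f "0::real"] by simp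
  next
    case (Suc m)
    let ?w = "snd (z m) \<bullet> fst (z (Suc m) - z m)"
    have "((\<lambda>t. ?w) has_integral ?w) (cbox (real m) (real m + 1))"
      using has_integral_const_real[of ?w "real m" "real m + 1"] by simp
    then have "(?f has_integral ?w) (cbox (real m) (real m + 1))"
    proof (rule has_integral_spike_interior)
      fix t assume "t \<in> box (real m) (real m + 1)"
      then have t: "real m < t" "t < real m + 1" by auto
      have "polygonal_loop n z t = z m + (t - real m) *\<^sub>R (z (Suc m) - z m)"
        using Suc.prems t by (intro polygonal_loop_edge) auto
      then have "?f t = (snd (z m) + (t - real m) *\<^sub>R snd (z (Suc m) - z m)) \<bullet> fst (z (Suc m) - z m)"
        using Suc.prems t polygonal_loop_deriv[of m n t z, THEN vector_derivative_at] by simp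
      then show "?f t = ?w" using orth[of m] Suc.prems by (simp add: inner_add_left)
    qed
    then have "(?f has_integral ?w) {real m..real (Suc m)}" by (simp add: add.commute)
    moreover have "(?f has_integral (\<Sum>k<m. snd (z k) \<bullet> fst (z (Suc k) - z k))) {0..real m}"
      using Suc by simp
    ultimately show ?case
      using has_integral_combine[of 0 "real m" "real (Suc m)" ?f] by auto
  qed
  from this[of n] show ?thesis by (simp add: action_def integral_unique)
qed

lemma normal_cone_interior:
  assumes "v \<in> normal_cone C x" "x \<in> interior C"
  shows "v = 0"
proof (rule ccontr)
  assume v: "v \<noteq> 0"
  obtain e where e: "e > 0" "cball x e \<subseteq> C" using assms(2) mem_interior_cball by blast
  let ?y = "x + (e / norm v) *\<^sub>R v"
  have "?y \<in> cball x e" using e v by (simp add: dist_norm)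
  then have "?y \<in> C" using e(2) by blast
  then have "v \<bullet> (?y - x) \<le> 0" using assms(1) unfolding normal_cone_def by blast
  moreover have "0 < (e / norm v) * (v \<bullet> v)" using e v by simp
  ultimately show False by simp
qed

text \<open>
  The loop runs through \<open>(q2,p1), (q1,p1), (q1,p3), (q3,p3), (q3,p2), (q2,p2)\<close>: with this sign of \<open>J\<close>
  the billiard triangle is traversed backwards.
\<close>
lemma billiard_closed_characteristic:
  assumes K: "convex K" "closed K" and Q: "convex Q" "closed Q"
    and q: "q1 \<in> K" "q2 \<in> K" "q3 \<in> K" and p: "p1 \<in> Q" "p2 \<in> Q" "p3 \<in> Q"
    and nK: "p3 - p1 \<in> normal_cone K q1" "p1 - p2 \<in> normal_cone K q2" "p2 - p3 \<in> normal_cone K q3"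
    and nQ: "q2 - q1 \<in> normal_cone Q p1" "q3 - q2 \<in> normal_cone Q p2" "q1 - q3 \<in> normal_cone Q p3"
    and ne: "\<not> (q1 = q2 \<and> q2 = q3)"
  shows "\<exists>T \<gamma>. closed_characteristic (K \<times> Q) T \<gamma>
    \<and> \<bar>action T \<gamma>\<bar> = p1 \<bullet> (q2 - q1) + p2 \<bullet> (q3 - q2) + p3 \<bullet> (q1 - q3)"
proof -
  define zs where "zs = [(q2,p1), (q1,p1), (q1,p3), (q3,p3), (q3,p2), (q2,p2), (q2,p1)]"
  define z where "z = nth zs"
  have z: "z 0 = (q2,p1)" "z (Suc 0) = (q1,p1)" "z (Suc (Suc 0)) = (q1,p3)" "z (Suc (Suc (Suc 0))) = (q3,p3)"
      "z (Suc (Suc (Suc (Suc 0)))) = (q3,p2)" "z (Suc (Suc (Suc (Suc (Suc 0))))) = (q2,p2)"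
      "z (Suc (Suc (Suc (Suc (Suc (Suc 0)))))) = (q2,p1)"
    by (simp_all add: z_def zs_def)
  have less6: "k = 0 \<or> k = Suc 0 \<or> k = Suc (Suc 0) \<or> k = Suc (Suc (Suc 0)) \<or> k = Suc (Suc (Suc (Suc 0)))
      \<or> k = Suc (Suc (Suc (Suc (Suc 0))))" if "k < 6" for k :: nat using that by auto
  have seg: "x + s *\<^sub>R (y - x) \<in> S" if "convex S" "x \<in> S" "y \<in> S" "0 \<le> s" "s \<le> 1" for x y :: "real^2" and s S
    using convexD_alt[OF that] by (simp add: algebra_simps)
  have fr: "(x, y) \<in> frontier (K \<times> Q)" if "x \<in> K" "y \<in> Q" "\<not> (x \<in> interior K \<and> y \<in> interior Q)" for x y
    using that K Q by (simp add: frontier_def closure_closed closed_Times interior_Times)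
  \<comment> \<open>Vertices of the billiard triangle may coincide, and zero is a normal vector
    everywhere. If the loop entered the interior of the product, the normal vectors at that place
    would all vanish and the triangle would collapse to a point, which \<open>ne\<close>
    excludes.\<close>
  have frQ: "(q + s *\<^sub>R (q' - q), p) \<in> frontier (K \<times> Q)"
    if "q \<in> K" "q' \<in> K" "p \<in> Q" "0 \<le> s" "s \<le> 1" "q - q' \<in> normal_cone Q p" "p' - p \<in> normal_cone K q'" 
      "q' - q'' \<in> normal_cone Q p'" "\<not> (q = q' \<and> q' = q'')" for q q' q'' p p' s
  proof (rule fr)
    show "q + s *\<^sub>R (q' - q) \<in> K" using that K by (intro seg) auto
    show "p \<in> Q" by fact
    show "\<not> (q + s *\<^sub>R (q' - q) \<in> interior K \<and> p \<in> interior Q)"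
    proof
      assume *: "q + s *\<^sub>R (q' - q) \<in> interior K \<and> p \<in> interior Q"
      then have "q = q'" using normal_cone_interior[OF that(6)] by simp
      then have "p' = p" using * normal_cone_interior[OF that(7)] by simp
      then have "q' = q''" using * normal_cone_interior[OF that(8)] by simp
      then show False using \<open>q = q'\<close> that(9) by simp
    qed
  qed
  have frK: "(q, p + s *\<^sub>R (p' - p)) \<in> frontier (K \<times> Q)"
    if "q \<in> K" "p \<in> Q" "p' \<in> Q" "0 \<le> s" "s \<le> 1" "p' - p \<in> normal_cone K q" "q - q'' \<in> normal_cone Q p'"
      "q' - q \<in> normal_cone Q p" "\<not> (q' = q \<and> q = q'')" for q q' q'' p p' s
  proof (rule fr)
    show "p + s *\<^sub>R (p' - p) \<in> Q" using that Q by (intro seg) auto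
    show "q \<in> K" by fact
    show "\<not> (q \<in> interior K \<and> p + s *\<^sub>R (p' - p) \<in> interior Q)"
    proof
      assume *: "q \<in> interior K \<and> p + s *\<^sub>R (p' - p) \<in> interior Q"
      then have "p' = p" using normal_cone_interior[OF that(6)] by simp
      then have "q = q''" "q' = q" using * normal_cone_interior[OF that(7)] normal_cone_interior[OF that(8)] by auto
      then show False using that(9) by simp
    qed
  qed
  have JQ: "(- v, 0) \<in> Jmap ` normal_cone (K \<times> Q) (x, y)" if "v \<in> normal_cone Q y" for v x y
    using that by (intro image_eqI[of _ _ "(0, v)"]) (auto simp: Jmap_def normal_cone_def)
  have JK: "(0, v) \<in> Jmap ` normal_cone (K \<times> Q) (x, y)" if "v \<in> normal_cone K x" for v x y
    using that by (intro image_eqI[of _ _ "(v, 0)"]) (auto simp: Jmap_def normal_cone_def)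
  have "closed_characteristic (K \<times> Q) (real 6) (polygonal_loop 6 z)"
  proof (rule closed_characteristic_polygonal_loop)
    show "z 6 = z 0" by (simp add: z eval_nat_numeral)
    show "\<exists>k<6. z k \<noteq> z 0"
    proof (cases "q1 = q2")
      case False
      then show ?thesis by (intro exI[of _ "Suc 0"]) (simp add: z)
    next
      case True
      then show ?thesis using ne by (intro exI[of _ "Suc (Suc (Suc 0))"]) (auto simp: z)
    qed
    fix k :: nat and s :: real assume k: "k < 6" and s: "0 \<le> s" "s \<le> 1"
    show "z k + s *\<^sub>R (z (Suc k) - z k) \<in> frontier (K \<times> Q)"
      using less6[OF k]
    proof (elim disjE)
      assume "k = 0"
      then show ?thesis using frQ[OF q(2,1) p(1) s nQ(1) nK(1) nQ(3)] ne by (auto simp: z)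
    next
      assume "k = Suc 0"
      then show ?thesis using frK[OF q(1) p(1,3) s nK(1) nQ(3) nQ(1)] ne by (auto simp: z)
    next
      assume "k = Suc (Suc 0)"
      then show ?thesis using frQ[OF q(1,3) p(3) s nQ(3) nK(3) nQ(2)] ne by (auto simp: z)
    next
      assume "k = Suc (Suc (Suc 0))"
      then show ?thesis using frK[OF q(3) p(3,2) s nK(3) nQ(2) nQ(3)] ne by (auto simp: z)
    next
      assume "k = Suc (Suc (Suc (Suc 0)))"
      then show ?thesis using frQ[OF q(3,2) p(2) s nQ(2) nK(2) nQ(1)] ne by (auto simp: z)
    next
      assume "k = Suc (Suc (Suc (Suc (Suc 0))))"
      then show ?thesis using frK[OF q(2) p(2,1) s nK(2) nQ(1) nQ(2)] ne by (auto simp: z)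
    qed
    show "z (Suc k) - z k \<in> Jmap ` normal_cone (K \<times> Q) (z k + s *\<^sub>R (z (Suc k) - z k))"
      using less6[OF k] JQ[OF nQ(1)] JQ[OF nQ(2)] JQ[OF nQ(3)] JK[OF nK(1)] JK[OF nK(2)] JK[OF nK(3)]
      by (elim disjE) (simp_all add: z)
  qed
  moreover have "\<bar>action (real 6) (polygonal_loop 6 z)\<bar> = p1 \<bullet> (q2 - q1) + p2 \<bullet> (q3 - q2) + p3 \<bullet> (q1 - q3)"
  proof -
    have "action (real 6) (polygonal_loop 6 z) = (\<Sum>k<6. snd (z k) \<bullet> fst (z (Suc k) - z k))"
    proof (rule action_polygonal_loop)
      fix k :: nat assume "k < 6"
      from less6[OF this] show "snd (z (Suc k) - z k) \<bullet> fst (z (Suc k) - z k) = 0"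
        by (elim disjE) (simp_all add: z)
    qed
    also have "\<dots> = - (p1 \<bullet> (q2 - q1) + p2 \<bullet> (q3 - q2) + p3 \<bullet> (q1 - q3))"
      by (simp add: eval_nat_numeral z inner_diff_right)
    finally have "action (real 6) (polygonal_loop 6 z) = \<dots>" .
    \<comment> \<open>Replacing \<open>p2\<close> and \<open>p3\<close> by \<open>p1\<close> does
      not increase the length and makes it zero, so the length is nonnegative.\<close>
    moreover have "(q3 - q2) \<bullet> (p1 - p2) \<le> 0" "(q1 - q3) \<bullet> (p1 - p3) \<le> 0"
      using nQ(2,3) p(1) by (auto simp: normal_cone_def)
    then have "0 \<le> p1 \<bullet> (q2 - q1) + p2 \<bullet> (q3 - q2) + p3 \<bullet> (q1 - q3)"
      by (simp add: algebra_simps inner_commute)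
    ultimately show ?thesis by simp
  qed
  ultimately show ?thesis by blast
qed

text \<open>The translates of the first vertex stay in the compact \<open>K\<close>, so a
  subsequence converges; since the factors tend to 1, the translations converge with it.\<close>

lemma translate_limit:
  fixes q1 q2 q3 :: "'a::euclidean_space"
  assumes K: "compact K"
    and fits: "\<And>r::real. 0 < r \<Longrightarrow> r < 1 \<Longrightarrow> \<exists>t. r *\<^sub>R q1 + t \<in> K \<and> r *\<^sub>R q2 + t \<in> K \<and> r *\<^sub>R q3 + t \<in> K"
  shows "\<exists>t. q1 + t \<in> K \<and> q2 + t \<in> K \<and> q3 + t \<in> K"
proof -
  \<comment> \<open>The summand 2 keeps \<open>r 0\<close> positive.\<close>
  define r where "r n = 1 - inverse (real n + 2)" for n :: nat
  have r: "0 < r n" "r n < 1" for n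
    by (auto simp: r_def inverse_eq_divide field_simps)
  have "r \<longlonglongrightarrow> 1 - 0"
    unfolding r_def
    by (intro tendsto_intros tendsto_inverse_0_at_top filterlim_tendsto_add_at_top[OF _ filterlim_real_sequentially, of _ 2, simplified add.commute])
  then have rlim: "r \<longlonglongrightarrow> 1" by simp
  have "\<exists>t. \<forall>n. r n *\<^sub>R q1 + t n \<in> K \<and> r n *\<^sub>R q2 + t n \<in> K \<and> r n *\<^sub>R q3 + t n \<in> K"
    using fits[OF r] by metis
  then obtain t where t: "r n *\<^sub>R q1 + t n \<in> K" "r n *\<^sub>R q2 + t n \<in> K" "r n *\<^sub>R q3 + t n \<in> K" for n
    by blast
  define s where "s n = r n *\<^sub>R q1 + t n" for n
  have "\<forall>n. s n \<in> K" using t by (simp add: s_def)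
  then obtain l \<phi> where l: "l \<in> K" "strict_mono \<phi>" "(s \<circ> \<phi>) \<longlonglongrightarrow> l"
    using K unfolding compact_def by blast
  have rphi: "(\<lambda>n. r (\<phi> n)) \<longlonglongrightarrow> 1"
    using LIMSEQ_subseq_LIMSEQ[OF rlim l(2)] by (simp add: o_def)
  have "q + (l - q1) \<in> K" if "\<And>n. r n *\<^sub>R q + t n \<in> K" for q
  proof -
    have lim: "(\<lambda>n. s (\<phi> n) + r (\<phi> n) *\<^sub>R (q - q1)) \<longlonglongrightarrow> l + 1 *\<^sub>R (q - q1)"
      using l(3) rphi by (intro tendsto_intros) (simp_all add: o_def)
    have mem: "s (\<phi> n) + r (\<phi> n) *\<^sub>R (q - q1) \<in> K" for n
      using that[of "\<phi> n"] by (simp add: s_def algebra_simps)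
    have "l + 1 *\<^sub>R (q - q1) \<in> K"
      by (rule closed_sequentially[OF compact_imp_closed[OF K] mem lim])
    then show ?thesis by (simp add: algebra_simps)
  qed
  then show ?thesis using t by blast
qed

section \<open>The length of a triangle as a support function\<close>

type_synonym triangle = "(real^2) \<times> (real^2) \<times> (real^2)"

text \<open>Summation by parts turns the length, a sum of maxima over \<open>Q\<close>, into the
  support function of one convex compact set in the space of triangles. A subgradient of the length
  is then a triple of differences of points of \<open>Q\<close>, which is what the reflection law
  needs.\<close>

definition length_functionals :: "(real^2) set \<Rightarrow> triangle set" where
  "length_functionals Q = (\<lambda>(p1, p2, p3). (p3 - p1, p1 - p2, p2 - p3)) ` (Q \<times> Q \<times> Q)"

definition triangle_length :: "(real^2) set \<Rightarrow> triangle \<Rightarrow> real" where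
  "triangle_length Q q = (SUP p\<in>length_functionals Q. p \<bullet> q)"

abbreviation diag :: "real^2 \<Rightarrow> triangle" where "diag t \<equiv> (t, t, t)"

lemma length_functionals_convex_compact:
  assumes "convex Q" "compact Q"
  shows "convex (length_functionals Q)" "compact (length_functionals Q)"
proof -
  let ?B = "\<lambda>p::triangle. (snd (snd p) - fst p, fst p - fst (snd p), fst (snd p) - snd (snd p))"
  have B: "(\<lambda>(p1, p2, p3). (p3 - p1, p1 - p2, p2 - p3)) = ?B" by (auto simp: fun_eq_iff)
  have "linear ?B" by (rule linearI) (auto simp: algebra_simps)
  then show "convex (length_functionals Q)"
    unfolding length_functionals_def B by (intro convex_linear_image convex_Times assms)
  show "compact (length_functionals Q)"
    unfolding length_functionals_def B
    by (intro compact_continuous_image compact_Times assms continuous_intros)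
qed

lemma length_functional_inner:
  "(p3 - p1, p1 - p2, p2 - p3) \<bullet> (q1, q2, q3) = p1 \<bullet> (q2 - q1) + p2 \<bullet> (q3 - q2) + p3 \<bullet> (q1 - q3)"
  for p1 :: "'a::real_inner"
  by (simp add: algebra_simps)

context
  fixes Q :: "(real^2) set"
  assumes Q: "convex Q" "compact Q" "Q \<noteq> {}"
begin

lemma length_functionals_bdd: "bdd_above ((\<lambda>p. p \<bullet> q) ` length_functionals Q)"
  using length_functionals_convex_compact(2)[OF Q(1,2)]
  by (intro bounded_imp_bdd_above compact_imp_bounded compact_continuous_image continuous_intros)

lemma length_functionals_ne: "length_functionals Q \<noteq> {}"
  using Q(3) by (auto simp: length_functionals_def)

lemma triangle_length_ge: "p \<in> length_functionals Q \<Longrightarrow> p \<bullet> q \<le> triangle_length Q q"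
  unfolding triangle_length_def by (intro cSUP_upper length_functionals_bdd)

lemma triangle_length_le: "(\<And>p. p \<in> length_functionals Q \<Longrightarrow> p \<bullet> q \<le> c) \<Longrightarrow> triangle_length Q q \<le> c"
  unfolding triangle_length_def using length_functionals_ne by (intro cSUP_least)

lemma triangle_length_nonneg: "0 \<le> triangle_length Q q"
proof -
  obtain p where "p \<in> Q" using Q(3) by blast
  then have "(p - p, p - p, p - p) \<in> length_functionals Q"
    unfolding length_functionals_def by (intro image_eqI[of _ _ "(p,p,p)"]) auto
  from triangle_length_ge[OF this, of q] show ?thesis by (cases q) simp
qed

lemma triangle_length_diag: "triangle_length Q (q + diag t) = triangle_length Q q"
proof -
  have "p \<bullet> (q + diag t) = p \<bullet> q" if "p \<in> length_functionals Q" for p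
    using that by (auto simp: length_functionals_def inner_add_right inner_diff_left)
  then show ?thesis unfolding triangle_length_def by (simp cong: SUP_cong)
qed

lemma triangle_length_scale_le:
  assumes "0 \<le> r" shows "triangle_length Q (r *\<^sub>R q) \<le> r * triangle_length Q q"
  using assms by (intro triangle_length_le) (auto intro!: mult_left_mono triangle_length_ge)

lemma continuous_triangle_length: "continuous_on S (triangle_length Q)"
proof -
  obtain R where R: "\<And>p. p \<in> length_functionals Q \<Longrightarrow> norm p \<le> R"
    using length_functionals_convex_compact(2)[OF Q(1,2)] compact_imp_bounded bounded_iff by metis
  have le: "triangle_length Q x \<le> triangle_length Q y + R * norm (x - y)" for x y
  proof (rule triangle_length_le)
    fix p assume p: "p \<in> length_functionals Q"
    have "p \<bullet> (x - y) \<le> norm p * norm (x - y)" by (rule norm_cauchy_schwarz)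
    also have "\<dots> \<le> R * norm (x - y)" using R[OF p] by (intro mult_right_mono) auto
    finally show "p \<bullet> x \<le> triangle_length Q y + R * norm (x - y)"
      using triangle_length_ge[OF p, of y] by (simp add: inner_diff_right)
  qed
  have "\<bar>triangle_length Q x - triangle_length Q y\<bar> \<le> \<bar>R\<bar> * norm (x - y)" for x y
  proof -
    have "R * norm (x - y) \<le> \<bar>R\<bar> * norm (x - y)" by (intro mult_right_mono) auto
    then show ?thesis using le[of x y] le[of y x] by (simp add: norm_minus_commute abs_le_iff)
  qed
  then have "(\<bar>R\<bar>)-lipschitz_on S (triangle_length Q)"
    by (intro lipschitz_onI) (auto simp: dist_norm)
  then show ?thesis by (rule lipschitz_on_continuous_on)
qed

text \<open>Coercivity up to translation, with the first vertex fixed at 0: a ball in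
  \<open>Q\<close> allows one of the points to move by \<open>?u\<close> in the direction of
  \<open>q2\<close> or against \<open>q3\<close>, and the gain bounds this vertex.\<close>

lemma norm_le_triangle_length:
  assumes r: "r > 0" "cball p0 r \<subseteq> Q"
  shows "norm (0, q2, q3) \<le> 2 * triangle_length Q (0, q2, q3) / r"
proof -
  have bd: "r * norm v \<le> triangle_length Q (0, q2, q3)" if v: "v = q2 \<or> v = q3" for v
  proof (cases "v = 0")
    case True
    then show ?thesis using triangle_length_nonneg by simp
  next
    case False
    let ?u = "(r / norm v) *\<^sub>R v"
    have p0: "p0 \<in> Q" using r by force
    have u: "p0 + ?u \<in> Q" "p0 - ?u \<in> Q" using r False by (auto simp: dist_norm intro!: subsetD[OF r(2)])
    have eq: "?u \<bullet> v = r * norm v" using False by (simp add: dot_square_norm power2_eq_square)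
    from v show ?thesis
    proof
      assume "v = q2"
      have "(p0 - (p0 + ?u), (p0 + ?u) - p0, p0 - p0) \<in> length_functionals Q"
        unfolding length_functionals_def using p0 u by (intro image_eqI[of _ _ "(p0 + ?u, p0, p0)"]) auto
      from triangle_length_ge[OF this, of "(0, q2, q3)"] show ?thesis using eq \<open>v = q2\<close> by simp
    next
      assume "v = q3"
      have "((p0 - ?u) - p0, p0 - p0, p0 - (p0 - ?u)) \<in> length_functionals Q"
        unfolding length_functionals_def using p0 u by (intro image_eqI[of _ _ "(p0, p0, p0 - ?u)"]) auto
      from triangle_length_ge[OF this, of "(0, q2, q3)"] show ?thesis using eq \<open>v = q3\<close> by simp
    qed
  qed
  have "norm (0 :: real^2, q2, q3) \<le> norm q2 + norm q3"
    using norm_Pair_le[of q2 q3] by (simp add: norm_Pair)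
  then have "r * norm (0 :: real^2, q2, q3) \<le> r * norm q2 + r * norm q3"
    using r(1) mult_left_mono[of _ _ r] by (simp add: distrib_left[symmetric])
  then show ?thesis using bd[of q2] bd[of q3] r(1) by (simp add: field_simps)
qed

end

text \<open>
  Among the triangles without a translate in the interior of \<open>K\<close>, one of minimal length touches \<open>K\<close> with
  outer normals \<open>a\<close> that sum to zero.  It minimises the length on the half-space \<open>\<beta> \<le> a \<bullet> q\<close> as well, so a multiple
  of \<open>a\<close> is a subgradient of the length; written out, this is the billiard reflection law.
\<close>
lemma worm_closed_characteristic:
  assumes shapes: "convex_shape K" "convex_shape Q"
    and nofit: "\<And>t. \<not> (q1 + t \<in> interior K \<and> q2 + t \<in> interior K \<and> q3 + t \<in> interior K)"
    and len: "\<And>p1 p2 p3. p1 \<in> Q \<Longrightarrow> p2 \<in> Q \<Longrightarrow> p3 \<in> Q \<Longrightarrow>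
      p1 \<bullet> (q2 - q1) + p2 \<bullet> (q3 - q2) + p3 \<bullet> (q1 - q3) \<le> c"
  shows "\<exists>T \<gamma>. closed_characteristic (K \<times> Q) T \<gamma> \<and> \<bar>action T \<gamma>\<bar> \<le> c"
proof -
  have K: "convex K" "compact K" "interior K \<noteq> {}" and Q: "convex Q" "compact Q" "interior Q \<noteq> {}"
    using shapes by (auto simp: convex_shape_def)
  have Q': "Q \<noteq> {}" using Q(3) interior_subset by blast
  note QQ = Q(1,2) Q'
  let ?L = "triangle_length Q" and ?P = "length_functionals Q"
  define I where "I = interior K \<times> interior K \<times> interior K"
  define G where "G = {q::triangle. \<forall>t. q + diag t \<notin> I}"
  have openI: "open I" unfolding I_def by (intro open_Times open_interior)
  have closedG: "closed G"
  proof -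
    have "G = (\<Inter>t. {q. q + diag t \<in> - I})" by (auto simp: G_def)
    moreover have "closed {q. q + diag t \<in> - I}" for t
      by (rule closed_vimage[unfolded vimage_def]) (use openI in \<open>auto simp: closed_def intro!: continuous_intros\<close>)
    ultimately show ?thesis by auto
  qed
  have G_diag: "q + diag t \<in> G" if "q \<in> G" for q t
    unfolding G_def
  proof (safe)
    fix s assume "q + diag t + diag s \<in> I"
    then have "q + diag (t + s) \<in> I" by (cases q) (simp add: add.assoc)
    then show False using that unfolding G_def by blast
  qed
  have q0: "(q1, q2, q3) \<in> G" using nofit by (auto simp: G_def I_def)
  have Lq0: "?L (q1, q2, q3) \<le> c"
  proof (rule triangle_length_le[OF QQ])
    fix p assume "p \<in> ?P"
    then obtain p1 p2 p3 where "p1 \<in> Q" "p2 \<in> Q" "p3 \<in> Q" "p = (p3 - p1, p1 - p2, p2 - p3)"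
      by (auto simp: length_functionals_def)
    then show "p \<bullet> (q1, q2, q3) \<le> c" using len by (simp only: length_functional_inner)
  qed
  obtain p0 where "p0 \<in> interior Q" using Q(3) by blast
  then obtain r where r: "r > 0" "cball p0 r \<subseteq> Q" using mem_interior_cball by blast
  \<comment> \<open>The length does not see translations, so a minimum is sought with first vertex
    0, where the relevant triangles form a compact set.\<close>
  define G0 where "G0 = G \<inter> {q. fst q = 0} \<inter> cball 0 (2 * ?L (q1, q2, q3) / r)"
  have toG0: "\<exists>q'\<in>G0. ?L q' = ?L q" if "q \<in> G" "?L q \<le> ?L (q1, q2, q3)" for q
  proof -
    obtain x y z where q: "q = (x, y, z)" by (cases q)
    let ?q = "q + diag (- x)"
    have L: "?L ?q = ?L q" by (rule triangle_length_diag[OF QQ])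
    have q': "?q = (0, y - x, z - x)" by (simp add: q)
    have "norm ?q \<le> 2 * ?L ?q / r" unfolding q' by (rule norm_le_triangle_length[OF QQ r])
    also have "\<dots> \<le> 2 * ?L (q1, q2, q3) / r" unfolding L using that r by (intro divide_right_mono) auto
    finally have "?q \<in> G0" using G_diag[OF that(1), of "- x"] by (auto simp: G0_def q')
    then show ?thesis using L by blast
  qed
  have "closed {q::triangle. fst q = 0}" by (intro closed_Collect_eq continuous_intros)
  then have "compact G0" unfolding G0_def
    by (intro closed_Int_compact closed_Int closedG) auto
  moreover have "G0 \<noteq> {}" using toG0[OF q0] by auto
  ultimately obtain q where q: "q \<in> G0" "\<And>q'. q' \<in> G0 \<Longrightarrow> ?L q \<le> ?L q'"
    using continuous_attains_inf[OF _ _ continuous_triangle_length[OF QQ]] by metis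
  define m where "m = ?L q"
  have qG: "q \<in> G" using q(1) by (simp add: G0_def)
  have mL0: "m \<le> ?L (q1, q2, q3)" using q(2) toG0[OF q0] by (force simp: m_def)
  have min: "m \<le> ?L q'" if "q' \<in> G" for q'
  proof (cases "?L q' \<le> ?L (q1, q2, q3)")
    case True
    then show ?thesis using toG0[OF that] q(2) by (force simp: m_def)
  qed (use mL0 in linarith)
  obtain k0 where k0: "k0 \<in> interior K" using K(3) by blast
  have m: "m > 0"
  proof (rule ccontr)
    assume "\<not> m > 0"
    then have "?L q = 0" using triangle_length_nonneg[OF QQ, of q] by (simp add: m_def)
    moreover obtain y z where qq: "q = (0, y, z)" using q(1) by (cases q) (auto simp: G0_def)
    ultimately have "norm q \<le> 0" using norm_le_triangle_length[OF QQ r, of y z] by simp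
    then have "q = 0" by simp
    moreover have "q + diag k0 \<notin> I" using qG unfolding G_def by blast
    ultimately show False using k0 by (simp add: I_def)
  qed
  obtain x1 x2 x3 where qx: "q = (x1, x2, x3)" by (cases q)
  \<comment> \<open>A proper contraction of \<open>q\<close> is shorter than \<open>m\<close>, hence
    not in \<open>G\<close>, hence fits; the limit is a translate of \<open>q\<close> in
    \<open>K\<close> itself.\<close>
  have "\<exists>t. x1 + t \<in> K \<and> x2 + t \<in> K \<and> x3 + t \<in> K"
  proof (rule translate_limit[OF K(2)])
    fix s :: real assume s: "0 < s" "s < 1"
    have "?L (s *\<^sub>R q) \<le> s * m" unfolding m_def using s by (intro triangle_length_scale_le[OF QQ]) auto
    also have "\<dots> < m" using s m by simp
    finally have "s *\<^sub>R q \<notin> G" using min linorder_not_less by blast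
    then obtain t where "s *\<^sub>R q + diag t \<in> I" unfolding G_def by blast
    then show "\<exists>t. s *\<^sub>R x1 + t \<in> K \<and> s *\<^sub>R x2 + t \<in> K \<and> s *\<^sub>R x3 + t \<in> K"
      using interior_subset by (auto simp: qx I_def)
  qed
  then obtain t where t: "x1 + t \<in> K" "x2 + t \<in> K" "x3 + t \<in> K" by blast
  define y1 y2 y3 where "y1 = x1 + t" and "y2 = x2 + t" and "y3 = x3 + t"
  note ys = y1_def y2_def y3_def
  have yq: "(y1, y2, y3) = q + diag t" by (simp add: ys qx)
  have y: "y1 \<in> K" "y2 \<in> K" "y3 \<in> K" using t by (auto simp: ys)
  have Ly: "?L (y1, y2, y3) = m" unfolding yq m_def by (rule triangle_length_diag[OF QQ])
  \<comment> \<open>The complement of \<open>G\<close>, written as a difference of convex sets in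
    order to separate \<open>q\<close> from it.\<close>
  define D where "D = (\<Union>x\<in>I. \<Union>y\<in>range diag. {x - y})"
  have "convex I" unfolding I_def by (intro convex_Times convex_interior K)
  moreover have "convex (range diag)"
  proof (rule convex_linear_image)
    show "linear diag" by (rule linearI) auto
  qed simp
  ultimately have convexD: "convex D" unfolding D_def by (rule convex_differences)
  have memD: "x - diag s \<in> D" if "x \<in> I" for x s
    using that unfolding D_def by blast
  have k0I: "diag k0 \<in> I" using k0 by (simp add: I_def)
  have "D \<inter> {q} = {}"
  proof -
    have "q \<notin> D"
    proof
      assume "q \<in> D"
      then obtain x s where "x \<in> I" "q = x - diag s" unfolding D_def by blast
      then have "q + diag s \<in> I" by simp
      then show False using qG unfolding G_def by blast
    qed
    then show ?thesis by blast
  qed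
  then obtain a b where a: "a \<noteq> 0" "\<And>x. x \<in> D \<Longrightarrow> a \<bullet> x \<le> b" "b \<le> a \<bullet> q"
    using separating_hyperplane_sets[OF convexD convex_singleton, of q] memD[OF k0I] by blast
  \<comment> \<open>\<open>D\<close> is invariant under translations, so a functional bounded above
    on it vanishes on the diagonal: the components of \<open>a\<close> sum to zero. The scalar
    \<open>c\<close> below would produce the value \<open>b + 1\<close>.\<close>
  have a_diag: "a \<bullet> diag s = 0" for s
  proof (rule ccontr)
    assume nz: "a \<bullet> diag s \<noteq> 0"
    define c where "c = (a \<bullet> diag k0 - b - 1) / (a \<bullet> diag s)"
    have "a \<bullet> (diag k0 - diag (c *\<^sub>R s)) \<le> b" using a(2) memD[OF k0I] by blast
    moreover have "a \<bullet> diag (c *\<^sub>R s) = c * (a \<bullet> diag s)"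
      using inner_scaleR_right[of a c "diag s"] by simp
    then have "a \<bullet> diag (c *\<^sub>R s) = a \<bullet> diag k0 - b - 1" using nz by (simp add: c_def del: inner_Pair)
    ultimately show False by (simp only: inner_diff_right)
  qed
  define \<beta> where "\<beta> = a \<bullet> q"
  have a_le: "a \<bullet> x \<le> \<beta>" if "x \<in> I" for x
    using a(2)[OF memD[OF that, of 0]] a(3) by (simp add: \<beta>_def zero_prod_def[symmetric])
  have a_less: "a \<bullet> x < \<beta>" if x: "x \<in> I" for x
  proof -
    obtain e where e: "e > 0" "cball x e \<subseteq> I" using openI x open_contains_cball by blast
    have "x + (e / norm a) *\<^sub>R a \<in> cball x e" using e(1) a(1) by (simp add: dist_norm)
    then have "a \<bullet> (x + (e / norm a) *\<^sub>R a) \<le> \<beta>" using e(2) a_le by blast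
    moreover have "0 < (e / norm a) * (a \<bullet> a)" using e(1) a(1) by simp
    ultimately show ?thesis by (simp add: inner_add_right)
  qed
  have a_K: "a \<bullet> (z1, z2, z3) \<le> \<beta>" if "z1 \<in> K" "z2 \<in> K" "z3 \<in> K" for z1 z2 z3
  proof -
    have "closure (interior K) = K" 
      using convex_closure_interior[OF K(1,3)] closure_closed[OF compact_imp_closed[OF K(2)]] by simp
    then have "(z1, z2, z3) \<in> closure I" using that by (simp add: I_def closure_Times)
    moreover have "closure I \<subseteq> {x. a \<bullet> x \<le> \<beta>}"
      using a_le by (intro closure_minimal closed_halfspace_le) auto
    ultimately show ?thesis by blast
  qed
  have \<beta>: "\<beta> > 0" using a_less[OF k0I] a_diag by simp
  have halfspace: "q' \<in> G" if "\<beta> \<le> a \<bullet> q'" for q'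
    unfolding G_def
  proof safe
    fix s assume "q' + diag s \<in> I"
    then show False using a_less[of "q' + diag s"] that a_diag[of s] by (simp add: inner_add_right)
  qed
  \<comment> \<open>Otherwise a hyperplane separates this point from \<open>?P\<close>, and its
    normal, rescaled to the boundary of the half-space, is a triangle in \<open>G\<close> shorter
    than \<open>m\<close>.\<close>
  have "(m / \<beta>) *\<^sub>R a \<in> ?P"
  proof (rule ccontr)
    assume "(m / \<beta>) *\<^sub>R a \<notin> ?P"
    then obtain v d where v: "v \<bullet> ((m / \<beta>) *\<^sub>R a) < d" "\<And>p. p \<in> ?P \<Longrightarrow> v \<bullet> p > d"
      using separating_hyperplane_closed_point[of ?P "(m / \<beta>) *\<^sub>R a"]
        length_functionals_convex_compact[OF Q(1,2)] compact_imp_closed by metis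
    define s where "s = a \<bullet> (- v)"
    have "?L (- v) \<le> - d"
      by (rule triangle_length_le[OF QQ]) (use v(2) in \<open>force simp: inner_commute\<close>)
    also have "- d < (m / \<beta>) * s" using v(1) by (simp add: s_def inner_commute)
    finally have less: "?L (- v) < (m / \<beta>) * s" .
    then have "0 < (m / \<beta>) * s" using triangle_length_nonneg[OF QQ, of "- v"] by linarith
    then have s: "s > 0" using m \<beta> by (simp add: zero_less_mult_iff zero_less_divide_iff)
    have "\<beta> \<le> a \<bullet> ((\<beta> / s) *\<^sub>R (- v))" using s by (simp add: s_def)
    then have "m \<le> ?L ((\<beta> / s) *\<^sub>R (- v))" using min halfspace by blast
    also have "\<dots> \<le> (\<beta> / s) * ?L (- v)" using s \<beta> by (intro triangle_length_scale_le[OF QQ]) auto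
    also have "\<dots> < (\<beta> / s) * ((m / \<beta>) * s)" using less s \<beta> by (intro mult_strict_left_mono) auto
    also have "\<dots> = m" using s \<beta> by simp
    finally show False by simp
  qed
  then obtain p1 p2 p3 where p: "p1 \<in> Q" "p2 \<in> Q" "p3 \<in> Q"
    and pa: "(p3 - p1, p1 - p2, p2 - p3) = (m / \<beta>) *\<^sub>R a"
    by (auto simp: length_functionals_def)
  obtain a1 a2 a3 where aa: "a = (a1, a2, a3)" by (cases a)
  have ay: "a \<bullet> (y1, y2, y3) = \<beta>" unfolding yq using a_diag by (simp add: inner_add_right \<beta>_def)
  have pm: "p1 \<bullet> (y2 - y1) + p2 \<bullet> (y3 - y2) + p3 \<bullet> (y1 - y3) = m"
    unfolding length_functional_inner[symmetric] pa using ay \<beta> by simp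
  have max: "p1' \<bullet> (y2 - y1) + p2' \<bullet> (y3 - y2) + p3' \<bullet> (y1 - y3) \<le> m"
    if "p1' \<in> Q" "p2' \<in> Q" "p3' \<in> Q" for p1' p2' p3'
    unfolding length_functional_inner[symmetric] Ly[symmetric]
    by (rule triangle_length_ge[OF QQ]) (use that in \<open>force simp: length_functionals_def\<close>)
  \<comment> \<open>Varying one of the maximising points alone gives the three normal cones of
    \<open>Q\<close>; varying one of the \<open>y\<close> alone gives those of
    \<open>K\<close>.\<close>
  have nQ: "y2 - y1 \<in> normal_cone Q p1" "y3 - y2 \<in> normal_cone Q p2" "y1 - y3 \<in> normal_cone Q p3"
    using max[OF _ p(2,3)] max[OF p(1) _ p(3)] max[OF p(1,2)] pm
    by (auto simp: normal_cone_def inner_diff_right inner_diff_left inner_commute)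
  have na: "a1 \<in> normal_cone K y1" "a2 \<in> normal_cone K y2" "a3 \<in> normal_cone K y3"
    using a_K[OF _ y(2,3)] a_K[OF y(1) _ y(3)] a_K[OF y(1,2)] ay
    by (auto simp: normal_cone_def aa inner_diff_right)
  have scale: "(m / \<beta>) *\<^sub>R v \<in> normal_cone K w" if "v \<in> normal_cone K w" for v w
  proof -
    have "0 \<le> m / \<beta>" using m \<beta> by simp
    then show ?thesis using that
      unfolding normal_cone_def mem_Collect_eq inner_scaleR_left by (blast intro: mult_nonneg_nonpos)
  qed
  have nK: "p3 - p1 \<in> normal_cone K y1" "p1 - p2 \<in> normal_cone K y2" "p2 - p3 \<in> normal_cone K y3"
    using na[THEN scale] pa by (simp_all add: aa)
  have ne: "\<not> (y1 = y2 \<and> y2 = y3)"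
  proof
    assume "y1 = y2 \<and> y2 = y3"
    then show False using pm m by simp
  qed
  have "m \<le> c" using mL0 Lq0 by linarith
  then show ?thesis
    using billiard_closed_characteristic[OF K(1) compact_imp_closed[OF K(2)] Q(1) compact_imp_closed[OF Q(2)]
        y p nK nQ ne] unfolding pm by auto
qed

section \<open>The capacity and translates of short triangles\<close>

lemma ehz_lagr_le:
  "closed_characteristic (K \<times> Q) T \<gamma> \<Longrightarrow> ehz_lagr K Q \<le> \<bar>action T \<gamma>\<bar>"
  unfolding ehz_lagr_def by (rule cInf_lower) (auto intro!: bdd_belowI[of _ 0])

text \<open>The infimum of an empty set of reals is unspecified, so some closed characteristic has to be exhibited.\<close>
lemma ehz_lagr_nonneg:
  assumes "convex_shape K" "convex_shape Q"
  shows "0 \<le> ehz_lagr K Q"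
proof -
  have K: "bounded K" and Q: "bounded Q"
    using assms by (auto simp: convex_shape_def compact_imp_bounded)
  obtain r where r: "r > 0" "\<And>x. x \<in> K \<Longrightarrow> norm x \<le> r" using K bounded_pos by blast
  obtain R where R: "R > 0" "\<And>x. x \<in> Q \<Longrightarrow> norm x \<le> R" using Q bounded_pos by blast
  \<comment> \<open>A segment longer than the diameter of \<open>K\<close>, as a triangle with two
    equal vertices, has no translate in \<open>K\<close>.\<close>
  let ?v = "(3 * r) *\<^sub>R axis 1 1 :: real^2"
  have nv: "norm ?v = 3 * r" using r(1) by simp
  have "\<exists>T \<gamma>. closed_characteristic (K \<times> Q) T \<gamma> \<and> \<bar>action T \<gamma>\<bar> \<le> R * (3 * r) + R * (3 * r)"
  proof (rule worm_closed_characteristic[OF assms, of 0 ?v ?v])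
    fix t
    show "\<not> (0 + t \<in> interior K \<and> ?v + t \<in> interior K \<and> ?v + t \<in> interior K)"
    proof
      assume "0 + t \<in> interior K \<and> ?v + t \<in> interior K \<and> ?v + t \<in> interior K"
      then have "norm t \<le> r" "norm (?v + t) \<le> r" using r(2) interior_subset by auto
      then show False using norm_triangle_ineq4[of "?v + t" t] nv r(1) by simp
    qed
  next
    fix p1 p2 p3 assume p: "p1 \<in> Q" "p2 \<in> Q" "p3 \<in> Q"
    have "p \<bullet> w \<le> R * (3 * r)" if "p \<in> Q" "norm w = 3 * r" for p w :: "real^2"
    proof -
      have "p \<bullet> w \<le> norm p * norm w" by (rule norm_cauchy_schwarz)
      also have "\<dots> \<le> R * (3 * r)" unfolding that(2) using R(2)[OF that(1)] r(1) by (intro mult_right_mono) auto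
      finally show ?thesis .
    qed
    note bd = this
    have "norm (- ?v) = 3 * r" by (simp only: norm_minus_cancel nv)
    then have "p1 \<bullet> ?v + p3 \<bullet> (- ?v) \<le> R * (3 * r) + R * (3 * r)"
      by (intro add_mono bd p nv)
    moreover have "p1 \<bullet> (w - 0) + p2 \<bullet> (w - w) + p3 \<bullet> (0 - w) = p1 \<bullet> w + p3 \<bullet> (- w)" for w
      by simp
    ultimately show "p1 \<bullet> (?v - 0) + p2 \<bullet> (?v - ?v) + p3 \<bullet> (0 - ?v) \<le> R * (3 * r) + R * (3 * r)"
      by (simp only:)
  qed
  then show ?thesis unfolding ehz_lagr_def by (intro cInf_greatest) auto
qed

text \<open>If the triangle scaled by \<open>r < 1\<close> had no translate in \<open>K\<close>,
  there would be a closed characteristic of action at most \<open>r\<close> times the capacity,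
  which is strictly smaller as the capacity is positive. Then \<open>r\<close> tends to 1.\<close>

lemma worm_translate:
  assumes shapes: "convex_shape K" "convex_shape Q" and pos: "0 < ehz_lagr K Q"
    and len: "\<And>p1 p2 p3. p1 \<in> Q \<Longrightarrow> p2 \<in> Q \<Longrightarrow> p3 \<in> Q \<Longrightarrow>
      p1 \<bullet> (q2 - q1) + p2 \<bullet> (q3 - q2) + p3 \<bullet> (q1 - q3) \<le> ehz_lagr K Q"
  shows "\<exists>t. q1 + t \<in> K \<and> q2 + t \<in> K \<and> q3 + t \<in> K"
proof (rule translate_limit)
  show "compact K" using shapes by (simp add: convex_shape_def)
  fix r :: real assume r: "0 < r" "r < 1"
  show "\<exists>t. r *\<^sub>R q1 + t \<in> K \<and> r *\<^sub>R q2 + t \<in> K \<and> r *\<^sub>R q3 + t \<in> K"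
  proof (rule ccontr)
    assume no: "\<not> (\<exists>t. r *\<^sub>R q1 + t \<in> K \<and> r *\<^sub>R q2 + t \<in> K \<and> r *\<^sub>R q3 + t \<in> K)"
    have "\<exists>T \<gamma>. closed_characteristic (K \<times> Q) T \<gamma> \<and> \<bar>action T \<gamma>\<bar> \<le> r * ehz_lagr K Q"
    proof (rule worm_closed_characteristic[OF shapes])
      fix t
      show "\<not> (r *\<^sub>R q1 + t \<in> interior K \<and> r *\<^sub>R q2 + t \<in> interior K \<and> r *\<^sub>R q3 + t \<in> interior K)"
        using no interior_subset by blast
    next
      fix p1 p2 p3 assume "p1 \<in> Q" "p2 \<in> Q" "p3 \<in> Q"
      from mult_left_mono[OF len[OF this], of r] r(1)
      show "p1 \<bullet> (r *\<^sub>R q2 - r *\<^sub>R q1) + p2 \<bullet> (r *\<^sub>R q3 - r *\<^sub>R q2) + p3 \<bullet> (r *\<^sub>R q1 - r *\<^sub>R q3)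
          \<le> r * ehz_lagr K Q"
        by (simp add: scaleR_diff_right[symmetric] distrib_left)
    qed
    then obtain T \<gamma> where "closed_characteristic (K \<times> Q) T \<gamma>" "\<bar>action T \<gamma>\<bar> \<le> r * ehz_lagr K Q" by blast
    then have "ehz_lagr K Q \<le> r * ehz_lagr K Q" using ehz_lagr_le by force
    then show False using r pos by simp
  qed
qed

section \<open>Quadrilaterals and hexagons\<close>

lemma crs_eq_0_imp_multiple:
  assumes "crs u w = 0" "u \<noteq> 0"
  shows "\<exists>s. w = s *\<^sub>R u"
proof (cases "u$1 = 0")
  case True
  then have "u$2 \<noteq> 0" using assms(2) by (auto simp: vec_eq_iff forall_2)
  then show ?thesis using True assms(1)
    by (intro exI[of _ "w$2 / u$2"]) (auto simp: vec_eq_iff forall_2 crs_def)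
next
  case False
  then show ?thesis using assms(1)
    by (intro exI[of _ "w$1 / u$1"]) (auto simp: vec_eq_iff forall_2 crs_def field_simps)
qed

lemma between_on_line:
  assumes "t1 \<le> t" "t \<le> t2"
  shows "(c::'a::real_vector) + t *\<^sub>R u \<in> convex hull {c + t1 *\<^sub>R u, c + t2 *\<^sub>R u}"
proof (cases "t1 = t2")
  case True
  then show ?thesis using assms by (auto simp: hull_inc)
next
  case False
  define r where "r = (t - t1) / (t2 - t1)"
  have r: "0 \<le> r" "r \<le> 1" "r * (t2 - t1) = t - t1" using False assms by (auto simp: r_def field_simps)
  have "c + t *\<^sub>R u = c + (t1 + r * (t2 - t1)) *\<^sub>R u" using r(3) by simp
  also have "\<dots> = (1 - r) *\<^sub>R (c + t1 *\<^sub>R u) + r *\<^sub>R (c + t2 *\<^sub>R u)" by (simp add: algebra_simps)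
  finally show ?thesis using r unfolding segment_convex_hull[symmetric] in_segment by blast
qed

text \<open>Radon's theorem splits the vertices into two sets with intersecting hulls. A single
  point would lie in the hull of the other three, so both sets have two points: they are the
  diagonals, meeting in \<open>c\<close>. A parameter 0 or 1 would put a vertex on the other
  diagonal.\<close>

lemma quadrilateral_diagonals:
  assumes "convex_quadrilateral Q"
  obtains c u w m n where "0 < m" "m < 1" "0 < n" "n < 1" "crs u w \<noteq> 0"
    "Q = convex hull {c - m *\<^sub>R u, c + (1 - m) *\<^sub>R u, c - n *\<^sub>R w, c + (1 - n) *\<^sub>R w}"
proof -
  obtain S where S: "finite S" "card S = 4" "Q = convex hull S" and ex: "\<And>x. x \<in> S \<Longrightarrow> x \<notin> convex hull (S - {x})"
    using assms unfolding convex_quadrilateral_def by blast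
  have "affine_dependent S" using S by (intro affine_dependent_biggerset) auto
  then obtain M P where MP: "M \<inter> P = {}" "M \<union> P = S" "convex hull M \<inter> convex hull P \<noteq> {}"
    using Radon_partition[OF S(1)] by blast
  have fin: "finite M" "finite P" using S(1) MP(2) by auto
  have card: "card M + card P = 4" using card_Un_disjoint[OF fin MP(1)] MP(2) S(2) by simp
  have two: "2 \<le> card A" if "A \<inter> B = {}" "A \<union> B = S" "convex hull A \<inter> convex hull B \<noteq> {}" "finite A" for A B
  proof (rule ccontr)
    assume "\<not> 2 \<le> card A"
    then have "card A = 0 \<or> card A = 1" by linarith
    then show False
    proof
      assume "card A = 0"
      then show False using that by simp
    next
      assume "card A = 1"
      then obtain x where "A = {x}" by (auto simp: card_1_singleton_iff)
      then have "B = S - {x}" "x \<in> convex hull B" "x \<in> S" using that by auto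
      then show False using ex by blast
    qed
  qed
  have "card M = 2" "card P = 2"
    using two[OF MP fin(1)] two[of P M] MP fin card by (auto simp: Int_commute Un_commute)
  then obtain W E So N where M: "M = {W, E}" "W \<noteq> E" and P: "P = {So, N}" "So \<noteq> N"
    by (auto simp: card_2_iff)
  have SS: "S = {W, E, So, N}" using MP(2) M P by auto
  have d: "W \<noteq> So" "W \<noteq> N" "E \<noteq> So" "E \<noteq> N" using MP(1) M P by auto
  have sub: "x \<notin> convex hull A" if "x \<in> S" "A \<subseteq> S - {x}" for x A
    using ex[OF that(1)] hull_mono[OF that(2), of convex] by blast
  have out: "W \<notin> convex hull {So, N}" "E \<notin> convex hull {So, N}" "So \<notin> convex hull {W, E}" "N \<notin> convex hull {W, E}"
    by (rule sub; use SS d M P in auto)+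
  obtain c where c: "c \<in> convex hull {W, E}" "c \<in> convex hull {So, N}" using MP(3) M P by blast
  obtain m where m: "0 \<le> m" "m \<le> 1" "c = (1 - m) *\<^sub>R W + m *\<^sub>R E"
    using c(1) unfolding segment_convex_hull[symmetric] in_segment by blast
  obtain n where n: "0 \<le> n" "n \<le> 1" "c = (1 - n) *\<^sub>R So + n *\<^sub>R N"
    using c(2) unfolding segment_convex_hull[symmetric] in_segment by blast
  have "c \<noteq> W" "c \<noteq> E" "c \<noteq> So" "c \<noteq> N" using c out by auto
  then have "m \<noteq> 0" "m \<noteq> 1" "n \<noteq> 0" "n \<noteq> 1" using m(3) n(3) by auto
  then have mn: "0 < m" "m < 1" "0 < n" "n < 1" using m n by auto
  define u where "u = E - W"
  define w where "w = N - So"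
  have pts: "W = c - m *\<^sub>R u" "E = c + (1 - m) *\<^sub>R u" "So = c - n *\<^sub>R w" "N = c + (1 - n) *\<^sub>R w"
  proof -
    show "W = c - m *\<^sub>R u" "E = c + (1 - m) *\<^sub>R u" unfolding u_def m(3) by (simp_all add: algebra_simps)
    show "So = c - n *\<^sub>R w" "N = c + (1 - n) *\<^sub>R w" unfolding w_def n(3) by (simp_all add: algebra_simps)
  qed
  \<comment> \<open>With parallel diagonals all vertices lie on one line, and an end of one diagonal
    lies between the ends of the other.\<close>
  have "crs u w \<noteq> 0"
  proof
    assume "crs u w = 0"
    moreover have "u \<noteq> 0" using M by (simp add: u_def)
    ultimately obtain s where s: "w = s *\<^sub>R u" using crs_eq_0_imp_multiple by blast
    have line: "W = c + (- m) *\<^sub>R u" "E = c + (1 - m) *\<^sub>R u" "So = c + (- (n * s)) *\<^sub>R u" "N = c + ((1 - n) * s) *\<^sub>R u"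
      using pts s by simp_all
    have sgn: "0 \<le> s \<Longrightarrow> 0 \<le> n * s" "0 \<le> s \<Longrightarrow> 0 \<le> (1 - n) * s" "s \<le> 0 \<Longrightarrow> n * s \<le> 0" "s \<le> 0 \<Longrightarrow> (1 - n) * s \<le> 0"
      using mn by (auto simp: mult_le_0_iff zero_le_mult_iff)
    consider "0 \<le> s" "n * s \<le> m" | "0 \<le> s" "m \<le> n * s" | "s \<le> 0" "- (n * s) \<le> 1 - m" | "s \<le> 0" "1 - m \<le> - (n * s)"
      by linarith
    then show False
    proof cases
      case 1
      then have "c + (- (n * s)) *\<^sub>R u \<in> convex hull {c + (- m) *\<^sub>R u, c + (1 - m) *\<^sub>R u}"
        by (intro between_on_line) (use mn sgn(1)[OF 1(1)] 1(2) in linarith)+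
      then show False using out line by metis
    next
      case 2
      then have "c + (- m) *\<^sub>R u \<in> convex hull {c + (- (n * s)) *\<^sub>R u, c + ((1 - n) * s) *\<^sub>R u}"
        by (intro between_on_line) (use mn sgn(2)[OF 2(1)] 2(2) in linarith)+
      then show False using out line by metis
    next
      case 3
      then have "c + (- (n * s)) *\<^sub>R u \<in> convex hull {c + (- m) *\<^sub>R u, c + (1 - m) *\<^sub>R u}"
        by (intro between_on_line) (use mn sgn(3)[OF 3(1)] 3(2) in linarith)+
      then show False using out line by metis
    next
      case 4
      then have "c + (1 - m) *\<^sub>R u \<in> convex hull {c + ((1 - n) * s) *\<^sub>R u, c + (- (n * s)) *\<^sub>R u}"
        by (intro between_on_line) (use mn sgn(4)[OF 4(1)] 4(2) in linarith)+
      then show False using out line by (metis insert_commute)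
    qed
  qed
  then show thesis using that[OF mn] S(3) SS pts by metis
qed

lemma dual_basis:
  assumes "crs u w \<noteq> 0"
  obtains us ws where "us \<bullet> u = 1" "us \<bullet> w = 0" "ws \<bullet> u = 0" "ws \<bullet> w = 1" "crs us ws = 1 / crs u w"
proof
  let ?us = "(1 / crs u w) *\<^sub>R vector [w$2, - (w$1)]" and ?ws = "(1 / crs u w) *\<^sub>R vector [- (u$2), u$1]"
  have "?us \<bullet> p = crs p w / crs u w" "?ws \<bullet> p = crs u p / crs u w" for p
    by (simp_all add: inner_vec_def sum_2 crs_def algebra_simps diff_divide_distrib)
  then show "?us \<bullet> u = 1" "?us \<bullet> w = 0" "?ws \<bullet> u = 0" "?ws \<bullet> w = 1"
    using assms by (simp_all add: crs_simps)
  have "crs (vector [w$2, - (w$1)]) (vector [- (u$2), u$1]) = crs u w"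
    by (simp add: crs_def)
  then show "crs ?us ?ws = 1 / crs u w"
    unfolding crs_simps(7,8) using assms by simp
qed

text \<open>A triangle is given by its edges and by support values of \<open>Q\<close> relative to
  \<open>c\<close>. Since the edges sum to zero, the choice of \<open>c\<close> does not affect the
  length.\<close>

lemma worm_edges:
  assumes shapes: "convex_shape K" "convex_shape Q" and pos: "0 < ehz_lagr K Q"
    and closed: "x + y + z = 0"
    and le: "\<And>p. p \<in> Q \<Longrightarrow> x \<bullet> (p - c) \<le> hx" "\<And>p. p \<in> Q \<Longrightarrow> y \<bullet> (p - c) \<le> hy"
      "\<And>p. p \<in> Q \<Longrightarrow> z \<bullet> (p - c) \<le> hz"
    and sum: "hx + hy + hz \<le> ehz_lagr K Q"
  shows "\<exists>t. t \<in> K \<and> t + x \<in> K \<and> t - z \<in> K"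
proof -
  have z: "z = - (x + y)" by (rule minus_unique[OF closed, symmetric])
  have "\<exists>t. 0 + t \<in> K \<and> x + t \<in> K \<and> (x + y) + t \<in> K"
  proof (rule worm_translate[OF shapes pos])
    fix p1 p2 p3 assume "p1 \<in> Q" "p2 \<in> Q" "p3 \<in> Q"
    then have "x \<bullet> (p1 - c) + y \<bullet> (p2 - c) + z \<bullet> (p3 - c) \<le> hx + hy + hz"
      using le by (intro add_mono)
    then show "p1 \<bullet> (x - 0) + p2 \<bullet> (x + y - x) + p3 \<bullet> (0 - (x + y)) \<le> ehz_lagr K Q"
      using sum by (simp add: z algebra_simps inner_commute)
  qed
  then show ?thesis by (simp add: z algebra_simps)
qed

lemma convex_shapeI:
  assumes "convex S" "compact S" "0 < area S"
  shows "convex_shape S"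
proof -
  have "\<not> negligible S" using assms(3) by (auto simp: area_def negligible_imp_measure0)
  then show ?thesis using assms negligible_convex_interior by (auto simp: convex_shape_def)
qed

definition diagonal_form :: "(real^2) set \<Rightarrow> real^2 \<Rightarrow> real^2 \<Rightarrow> real^2 \<Rightarrow> real \<Rightarrow> real \<Rightarrow> bool" where
  "diagonal_form Q c u w m n \<longleftrightarrow> 0 < m \<and> m < 1 \<and> 0 < n \<and> n < 1 \<and>
     Q = convex hull {c - m *\<^sub>R u, c + (1 - m) *\<^sub>R u, c - n *\<^sub>R w, c + (1 - n) *\<^sub>R w}"

text \<open>Reversing or exchanging the diagonals brings any chosen vertex into the role of
  \<open>c - m *\<^sub>R u\<close>.\<close>

lemma diagonal_form_sym:
  assumes "diagonal_form Q c u w m n"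
  shows "diagonal_form Q c (- u) w (1 - m) n" "diagonal_form Q c u (- w) m (1 - n)" "diagonal_form Q c w u n m"
  using assms by (auto simp: diagonal_form_def insert_commute)

lemma diagonal_form_le:
  assumes "diagonal_form Q c u w m n" "p \<in> Q"
    and "- m * (e \<bullet> u) \<le> h" "(1 - m) * (e \<bullet> u) \<le> h" "- n * (e \<bullet> w) \<le> h" "(1 - n) * (e \<bullet> w) \<le> h"
  shows "e \<bullet> (p - c) \<le> h"
proof -
  have "Q = convex hull {c - m *\<^sub>R u, c + (1 - m) *\<^sub>R u, c - n *\<^sub>R w, c + (1 - n) *\<^sub>R w}"
    using assms(1) by (simp add: diagonal_form_def)
  also have "\<dots> \<subseteq> {p. e \<bullet> p \<le> h + e \<bullet> c}"
    using assms(3-) by (intro hull_minimal convex_halfspace_le) (auto simp: inner_diff_right inner_add_right)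
  finally have "Q \<subseteq> {p. e \<bullet> p \<le> h + e \<bullet> c}" .
  then show ?thesis using assms(2) by (auto simp: inner_diff_right)
qed

text \<open>The area bound is the width transverse to the diagonal \<open>u\<close>, taken between
  the ends of the other diagonal in both orders.\<close>

lemma diagonal_form_area:
  assumes "diagonal_form Q c u w m n"
  shows "convex Q" "compact Q" "\<bar>crs u w\<bar> / 2 \<le> area Q"
proof -
  have Q: "Q = convex hull {c - m *\<^sub>R u, c + (1 - m) *\<^sub>R u, c - n *\<^sub>R w, c + (1 - n) *\<^sub>R w}"
    using assms by (simp add: diagonal_form_def)
  show cQ: "convex Q" "compact Q" unfolding Q by (auto intro!: finite_imp_compact_convex_hull)
  have v: "c - m *\<^sub>R u \<in> Q" "c - m *\<^sub>R u + u \<in> Q" "c - n *\<^sub>R w \<in> Q" "c + (1 - n) *\<^sub>R w \<in> Q"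
    unfolding Q by (auto intro!: hull_inc simp: algebra_simps)
  have "crs u (q - q') \<le> 2 * area Q" if "q \<in> Q" "q' \<in> Q" for q q'
    using area_chords[OF cQ v(1,2,1,2), of q 0 q' q q'] that by (simp add: crs_simps)
  from this[OF v(4,3)] this[OF v(3,4)] show "\<bar>crs u w\<bar> / 2 \<le> area Q"
    by (simp add: crs_simps abs_le_iff algebra_simps)
qed

text \<open>
  Of the four vertices, \<open>c - m *\<^sub>R u\<close> is relatively farthest from the intersection of the diagonals.  The vectors
  \<open>k\<close> and \<open>k'\<close> are normal to the two sides at this vertex.  The lines of these two sides together with the line of
  one of the other sides bound two triangles containing \<open>Q\<close>; the four triangles used for \<open>K\<close> are their
  rotations by a quarter turn and the reflections of these, scaled to length \<open>C\<close>.
\<close>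
lemma ehz_le_diagonal_form:
  assumes shapes: "convex_shape K" "convex_shape Q" and pos: "0 < ehz_lagr K Q"
    and Q: "diagonal_form Q c u w m n" and D: "0 < crs u w" and max: "n \<le> m" "1 - n \<le> m"
  shows "(ehz_lagr K Q)\<^sup>2 \<le> crs u w * area K"
proof -
  define C where "C = ehz_lagr K Q"
  have "crs u w \<noteq> 0" using D by simp
  then obtain us ws where dual: "us \<bullet> u = 1" "us \<bullet> w = 0" "ws \<bullet> u = 0" "ws \<bullet> w = 1"
    and cus: "crs us ws = 1 / crs u w"
    by (rule dual_basis)
  have mn: "0 < m" "m < 1" "0 < n" "n < 1" using Q by (auto simp: diagonal_form_def)
  \<comment> \<open>\<open>k\<close> and \<open>- k'\<close> are outer normals to the sides from
    \<open>c - m *\<^sub>R u\<close> to \<open>c + (1 - n) *\<^sub>R w\<close> and to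
    \<open>c - n *\<^sub>R w\<close>.\<close>
  define k where "k = C *\<^sub>R (ws - ((1 - n) / m) *\<^sub>R us)"
  define k' where "k' = C *\<^sub>R (ws + (n / m) *\<^sub>R us)"
  \<comment> \<open>\<open>\<alpha>\<close> makes \<open>\<alpha> *\<^sub>R k' - k\<close> normal to
    the side from \<open>c + (1 - m) *\<^sub>R u\<close> to \<open>c - n *\<^sub>R w\<close>, and
    \<open>\<delta>\<close> makes \<open>k' - \<delta> *\<^sub>R k\<close> normal to the one to
    \<open>c + (1 - n) *\<^sub>R w\<close>.\<close>
  define \<alpha> where "\<alpha> = m - (1 - m) * (1 - n) / n"
  define \<delta> where "\<delta> = m - (1 - m) * n / (1 - n)"
  have an: "\<alpha> * n = m * n - (1 - m) * (1 - n)" and dn: "\<delta> * (1 - n) = m * (1 - n) - (1 - m) * n"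
    using mn by (auto simp: \<alpha>_def \<delta>_def field_simps)
  \<comment> \<open>Maximality of \<open>m\<close> is what makes the scales nonnegative:
    \<open>0 \<le> \<alpha>\<close> means \<open>1 \<le> m + n\<close>, and
    \<open>0 \<le> \<delta>\<close> means \<open>n \<le> m\<close>.\<close>
  have "(1 - m) * (1 - n) \<le> n * m" "(1 - m) * n \<le> (1 - n) * m"
    using mn max by (intro mult_mono; simp)+
  then have "0 \<le> \<alpha> * n" "0 \<le> \<delta> * (1 - n)" unfolding an dn by (auto simp: mult.commute)
  then have \<alpha>0: "0 \<le> \<alpha>" and \<delta>0: "0 \<le> \<delta>" using mn by (auto simp: zero_le_mult_iff)
  have "0 \<le> (1 - m) * (1 - n) / n" "0 \<le> (1 - m) * n / (1 - n)" using mn by auto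
  then have \<alpha>1: "\<alpha> < 1" and \<delta>1: "\<delta> < 1" using mn unfolding \<alpha>_def \<delta>_def by linarith+
  have ku: "k \<bullet> u = - (C * ((1 - n) / m))" "k \<bullet> w = C" "k' \<bullet> u = C * (n / m)" "k' \<bullet> w = C"
    by (simp_all add: k_def k'_def inner_diff_left inner_add_left dual)
  have C: "C > 0" using pos by (simp add: C_def)
  note le = diagonal_form_le[OF Q]
  have neg: "- a * b \<le> h" "a * - b \<le> h" if "0 \<le> a" "0 \<le> b" "0 \<le> h" for a b h :: real
    using mult_nonneg_nonneg[OF that(1,2)] that(3) by simp_all
  have b1: "k \<bullet> (p - c) \<le> C * (1 - n)" if "p \<in> Q" for p
  proof (rule le[OF that])
    show "(1 - m) * (k \<bullet> u) \<le> C * (1 - n)" "- n * (k \<bullet> w) \<le> C * (1 - n)"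
      unfolding ku by (intro neg; use mn C in simp)+
    show "- m * (k \<bullet> u) \<le> C * (1 - n)" "(1 - n) * (k \<bullet> w) \<le> C * (1 - n)"
      unfolding ku using mn by simp_all
  qed
  have d3: "- k' \<bullet> (p - c) \<le> C * n" if "p \<in> Q" for p
  proof (rule le[OF that])
    have e: "- k' \<bullet> u = - (C * (n / m))" "- k' \<bullet> w = - C" by (simp_all add: ku)
    show "(1 - m) * (- k' \<bullet> u) \<le> C * n" "(1 - n) * (- k' \<bullet> w) \<le> C * n"
      unfolding e by (intro neg; use mn C in simp)+
    show "- m * (- k' \<bullet> u) \<le> C * n" "- n * (- k' \<bullet> w) \<le> C * n"
      unfolding e using mn by simp_all
  qed
  have b3: "- (\<alpha> *\<^sub>R k') \<bullet> (p - c) \<le> C * (\<alpha> * n)" if "p \<in> Q" for p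
    using mult_left_mono[OF d3[OF that] \<alpha>0] by (simp add: mult_ac)
  have d1: "(\<delta> *\<^sub>R k) \<bullet> (p - c) \<le> C * (\<delta> * (1 - n))" if "p \<in> Q" for p
    using mult_left_mono[OF b1[OF that] \<delta>0] by (simp add: mult_ac)
  have b2: "(\<alpha> *\<^sub>R k' - k) \<bullet> (p - c) \<le> C * (1 - m)" if "p \<in> Q" for p
  proof (rule le[OF that])
    have "(\<alpha> *\<^sub>R k' - k) \<bullet> u = C * ((\<alpha> * n + (1 - n)) / m)"
      by (simp add: inner_diff_left ku) (simp add: algebra_simps add_divide_distrib diff_divide_distrib)
    then have e1: "(\<alpha> *\<^sub>R k' - k) \<bullet> u = C" unfolding an using mn by (simp add: field_simps)
    have "\<alpha> - 1 = - ((1 - m) / n)" using mn by (simp add: \<alpha>_def field_simps)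
    moreover have "(\<alpha> *\<^sub>R k' - k) \<bullet> w = C * (\<alpha> - 1)"
      by (simp add: inner_diff_left ku algebra_simps)
    ultimately have e2: "(\<alpha> *\<^sub>R k' - k) \<bullet> w = - (C * ((1 - m) / n))" by simp
    show "- m * ((\<alpha> *\<^sub>R k' - k) \<bullet> u) \<le> C * (1 - m)" "(1 - n) * ((\<alpha> *\<^sub>R k' - k) \<bullet> w) \<le> C * (1 - m)"
      unfolding e1 e2 by (intro neg; use mn C in simp)+
    show "(1 - m) * ((\<alpha> *\<^sub>R k' - k) \<bullet> u) \<le> C * (1 - m)" "- n * ((\<alpha> *\<^sub>R k' - k) \<bullet> w) \<le> C * (1 - m)"
      unfolding e1 e2 using mn by simp_all
  qed
  have d2: "(k' - \<delta> *\<^sub>R k) \<bullet> (p - c) \<le> C * (1 - m)" if "p \<in> Q" for p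
  proof (rule le[OF that])
    have "(k' - \<delta> *\<^sub>R k) \<bullet> u = C * ((n + \<delta> * (1 - n)) / m)"
      by (simp add: inner_diff_left ku) (simp add: algebra_simps add_divide_distrib diff_divide_distrib)
    then have e1: "(k' - \<delta> *\<^sub>R k) \<bullet> u = C" unfolding dn using mn by (simp add: field_simps)
    have "1 - \<delta> = (1 - m) / (1 - n)" using mn by (simp add: \<delta>_def field_simps)
    moreover have "(k' - \<delta> *\<^sub>R k) \<bullet> w = C * (1 - \<delta>)"
      by (simp add: inner_diff_left ku algebra_simps)
    ultimately have e2: "(k' - \<delta> *\<^sub>R k) \<bullet> w = C * ((1 - m) / (1 - n))" by simp
    show "- m * ((k' - \<delta> *\<^sub>R k) \<bullet> u) \<le> C * (1 - m)" "- n * ((k' - \<delta> *\<^sub>R k) \<bullet> w) \<le> C * (1 - m)"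
      unfolding e1 e2 by (intro neg; use mn C in simp)+
    show "(1 - m) * ((k' - \<delta> *\<^sub>R k) \<bullet> u) \<le> C * (1 - m)" "(1 - n) * ((k' - \<delta> *\<^sub>R k) \<bullet> w) \<le> C * (1 - m)"
      unfolding e1 e2 using mn by simp_all
  qed
  \<comment> \<open>All four sums equal \<open>C\<close>, since
    \<open>\<alpha> * n = m + n - 1\<close> and \<open>\<delta> * (1 - n) = m - n\<close>.\<close>
  have s1: "C * (1 - n) + C * (1 - m) + C * (\<alpha> * n) \<le> C" "C * (\<alpha> * n) + C * (1 - m) + C * (1 - n) \<le> C"
    unfolding an by (simp_all add: algebra_simps)
  have s2: "C * (\<delta> * (1 - n)) + C * (1 - m) + C * n \<le> C" "C * n + C * (1 - m) + C * (\<delta> * (1 - n)) \<le> C"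
    unfolding dn by (simp_all add: algebra_simps)
  note worm = worm_edges[OF shapes pos, folded C_def]
  have "\<exists>t. t \<in> K \<and> t + k \<in> K \<and> t - - (\<alpha> *\<^sub>R k') \<in> K"
    by (rule worm[OF _ b1 b2 b3 s1(1)]) simp
  then obtain O1 where O1: "O1 \<in> K" "O1 + k \<in> K" "O1 + \<alpha> *\<^sub>R k' \<in> K" by auto
  have "\<exists>t. t \<in> K \<and> t + - (\<alpha> *\<^sub>R k') \<in> K \<and> t - k \<in> K"
    by (rule worm[OF _ b3 b2 b1 s1(2)]) simp
  then obtain P1 where P1: "P1 \<in> K" "P1 - k \<in> K" "P1 - \<alpha> *\<^sub>R k' \<in> K" by auto
  have "\<exists>t. t \<in> K \<and> t + \<delta> *\<^sub>R k \<in> K \<and> t - - k' \<in> K"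
    by (rule worm[OF _ d1 d2 d3 s2(1)]) simp
  then obtain O2 where O2: "O2 \<in> K" "O2 + k' \<in> K" "O2 + \<delta> *\<^sub>R k \<in> K" by auto
  have "\<exists>t. t \<in> K \<and> t + - k' \<in> K \<and> t - \<delta> *\<^sub>R k \<in> K"
    by (rule worm[OF _ d3 d2 d1 s2(2)]) simp
  then obtain P2 where P2: "P2 \<in> K" "P2 - k' \<in> K" "P2 - \<delta> *\<^sub>R k \<in> K" by auto
  have K: "convex K" "compact K" using shapes by (auto simp: convex_shape_def)
  have "(1 - \<alpha> * \<delta>) * crs k' k \<le> (2 - \<alpha> - \<delta>) * area K"
    by (rule area_four_triangles[OF K O1 P1 O2 P2 \<alpha>0 \<alpha>1 \<delta>0 \<delta>1])
  moreover have "crs k' k = C\<^sup>2 / (m * crs u w)"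
  proof -
    have "crs k' k = C\<^sup>2 * (crs us ws * (n / m + (1 - n) / m))"
      by (simp add: k_def k'_def crs_simps crs_anti[of ws us] power2_eq_square algebra_simps
          add_divide_distrib diff_divide_distrib)
    also have "n / m + (1 - n) / m = 1 / m" by (simp add: add_divide_distrib[symmetric])
    finally show ?thesis by (simp add: cus)
  qed
  \<comment> \<open>This identity cancels the \<open>m\<close> in \<open>crs k' k\<close>, so that
    only the area of \<open>Q\<close> survives.\<close>
  moreover have "1 - \<alpha> * \<delta> = m * (2 - \<alpha> - \<delta>)"
    using mn unfolding \<alpha>_def \<delta>_def by (simp add: divide_simps) (simp add: algebra_simps)
  ultimately have "(2 - \<alpha> - \<delta>) * (C\<^sup>2 / crs u w) \<le> (2 - \<alpha> - \<delta>) * area K"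
    using mn by simp
  then have "C\<^sup>2 / crs u w \<le> area K"
    by (rule mult_left_le_imp_le) (use \<alpha>1 \<delta>1 in simp)
  then show ?thesis using D by (simp add: C_def field_simps)
qed

text \<open>The cases ask which of \<open>m\<close>, \<open>1 - m\<close>, \<open>n\<close>,
  \<open>1 - n\<close> is largest. Reversing \<open>w\<close> corrects the sign of
  \<open>crs u w\<close> and merely exchanges the two maximality conditions.\<close>

lemma viterbo_diagonal_form:
  assumes shapes: "convex_shape K" "convex_shape Q" and pos: "0 < ehz_lagr K Q"
    and Q: "diagonal_form Q c u w m n" and D: "crs u w \<noteq> 0"
  shows "(1/2) * (ehz_lagr K Q)\<^sup>2 \<le> area K * area Q"
proof -
  have key: "(ehz_lagr K Q)\<^sup>2 \<le> \<bar>crs u w\<bar> * area K"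
    if Q: "diagonal_form Q c u w m n" and D: "crs u w \<noteq> 0" and max: "n \<le> m" "1 - n \<le> m" for u w m n
  proof (cases "crs u w > 0")
    case True
    then show ?thesis using ehz_le_diagonal_form[OF shapes pos Q True max] by simp
  next
    case False
    then have "(ehz_lagr K Q)\<^sup>2 \<le> crs u (- w) * area K"
      using D max by (intro ehz_le_diagonal_form[OF shapes pos diagonal_form_sym(2)[OF Q]]) (auto simp: crs_simps)
    then show ?thesis using False by (simp add: crs_simps)
  qed
  have "(ehz_lagr K Q)\<^sup>2 \<le> \<bar>crs u w\<bar> * area K"
  proof -
    note sym = diagonal_form_sym
    consider "n \<le> m" "1 - n \<le> m" | "n \<le> 1 - m" "1 - n \<le> 1 - m" | "m \<le> n" "1 - m \<le> n" | "m \<le> 1 - n" "1 - m \<le> 1 - n"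
      by linarith
    then show ?thesis
    proof cases
      case 1
      then show ?thesis using key[OF Q D] by blast
    next
      case 2
      then show ?thesis using key[OF sym(1)[OF Q]] D by (simp add: crs_simps)
    next
      case 3
      then show ?thesis using key[OF sym(3)[OF Q]] D by (simp add: crs_anti[of w u])
    next
      case 4
      then show ?thesis using key[OF sym(1)[OF sym(3)[OF Q]]] D by (simp add: crs_simps crs_anti[of w u])
    qed
  qed
  also have "\<dots> \<le> (2 * area Q) * area K"
    using diagonal_form_area(3)[OF Q] area_nonneg by (intro mult_right_mono) auto
  finally show ?thesis by (simp add: mult.commute mult.left_commute)
qed

section \<open>The regular hexagon and its affine images\<close>

lemma regular_hexagon_vertices:
  "regular_hexagon = convex hull {pt 1 0, pt (1/2) (sqrt 3/2), pt (-1/2) (sqrt 3/2), pt (-1) 0,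
     pt (-1/2) (- sqrt 3/2), pt (1/2) (- sqrt 3/2)}"
proof -
  have set6: "{..<6::nat} = {0, 1, 2, 3, 4, 5}" by auto
  have cs: "cos (pi / 3) = 1/2" "sin (pi / 3) = sqrt 3/2"
    by (simp_all add: cos_60 sin_60)
  have 2: "cos (2 * pi / 3) = - 1/2" "sin (2 * pi / 3) = sqrt 3/2"
    using cos_minus[of "pi/3"] cos_periodic_pi[of "- (pi/3)"] sin_periodic_pi[of "- (pi/3)"] cs by (simp_all add: field_simps)
  have 4: "cos (4 * pi / 3) = - 1/2" "sin (4 * pi / 3) = - sqrt 3/2"
    using cos_periodic_pi[of "pi/3"] sin_periodic_pi[of "pi/3"] cs by (simp_all add: field_simps)
  have 5: "cos (5 * pi / 3) = 1/2" "sin (5 * pi / 3) = - sqrt 3/2"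
    using cos_periodic_pi[of "2 * pi/3"] sin_periodic_pi[of "2 * pi/3"] 2 by (simp_all add: field_simps)
  show ?thesis
    unfolding regular_hexagon_def set6 by (simp add: cs 2 4 5 insert_commute)
qed

text \<open>The three forms belong to the three pairs of opposite sides: each is 1 on one side of
  its pair and -1 on the other.\<close>

lemma regular_hexagon_bounds:
  assumes "x \<in> regular_hexagon"
  shows "\<bar>x$1 + x$2 / sqrt 3\<bar> \<le> 1" "\<bar>2 * x$2 / sqrt 3\<bar> \<le> 1" "\<bar>x$1 - x$2 / sqrt 3\<bar> \<le> 1"
proof -
  have le: "A * x$1 + B * x$2 \<le> 1"
    if "\<bar>A\<bar> \<le> 1" "\<bar>A/2 + B * (sqrt 3/2)\<bar> \<le> 1" "\<bar>A/2 - B * (sqrt 3/2)\<bar> \<le> 1" for A B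
  proof -
    have "regular_hexagon \<subseteq> UNIV \<inter> {z::real^2. A * z$1 + B * z$2 \<le> 1}"
      unfolding regular_hexagon_vertices
    proof (rule hull_minimal)
      show "convex (UNIV \<inter> {z::real^2. A * z$1 + B * z$2 \<le> 1})"
        unfolding linear_form_crs crs_inner by (auto intro: convex_halfspace_le)
    qed (use that in \<open>auto simp: abs_le_iff\<close>)
    then show ?thesis using assms by auto
  qed
  have le': "A * x$1 + B * (x$2 / sqrt 3) \<le> 1"
    if "\<bar>A\<bar> \<le> 1" "\<bar>A/2 + B/2\<bar> \<le> 1" "\<bar>A/2 - B/2\<bar> \<le> 1" for A B
    using le[of A "B / sqrt 3"] that by simp
  show "\<bar>x$1 + x$2 / sqrt 3\<bar> \<le> 1" "\<bar>x$1 - x$2 / sqrt 3\<bar> \<le> 1"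
    using le'[of 1 1] le'[of "-1" "-1"] le'[of 1 "-1"] le'[of "-1" 1] by (simp_all add: abs_le_iff)
  have "2 * x$2 / sqrt 3 = 2 * (x$2 / sqrt 3)" by simp
  then show "\<bar>2 * x$2 / sqrt 3\<bar> \<le> 1"
    using le'[of 0 2] le'[of 0 "-2"] by linarith
qed

text \<open>The chord bound for a long diagonal \<open>l\<close>, with the two parallel sides as
  chords of half its length; exchanging these sides covers the other sign of
  \<open>det M\<close>.\<close>

lemma affine_hexagon_area:
  assumes Q: "Q = (\<lambda>x. M *v x + b) ` regular_hexagon"
  shows "convex Q" "compact Q" "3 * sqrt 3 / 2 * \<bar>det M\<bar> \<le> area Q"
proof -
  have lin: "linear ((*v) M)" by (rule matrix_vector_mul_linear)
  have Q': "Q = (\<lambda>x. b + x) ` ((*v) M ` regular_hexagon)" unfolding Q by (auto simp: add.commute)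
  have H: "convex regular_hexagon" "compact regular_hexagon"
    unfolding regular_hexagon_vertices by (auto intro: finite_imp_compact_convex_hull)
  show cQ: "convex Q" "compact Q" unfolding Q'
    by (intro convex_translation convex_linear_image lin H compact_translation
      compact_continuous_image[OF linear_continuous_on] lin[unfolded linear_conv_bounded_linear])+
  have Mv: "M *v x + b \<in> Q" if "x \<in> regular_hexagon" for x using that Q by blast
  have verts: "pt 1 0 \<in> regular_hexagon" "pt (-1) 0 \<in> regular_hexagon" "pt (1/2) (sqrt 3/2) \<in> regular_hexagon"
    "pt (-1/2) (sqrt 3/2) \<in> regular_hexagon" "pt (1/2) (- sqrt 3/2) \<in> regular_hexagon" "pt (-1/2) (- sqrt 3/2) \<in> regular_hexagon"
    unfolding regular_hexagon_vertices by (auto intro: hull_inc)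
  define l where "l = M *v pt 2 0"
  have shift: "M *v x + b + r *\<^sub>R l \<in> Q" if "x + r *\<^sub>R pt 2 0 \<in> regular_hexagon" for x r
    using Mv[OF that] by (simp only: l_def matrix_vector_right_distrib matrix_vector_mult_scaleR add_ac)
  have z: "M *v pt (-1) 0 + b \<in> Q" "M *v pt (-1) 0 + b + l \<in> Q"
    using Mv[OF verts(2)] shift[of "pt (-1) 0" 1] verts(1) by simp_all
  have q: "M *v pt (-1/2) (sqrt 3/2) + b \<in> Q" "M *v pt (-1/2) (sqrt 3/2) + b + (1/2) *\<^sub>R l \<in> Q"
    using Mv[OF verts(4)] shift[of "pt (-1/2) (sqrt 3/2)" "1/2"] verts(3) by simp_all
  have q': "M *v pt (-1/2) (- sqrt 3/2) + b \<in> Q" "M *v pt (-1/2) (- sqrt 3/2) + b + (1/2) *\<^sub>R l \<in> Q"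
    using Mv[OF verts(6)] shift[of "pt (-1/2) (- sqrt 3/2)" "1/2"] verts(5) by simp_all
  have cr: "crs l (M *v pt (-1/2) (sqrt 3/2) + b - (M *v pt (-1/2) (- sqrt 3/2) + b)) = 2 * sqrt 3 * det M"
    "crs l (M *v pt (-1/2) (- sqrt 3/2) + b - (M *v pt (-1/2) (sqrt 3/2) + b)) = - (2 * sqrt 3 * det M)"
    by (simp_all add: l_def crs_def matrix_vector_mult_def sum_2 det_2 algebra_simps)
  have "(1 - 1/2) * crs l ((M *v pt (-1) 0 + b) - (M *v pt (-1) 0 + b)) + 2 * sqrt 3 * det M + 1/2 * (2 * sqrt 3 * det M) \<le> 2 * area Q"
    unfolding cr(1)[symmetric] by (intro area_chords[OF cQ z z q q']) (use q q' in auto)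
  moreover have "(1 - 1/2) * crs l ((M *v pt (-1) 0 + b) - (M *v pt (-1) 0 + b)) + - (2 * sqrt 3 * det M) + 1/2 * - (2 * sqrt 3 * det M) \<le> 2 * area Q"
    unfolding cr(2)[symmetric] by (intro area_chords[OF cQ z z q' q]) (use q q' in auto)
  ultimately have "\<bar>3 * sqrt 3 * det M\<bar> \<le> 2 * area Q"
    by (simp add: abs_le_iff crs_simps(11) mult_ac)
  then show "3 * sqrt 3 / 2 * \<bar>det M\<bar> \<le> area Q" by (simp add: abs_mult)
qed

lemma viterbo_hexagon:
  assumes shapes: "convex_shape K" "convex_shape Q" and pos: "0 < ehz_lagr K Q"
    and M: "det M \<noteq> 0" and Q: "Q = (\<lambda>x. M *v x + b) ` regular_hexagon"
  shows "(1/2) * (ehz_lagr K Q)\<^sup>2 \<le> area K * area Q"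
proof -
  define C where "C = ehz_lagr K Q"
  define a1 where "a1 = M *v pt 1 0"
  define a2 where "a2 = M *v pt 0 1"
  have D: "crs a1 a2 = det M"
    by (simp add: a1_def a2_def crs_def matrix_vector_mult_def sum_2 det_2 algebra_simps)
  obtain us ws where dual: "us \<bullet> a1 = 1" "us \<bullet> a2 = 0" "ws \<bullet> a1 = 0" "ws \<bullet> a2 = 1"
    and cus: "crs us ws = 1 / det M"
    using dual_basis[of a1 a2] D M by metis
  \<comment> \<open>\<open>e1\<close>, \<open>e2\<close> and \<open>e1 - e2\<close> are normal to
    the three pairs of sides, scaled to reach \<open>C / 2\<close> on both sides of the centre
    \<open>b\<close>, so that each segment traversed twice has length \<open>C\<close>.\<close>
  define e1 where "e1 = (C / 2) *\<^sub>R (us + (1 / sqrt 3) *\<^sub>R ws)"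
  define e2 where "e2 = (C / 2) *\<^sub>R ((2 / sqrt 3) *\<^sub>R ws)"
  have C: "C > 0" using pos by (simp add: C_def)
  have e_bounds: "\<bar>e1 \<bullet> (p - b)\<bar> \<le> C / 2" "\<bar>e2 \<bullet> (p - b)\<bar> \<le> C / 2" "\<bar>(e1 - e2) \<bullet> (p - b)\<bar> \<le> C / 2" if p: "p \<in> Q" for p
  proof -
    obtain x where x: "x \<in> regular_hexagon" "p - b = M *v x" using p Q by auto
    have "M *v x = x$1 *\<^sub>R a1 + x$2 *\<^sub>R a2"
      by (simp add: a1_def a2_def vec_eq_iff matrix_vector_mult_def sum_2 algebra_simps)
    then have "us \<bullet> (p - b) = x$1" "ws \<bullet> (p - b) = x$2"
      by (simp_all add: x(2) inner_add_right dual)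
    then have "e1 \<bullet> (p - b) = C / 2 * (x$1 + x$2 / sqrt 3)" "e2 \<bullet> (p - b) = C / 2 * (2 * x$2 / sqrt 3)"
      "(e1 - e2) \<bullet> (p - b) = C / 2 * (x$1 - x$2 / sqrt 3)"
      by (simp_all add: e1_def e2_def inner_diff_left inner_add_left) (simp_all add: field_simps)
    moreover have "\<bar>C / 2 * y\<bar> \<le> C / 2" if "\<bar>y\<bar> \<le> 1" for y
      using mult_left_mono[OF that, of "C / 2"] C by (simp add: abs_mult)
    ultimately show "\<bar>e1 \<bullet> (p - b)\<bar> \<le> C / 2" "\<bar>e2 \<bullet> (p - b)\<bar> \<le> C / 2" "\<bar>(e1 - e2) \<bullet> (p - b)\<bar> \<le> C / 2"
      using regular_hexagon_bounds[OF x(1)] by (simp_all only:)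
  qed
  note worm = worm_edges[OF shapes pos, folded C_def]
  have seg: "\<exists>t. t \<in> K \<and> t + e \<in> K" if "\<And>p. p \<in> Q \<Longrightarrow> \<bar>e \<bullet> (p - b)\<bar> \<le> C / 2" for e
  proof -
    have "\<exists>t. t \<in> K \<and> t + e \<in> K \<and> t - 0 \<in> K"
    proof (rule worm[of e "- e" 0 b "C/2" "C/2" 0])
      fix p assume "p \<in> Q"
      from that[OF this] show "e \<bullet> (p - b) \<le> C / 2" "- e \<bullet> (p - b) \<le> C / 2" "0 \<bullet> (p - b) \<le> 0"
        by (simp_all add: abs_le_iff)
    qed simp_all
    then show ?thesis by blast
  qed
  \<comment> \<open>At two thirds of the segments an edge contributes \<open>C / 3\<close>, so a
    triangle with three such edges again has length \<open>C\<close>.\<close>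
  have third: "((2/3) *\<^sub>R e) \<bullet> (p - b) \<le> C / 3" "(- (2/3) *\<^sub>R e) \<bullet> (p - b) \<le> C / 3" if "\<bar>e \<bullet> (p - b)\<bar> \<le> C / 2" for e p
    using that by (auto simp: abs_le_iff)
  obtain h where h: "h \<in> K" "h + e1 \<in> K" using seg[of e1] e_bounds(1) by blast
  obtain v where v: "v \<in> K" "v + e2 \<in> K" using seg[of e2] e_bounds(2) by blast
  obtain g where g: "g \<in> K" "g + (e1 - e2) \<in> K" using seg[of "e1 - e2"] e_bounds(3) by blast
  have "\<exists>t. t \<in> K \<and> t + (2/3) *\<^sub>R e1 \<in> K \<and> t - (- (2/3)) *\<^sub>R e2 \<in> K"
    by (rule worm[OF _ third(1)[OF e_bounds(1)] third(2)[OF e_bounds(3)] third(2)[OF e_bounds(2)]])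
      (simp_all add: algebra_simps)
  then obtain t' where t': "t' \<in> K" "t' + (2/3) *\<^sub>R e1 \<in> K" "t' + (2/3) *\<^sub>R e2 \<in> K" by auto
  have "\<exists>t. t \<in> K \<and> t + (- (2/3)) *\<^sub>R e1 \<in> K \<and> t - (2/3) *\<^sub>R e2 \<in> K"
    by (rule worm[OF _ third(2)[OF e_bounds(1)] third(1)[OF e_bounds(3)] third(1)[OF e_bounds(2)]])
      (simp_all add: algebra_simps)
  then obtain t where t: "t \<in> K" "t + (- (2/3)) *\<^sub>R e1 \<in> K" "t - (2/3) *\<^sub>R e2 \<in> K" by blast
  have K: "convex K" "compact K" using shapes by (auto simp: convex_shape_def)
  have A: "2/3 * \<bar>crs e1 e2\<bar> \<le> area K"
    by (rule area_hexagon_worms[OF K h v g t(1) _ _ t']) (use t in simp_all)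
  have "crs e1 e2 = C\<^sup>2 / (2 * sqrt 3 * det M)"
    by (simp add: e1_def e2_def crs_simps cus power2_eq_square)
  then have "2/3 * (C\<^sup>2 / (2 * sqrt 3 * \<bar>det M\<bar>)) \<le> area K" using A by (simp add: abs_mult)
  then have "2/3 * (C\<^sup>2 / (2 * sqrt 3 * \<bar>det M\<bar>)) * (3 * sqrt 3 / 2 * \<bar>det M\<bar>) \<le> area K * area Q"
    using affine_hexagon_area(3)[OF Q] by (intro mult_mono area_nonneg) auto
  then show ?thesis using M by (simp add: C_def)
qed

theorem theorem1p2:
  fixes K Q :: "(real^2) set"
  assumes "convex_shape K"
    and "convex_quadrilateral Q \<or> affinely_regular_hexagon Q"
  shows "area K * area Q \<ge> (1/2) * (ehz_lagr K Q)^2"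
proof -
  from assms(2) have "convex_shape Q \<and> (0 < ehz_lagr K Q \<longrightarrow> (1/2) * (ehz_lagr K Q)\<^sup>2 \<le> area K * area Q)"
  proof
    assume "convex_quadrilateral Q"
    then obtain c u w m n where D: "crs u w \<noteq> 0" and "0 < m" "m < 1" "0 < n" "n < 1"
      "Q = convex hull {c - m *\<^sub>R u, c + (1 - m) *\<^sub>R u, c - n *\<^sub>R w, c + (1 - n) *\<^sub>R w}"
      by (rule quadrilateral_diagonals)
    then have Q: "diagonal_form Q c u w m n" by (simp add: diagonal_form_def)
    have "convex_shape Q"
      using diagonal_form_area[OF Q] D by (intro convex_shapeI) auto
    then show ?thesis using viterbo_diagonal_form[OF assms(1) _ _ Q D] by blast
  next
    assume "affinely_regular_hexagon Q"
    then obtain M b where "invertible M" and Q: "Q = (\<lambda>x. M *v x + b) ` regular_hexagon"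
      unfolding affinely_regular_hexagon_def by blast
    then have M: "det M \<noteq> 0" by (simp add: invertible_det_nz)
    then have "0 < 3 * sqrt 3 / 2 * \<bar>det M\<bar>" by simp
    then have "convex_shape Q"
      using affine_hexagon_area[OF Q] by (intro convex_shapeI) linarith+
    then show ?thesis using viterbo_hexagon[OF assms(1) _ _ M Q] by blast
  qed
  \<comment> \<open>For capacity 0 only the areas have to be nonnegative; a nonzero capacity is
    positive.\<close>
  then show ?thesis
    using ehz_lagr_nonneg[OF assms(1), of Q] area_nonneg[of K] area_nonneg[of Q]
    by (cases "ehz_lagr K Q = 0") auto
qed

end
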